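(* Let $\check R(z)$ be the normalized $R$-matrix of the $8$-dimensional first fundamental representation $\tilde L_1$ of the twisted quantum affine algebra $U_q(\mathrm D_4^{(3)})$, regarded as an operator on $\tilde L_1\otimes\tilde L_1$, where $\tilde L_1\cong L_{\omega_1}\oplus L_{\omega_0}$ as a $U_q(\mathrm G_2)$-module. Then $$\check{R}(z)=P_{2\omega_1}^q-q^{-2}\frac{1-q^{2}z}{1-q^{-2}z}P_{\omega_2}^q + \frac{q^{-5}f_{\omega_1}(z)}{(1-q^{-2}z)(1+q^{-4}z+q^{-8}z^2)}\otimes P_{\omega_1}^q+\frac{q^{-8}f_{\omega_0}(z)}{(1-q^{-2}z)(1-q^{-6}z)(1+q^{-4}z+q^{-8}z^2)}\otimes P_{\omega_0}^q ,$$ where $$f_{\omega_1}(z)=\begin{bmatrix}-q^{-3}-q^{-2}\alpha z+q^{2}\alpha z^2+q^{3}z^3 & \beta z(1-z) & \beta z(1-z)\\ \gamma z(1-z) & \beta z(q^{3}+q^{-3}z) & (1-z)(q^{3}+\kappa z+q^{-3}z^2)\\ \gamma z(1-z) & (1-z)(q^{3}+\kappa z+q^{-3}z^2) & \beta z(q^{3}+q^{-3}z)\end{bmatrix},$$ $$f_{\omega_0}(z)=\begin{bmatrix}q^{-6}-q^{-3}\zeta z+\xi z^2-q^{3}\zeta z^3+q^{6}z^4 & \eta z(1-z^2)\\ \rho z(1-z^2) & q^{6}-q^{3}\zeta z+\xi z^2-q^{-3}\zeta z^3+q^{-6}z^4 \end{bmatrix},$$ and $$\alpha=\frac{[2]^{\mathrm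 i}[2]_{3}^{\mathrm i}}{[2]},\ \ \beta=\frac{[2]_{3}^{\mathrm i}}{[2]},\ \ \gamma=\frac{[2]_{3}^{\mathrm i}[2]_4}{[2]},\ \ \kappa=\frac{[2]_{2}}{[2]},\ \ \zeta=\frac{[2]_{4}}{[2]},\ \ \eta=\frac{[2]_{3}^{\mathrm i}}{[2]},\ \ \rho=\frac{[2]_{3}^{\mathrm i}[3]_{2}^{\mathrm i}[7]}{[2]},\ \ \xi=[2]^{\mathrm i}[2]_3^{\mathrm i}[2]_4 .$$
   Context: Fix $q\in\mathbb C^\times$, not a root of unity, and a square root $q^{1/2}$. Notation: $[n]_k=\frac{q^{kn}-q^{-kn}}{q^k-q^{-k}}$, $[n]_k^{\mathrm i}=\frac{q^{kn}+(-1)^{n-1}q^{-kn}}{q^k+q^{-k}}$, $[n]=[n]_1$, $[n]^{\mathrm i}=[n]^{\mathrm i}_1$. Square roots $\sqrt{[2]},\sqrt{[3]}$ are fixed. Algebra. $U_q(\mathrm D_4^{(3)})$ (level zero) is generated by $E_i,F_i,K_i^{\pm1}$, $i=0,1,2$, with $(d_0,d_1,d_2)=(1,1,3)$, $q_i=q^{d_i}$, symmetrized Cartan matrix $B$ with $B_{ii}=2d_i$, $B_{01}=B_{10}=-1$, $B_{12}=B_{21}=-3$, $B_{02}=B_{20}=0$, Cartan matrix $C_{ij}=B_{ij}/d_i$. Relations: the $K_i$ are invertible and commute, $K_0K_1^2K_2=1$, $K_iE_jK_i^{-1}=q^{B_{ij}}E_j$, $K_iF_jK_i^{-1}=q^{-B_{ij}}F_j$,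 $[E_i,F_j]=\delta_{ij}\frac{K_i-K_i^{-1}}{q_i-q_i^{-1}}$, and the quantum Serre relations. Coproduct: $\Delta K_i=K_i\otimes K_i$, $\Delta E_i=E_i\otimes K_i^{1/2}+K_i^{-1/2}\otimes E_i$, $\Delta F_i=F_i\otimes K_i^{1/2}+K_i^{-1/2}\otimes F_i$, where $K_i^{\pm1/2}$ acts by $q_i^{\pm\lambda_i/2}$ on a vector on which $K_i$ acts by $q_i^{\lambda_i}$. The subalgebra generated by $E_i,F_i,K_i^{\pm1}$, $i=1,2$, is $U_q(\mathrm G_2)$; $L_\lambda$ is its irreducible (type 1) module of highest weight $\lambda$, $\omega_1,\omega_2$ are the fundamental weights, $\omega_0=0$. First fundamental module. $\tilde L_1(a)$, $a\in\mathbb C^\times$, has basis $v_1,\dots,v_8$, with $v_1,\dots,v_7$ a basis of $L_{\omega_1}$ ($v_1$ of weight $\omega_1$) and $v_8$ spanning $L_{\omega_0}$. The nonzero actions of $F_1,F_2$ are $F_1v_1=v_2$, $F_2v_2=v_3$, $F_1v_3=\sqrt{[2]}v_4$, $F_1v_4=\sqrt{[2]}v_5$, $F_2v_5=v_6$, $F_1v_6=v_7$; $E_1,E_2$ are the transposes of $F_1,F_2$. With $E_{ij}$ matrix units, $K_0=q^{-2}E_{11}+q^{-1}(E_{22}+E_{33})+E_{44}+E_{88}+q(E_{55}+E_{66})+q^2E_{77}$, $E_0(a)=\frac{a}{\sqrt{[2]}}(E_{41}+E_{74})+a\frac{\sqrt{[3]}}{\sqrt{[2]}}(E_{81}+E_{78})+a(E_{52}+E_{63})$,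 and $F_0(a)$ is the transpose of $a^{-2}E_0(a)$. (In terms of Drinfeld polynomials this is the first fundamental module, up to an overall rescaling of $a$ that does not affect $\check R$.) $R$-matrix. $\check R(z)$ is the rational $\mathrm{End}(\tilde L_1\otimes\tilde L_1)$-valued function of $z$ (the flip composed with the universal $R$-matrix evaluated on $\tilde L_1(z)\otimes\tilde L_1(1)$, normalized) such that for generic $a/b$ the map $\check R(a/b):\tilde L_1(a)\otimes\tilde L_1(b)\to\tilde L_1(b)\otimes\tilde L_1(a)$ is the unique module homomorphism with $v_1\otimes v_1\mapsto v_1\otimes v_1$. Projectors. As $U_q(\mathrm G_2)$-modules, $\tilde L_1^{\otimes2}\cong L_{2\omega_1}\oplus L_{\omega_2}\oplus 3L_{\omega_1}\oplus 2L_{\omega_0}$. For $\lambda=2\omega_1,\omega_2$, $P^q_\lambda$ is the projector onto $L_\lambda$ along the other isotypic components. Fix singular vectors of weight $\omega_1$: $u_1=\frac{1}{\sqrt{[3]}}\big(q^3v_1\otimes v_4-q^{3/2}\sqrt{[2]}\,v_2\otimes v_3+q^{-3/2}\sqrt{[2]}\,v_3\otimes v_2-q^{-3}v_4\otimes v_1\big)$, $u_2=v_1\otimes v_8$, $u_3=v_8\otimes v_1$; and of weight $\omega_0$: $w_1=\sum_{i=1}^7p_i^qv_i\otimes v_{8-i}$ with $(p_1^q,\dots,p_7^q)=(q^5,-q^4,q,-1,q^{-1},-q^{-4},q^{-5})$, $w_2=v_8\otimes v_8$. For a matrix $f=(f_{ij})$, $f\otimes P^q_{\omega_1}$ denotes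 the operator sending $Xu_j\mapsto\sum_if_{ij}Xu_i$ for all $X\in U_q(\mathrm G_2)$ and vanishing on the other isotypic components; likewise $f\otimes P^q_{\omega_0}$ with $w_1,w_2$. *)

theory Defs
  imports "HOL-Analysis.Analysis" "HOL-Computational_Algebra.Polynomial"
begin

text \<open>
  Throughout, \<open>h\<close> is the fixed square root of \<open>q\<close>, and \<open>r2\<close>, \<open>r3\<close> are the fixed square roots
  of \<open>[2]\<close> and \<open>[3]\<close>.  The index type \<^typ>\<open>8\<close> is arithmetic modulo 8, with elements
  \<open>1, \<dots>, 7, 8 = 0\<close>; so the basis vector \<open>v\<^sub>i\<close> is \<open>axis i 1\<close>, with the usual numbering.
  Operators on \<open>\<complex>\<^sup>8 \<otimes> \<complex>\<^sup>8\<close> are matrices indexed by \<^typ>\<open>8 \<times> 8\<close>.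
\<close>

definition qint :: "complex \<Rightarrow> int \<Rightarrow> int \<Rightarrow> complex" where
  "qint q k n = (q powi (k * n) - q powi (- (k * n))) / (q powi k - q powi (- k))"

definition qint_i :: "complex \<Rightarrow> int \<Rightarrow> int \<Rightarrow> complex" where
  "qint_i q k n =
     (q powi (k * n) + (- 1) powi (n - 1) * q powi (- (k * n))) / (q powi k + q powi (- k))"

definition dsym :: "nat \<Rightarrow> nat" where
  "dsym i = (if i = 2 then 3 else 1)"

definition Bsym :: "nat \<Rightarrow> nat \<Rightarrow> int" where
  "Bsym i j =
     (if i = j then 2 * int (dsym i)
      else if {i, j} = {0, 1} then - 1
      else if {i, j} = {1, 2} then - 3
      else 0)"

definition qbinom :: "complex \<Rightarrow> int \<Rightarrow> nat \<Rightarrow> nat \<Rightarrow> complex" where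
  "qbinom q k n m =
     (\<Prod>j=1..n. qint q k (int j)) / ((\<Prod>j=1..m. qint q k (int j)) * (\<Prod>j=1..n - m. qint q k (int j)))"

definition mpow :: "complex^'n^'n \<Rightarrow> nat \<Rightarrow> complex^'n^'n" where
  "mpow A k = (((**) A) ^^ k) (mat 1)"

definition serre :: "complex \<Rightarrow> (nat \<Rightarrow> complex^'n^'n) \<Rightarrow> bool" where
  "serre q E \<longleftrightarrow> (\<forall>i\<in>{0,1,2}. \<forall>j\<in>{0,1,2}. i \<noteq> j \<longrightarrow>
     (let N = nat (1 - Bsym i j div int (dsym i)) in
      (\<Sum>m=0..N. mat ((- 1) ^ m * qbinom q (int (dsym i)) N m) **
                  (mpow (E i) (N - m) ** E j ** mpow (E i) m)) = 0))"

text \<open>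
  The defining relations of \<open>U\<^sub>q(D\<^sub>4\<^sup>(\<^sup>3\<^sup>))\<close> at level zero, with \<open>K' i\<close> in the role of the inverse of \<open>K i\<close>.
  Homomorphisms and submodules below depend only on the action of the generators; the lemma
  \<open>L1_rep\<close> shows that the matrices used for \<open>L\<^sub>1(a)\<close> do form a representation.
\<close>

definition Uq_D43_rep ::
  "complex \<Rightarrow> (nat \<Rightarrow> complex^'n^'n) \<Rightarrow> (nat \<Rightarrow> complex^'n^'n) \<Rightarrow>
   (nat \<Rightarrow> complex^'n^'n) \<Rightarrow> (nat \<Rightarrow> complex^'n^'n) \<Rightarrow> bool" where
  "Uq_D43_rep q E F K K' \<longleftrightarrow>
     (\<forall>i\<in>{0,1,2}. K i ** K' i = mat 1 \<and> K' i ** K i = mat 1) \<and>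
     K 0 ** K 1 ** K 1 ** K 2 = mat 1 \<and>
     (\<forall>i\<in>{0,1,2}. \<forall>j\<in>{0,1,2}.
        K i ** K j = K j ** K i \<and>
        K i ** E j ** K' i = mat (q powi (Bsym i j)) ** E j \<and>
        K i ** F j ** K' i = mat (q powi (- Bsym i j)) ** F j \<and>
        E i ** F j - F j ** E i =
          (if i = j then mat (1 / (q ^ dsym i - inverse q ^ dsym i)) ** (K i - K' i) else 0)) \<and>
     serre q E \<and> serre q F"

definition munit :: "complex \<Rightarrow> 'n \<Rightarrow> 'n \<Rightarrow> complex^'n^'n" where
  "munit c i j = (\<chi> k l. if k = i \<and> l = j then c else 0)"

text \<open>
  \<open>K\<^sub>i\<close> acts on \<open>v\<^sub>k\<close> by \<open>q\<^sub>i\<close> to the power \<open>wt i $ k\<close>.  The rows for \<open>i = 1, 2\<close> are the weights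
  of \<open>v\<^sub>k\<close> in terms of the fundamental weights: \<open>v\<^sub>1\<close> has weight \<open>\<omega>\<^sub>1\<close>, the actions of \<open>F\<^sub>1\<close> and
  \<open>F\<^sub>2\<close> subtract \<open>\<alpha>\<^sub>1 = 2\<omega>\<^sub>1 - \<omega>\<^sub>2\<close> and \<open>\<alpha>\<^sub>2 = -3\<omega>\<^sub>1 + 2\<omega>\<^sub>2\<close>, and \<open>v\<^sub>8\<close> has weight 0.
\<close>

definition wt :: "nat \<Rightarrow> int^8" where
  "wt i = (if i = 0 then vector [-2, -1, -1, 0, 1, 1, 2, 0]
           else if i = 1 then vector [1, -1, 2, 0, -2, 1, -1, 0]
           else vector [0, 1, -1, 0, 1, -1, 0, 0])"

text \<open>
  \<open>Kop q i\<close> is \<open>K\<^sub>i\<close>; also \<open>Kop (inverse q) i\<close> is its inverse, and \<open>Kop h i\<close>,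
  \<open>Kop (inverse h) i\<close> are \<open>K\<^sub>i\<close> to the power \<open>1/2\<close> and \<open>-1/2\<close>.
\<close>

definition Kop :: "complex \<Rightarrow> nat \<Rightarrow> complex^8^8" where
  "Kop q i = (\<chi> k l. if k = l then q powi (int (dsym i) * wt i $ k) else 0)"

definition F1op :: "complex \<Rightarrow> complex^8^8" where
  "F1op r2 = munit 1 2 1 + munit r2 4 3 + munit r2 5 4 + munit 1 7 6"

definition F2op :: "complex^8^8" where
  "F2op = munit 1 3 2 + munit 1 6 5"

definition E0op :: "complex \<Rightarrow> complex \<Rightarrow> complex \<Rightarrow> complex^8^8" where
  "E0op r2 r3 a =
     munit (a / r2) 4 1 + munit (a / r2) 7 4
     + munit (a * (r3 / r2)) 8 1 + munit (a * (r3 / r2)) 7 8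
     + munit a 5 2 + munit a 6 3"

definition Eop :: "complex \<Rightarrow> complex \<Rightarrow> complex \<Rightarrow> nat \<Rightarrow> complex^8^8" where
  "Eop r2 r3 a i =
     (if i = 0 then E0op r2 r3 a
      else if i = 1 then transpose (F1op r2)
      else transpose F2op)"

definition Fop :: "complex \<Rightarrow> complex \<Rightarrow> complex \<Rightarrow> nat \<Rightarrow> complex^8^8" where
  "Fop r2 r3 a i =
     (if i = 0 then transpose (mat (1 / a\<^sup>2) ** E0op r2 r3 a)
      else if i = 1 then F1op r2
      else F2op)"

lemma munit_mult: "munit c i j ** munit d k l = (if j = k then munit (c*d) i l else (0::complex^'n^'n))"
proof -
  have "(\<Sum>m\<in>UNIV. munit c i j $ x $ m * munit d k l $ m $ y) = (if x = i \<and> y = l \<and> j = k then c * d else 0)" for x y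
  proof -
    have "(\<Sum>m\<in>UNIV. munit c i j $ x $ m * munit d k l $ m $ y) =
       (\<Sum>m\<in>UNIV. if m = j then (if x = i \<and> y = l \<and> j = k then c * d else 0) else 0)"
      by (rule sum.cong) (auto simp: munit_def)
    then show ?thesis by simp
  qed
  then show ?thesis
    by (auto simp: vec_eq_iff matrix_matrix_mult_def) (auto simp: munit_def)
qed

lemma if_mult: "(if P then c else 0) * x = (if P then c * x else 0)"
    "x * (if P then c else 0) = (if P then x * c else 0)" for c x :: complex
  by auto

lemma mat_scal: "mat c ** A = (\<chi> k l. c * A $ k $ l)" for A :: "complex^'n^'n"
  by (simp add: vec_eq_iff matrix_matrix_mult_def mat_def if_mult)

lemma munit_add: "munit c i j + munit d i j = munit (c + d) i j"
  by (auto simp: munit_def vec_eq_iff)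
lemma munit_0: "munit 0 i j = 0"
  by (auto simp: munit_def vec_eq_iff)
lemma mat_munit: "mat c ** munit d i j = munit (c * d) i j"
  by (simp add: mat_scal) (auto simp: munit_def vec_eq_iff)
lemma transpose_munit: "transpose (munit c i j) = munit c j i"
  by (auto simp: munit_def vec_eq_iff transpose_def)
lemma transpose_add: "transpose (A + B) = transpose A + (transpose B :: complex^'n^'n)"
  by (auto simp: vec_eq_iff transpose_def)
lemma mzero: "0 ** A = (0::complex^'n^'n)" "A ** 0 = (0::complex^'n^'n)"
  by (auto simp: vec_eq_iff matrix_matrix_mult_def)
lemma madd: "(A + B) ** C = A ** C + B ** (C :: complex^'n^'n)" "C ** (A + B) = C ** A + C ** (B :: complex^'n^'n)"
  by (simp_all add: vec_eq_iff matrix_matrix_mult_def sum.distrib distrib_left distrib_right)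
lemma forall_8: "(\<forall>i::8. P i) \<longleftrightarrow> P 1 \<and> P 2 \<and> P 3 \<and> P 4 \<and> P 5 \<and> P 6 \<and> P 7 \<and> P 8"
proof -
  have "UNIV = {1,2,3,4,5,6,7,8::8}"
    by (rule sym, rule card_subset_eq) simp_all
  then have "(\<forall>i::8. P i) \<longleftrightarrow> (\<forall>i\<in>{1,2,3,4,5,6,7,8}. P i)" by (metis UNIV_I)
  then show ?thesis by simp
qed

lemma wt_simps:
  "wt 0 $ 1 = -2" "wt 0 $ 2 = -1" "wt 0 $ 3 = -1" "wt 0 $ 4 = 0" "wt 0 $ 5 = 1" "wt 0 $ 6 = 1" "wt 0 $ 7 = 2" "wt 0 $ 8 = 0" "wt 0 $ 0 = 0"
  "wt (Suc 0) $ 1 = 1" "wt (Suc 0) $ 2 = -1" "wt (Suc 0) $ 3 = 2" "wt (Suc 0) $ 4 = 0" "wt (Suc 0) $ 5 = -2" "wt (Suc 0) $ 6 = 1" "wt (Suc 0) $ 7 = -1" "wt (Suc 0) $ 8 = 0" "wt (Suc 0) $ 0 = 0"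
  "wt 2 $ 1 = 0" "wt 2 $ 2 = 1" "wt 2 $ 3 = -1" "wt 2 $ 4 = 0" "wt 2 $ 5 = 1" "wt 2 $ 6 = -1" "wt 2 $ 7 = 0" "wt 2 $ 8 = 0" "wt 2 $ 0 = 0"
  by (simp_all add: wt_def vector_def)

lemma Kop_mult: "Kop q i ** A = (\<chi> k l. q powi (int (dsym i) * wt i $ k) * A $ k $ l)"
  "A ** Kop q i = (\<chi> k l. A $ k $ l * q powi (int (dsym i) * wt i $ l))"
  by (simp_all add: vec_eq_iff Kop_def matrix_matrix_mult_def if_mult)

lemmas ops = Eop_def Fop_def E0op_def F1op_def F2op_def transpose_add transpose_munit madd mat_munit munit_mult

lemma K_KK: assumes "q \<noteq> 0"
  shows "Kop q i ** Kop (inverse q) i = mat 1" "Kop (inverse q) i ** Kop q i = mat 1"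
  using assms by (auto simp: Kop_mult) (auto simp: vec_eq_iff Kop_def mat_def power_int_inverse)

lemma K_prod: assumes "q \<noteq> 0"
  shows "Kop q 0 ** Kop q 1 ** Kop q 1 ** Kop q 2 = mat 1"
proof -
  have "\<forall>k. wt 0 $ k + wt 1 $ k + wt 1 $ k + 3 * wt 2 $ k = 0"
    by (simp add: forall_8 wt_simps)
  then have "q powi (wt 0 $ k) * q powi (wt 1 $ k) * q powi (wt 1 $ k) * q powi (3 * wt 2 $ k) = 1" for k
    using assms by (simp flip: power_int_add)
  then show ?thesis
    unfolding Kop_mult(2) by (simp add: vec_eq_iff Kop_def mat_def dsym_def)
qed

lemma K_comm: "Kop q i ** Kop q j = Kop q j ** Kop q i"
  unfolding Kop_mult by (auto simp: vec_eq_iff Kop_def)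

lemma K_munit: assumes "q \<noteq> 0"
  shows "Kop q i ** munit c k l ** Kop (inverse q) i = munit (q powi (int (dsym i) * (wt i $ k - wt i $ l)) * c) k l"
  unfolding Kop_mult using assms
  by (auto simp: vec_eq_iff munit_def power_int_inverse right_diff_distrib power_int_diff field_simps)

lemma K_E: assumes "q \<noteq> 0" "i \<in> {0,1,2}" "j \<in> {0,1,2}"
  shows "Kop q i ** Eop r2 r3 a j ** Kop (inverse q) i = mat (q powi (Bsym i j)) ** Eop r2 r3 a j"
    "Kop q i ** Fop r2 r3 a j ** Kop (inverse q) i = mat (q powi (- Bsym i j)) ** Fop r2 r3 a j"
  using assms(2,3)
  by (elim insertE emptyE; simp add: ops K_munit[OF assms(1)] wt_simps Bsym_def dsym_def doubleton_eq_iff)+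


lemma roots: assumes "q \<noteq> 0" "q^2 \<noteq> 1" "q^4 \<noteq> 1" "r2^2 = qint q 1 2" "r3^2 = qint q 1 3"
  shows "r2 \<noteq> 0" "r2 * r2 = q + inverse q" "r3 * r3 = (q + inverse q) * (q + inverse q) - 1"
    "q - inverse q \<noteq> 0" "q + inverse q \<noteq> 0"
proof -
  show 1: "q - inverse q \<noteq> 0" using assms(1,2) by (simp add: field_simps power2_eq_square)
  have "q^2 \<noteq> -1" using assms(3) by (metis (no_types, lifting) mult_2 numeral_Bit0 power_add power2_minus power2_eq_square one_power2 power_mult)
  then show 2: "q + inverse q \<noteq> 0" using assms(1) by (simp add: field_simps power2_eq_square eq_neg_iff_add_eq_0)
  have "(q + inverse q) * (q - inverse q) = q ^ 2 - inverse q ^ 2" by (simp add: algebra_simps power2_eq_square)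
  then have "qint q 1 2 = q + inverse q" using 1
    by (simp add: qint_def power_int_minus divide_eq_eq power_inverse)
  then show 3: "r2 * r2 = q + inverse q" using assms(4) by (simp add: power2_eq_square)
  show "r2 \<noteq> 0" using 2 3 by auto
  have "((q + inverse q) * (q + inverse q) - 1) * (q - inverse q) = q ^ 3 - inverse q ^ 3"
    using assms(1) by (simp add: algebra_simps power3_eq_cube)
  then have "qint q 1 3 = (q + inverse q) * (q + inverse q) - 1" using 1
    by (simp add: qint_def power_int_minus divide_eq_eq power_inverse)
  then show "r3 * r3 = (q + inverse q) * (q + inverse q) - 1" using assms(5) by (simp add: power2_eq_square)
qed

lemma Kdiff: assumes "q \<noteq> 0" "q - inverse q \<noteq> 0" "q ^ 3 - inverse q ^ 3 \<noteq> 0" "i \<in> {0,1,2}"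
  shows "mat (1 / (q ^ dsym i - inverse q ^ dsym i)) ** (Kop q i - Kop (inverse q) i) =
    (\<chi> k l. if k = l then (if wt i $ k = 2 then q + inverse q else if wt i $ k = -2 then -(q + inverse q) else of_int (wt i $ k)) else 0)"
proof -
  have e: "q ^ 2 - inverse q ^ 2 = (q + inverse q) * (q - inverse q)" by (simp add: algebra_simps power2_eq_square)
  have n: "inverse q - q = - (q - inverse q)" "inverse q ^ 3 - q ^ 3 = - (q ^ 3 - inverse q ^ 3)"
    "inverse q ^ 2 - q ^ 2 = - (q + inverse q) * (q - inverse q)" by (simp_all add: algebra_simps power2_eq_square)
  show ?thesis
    unfolding mat_scal using assms(4)
    apply (elim insertE emptyE)
    using assms(1-3)
    by (simp_all add: vec_eq_iff forall_8 Kop_def wt_simps dsym_def power_int_minus n e power_inverse[symmetric] divide_eq_eq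
         del: power_inverse minus_diff_eq)
qed

lemma EF: assumes "q \<noteq> 0" "r2 \<noteq> 0" "r2 * r2 = q + inverse q" "r3 * r3 = (q + inverse q) * (q + inverse q) - 1"
   "a \<noteq> 0" "i \<in> {0,1,2}" "j \<in> {0,1,2}"
  shows "Eop r2 r3 a i ** Fop r2 r3 a j - Fop r2 r3 a j ** Eop r2 r3 a i =
          (if i = j then (\<chi> k l. if k = l then (if wt i $ k = 2 then q + inverse q else if wt i $ k = -2 then -(q + inverse q) else of_int (wt i $ k)) else 0) else 0)"
proof -
  have r3: "r3 * r3 = r2 * r2 * (r2 * r2) - 1" and n: "q + inverse q = r2 * r2" using assms by simp_all
  show ?thesis
  unfolding n using assms(6,7)
  apply (elim insertE emptyE)
  using assms(2,5)
  apply (simp_all add: ops)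
  apply (simp_all add: vec_eq_iff forall_8 munit_def wt_simps)
  apply (simp_all add: field_simps power2_eq_square)
  using r3 apply (simp_all add: algebra_simps)
  done
qed

lemma mpow_simps: "mpow A 0 = mat 1" "mpow A (Suc n) = A ** mpow A n" "mat 1 ** A = A" "A ** mat 1 = A"
  by (simp_all add: mpow_def)

lemma serre_E: assumes "r2 \<noteq> 0" "r2^2 = qint q 1 2" "qint q 1 1 = 1" "qint q 3 1 = 1" "r3 * r3 = r2 * r2 * (r2 * r2) - 1" "a \<noteq> 0"
  shows "serre q (Eop r2 r3 a)" "serre q (Fop r2 r3 a)"
proof -
  have z: "qint q 1 2 \<noteq> 0" using assms(1,2) by (metis power_not_zero)
  have b: "qbinom q 1 2 0 = 1" "qbinom q 1 2 1 = r2 * r2" "qbinom q 1 2 2 = 1"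
    using assms(1-4) z by (simp_all add: qbinom_def eval_nat_numeral) 
  have r3: "r3 * r3 = r2 * r2 * (r2 * r2) - 1" using assms by simp
  have r4: "r2 * (r2 * (r2 * r2)) = 1 + r3 * r3" using r3 by (simp add: algebra_simps)
  have r5: "r2 * (r2 * (r2 * (r2 * x))) = (1 + r3 * r3) * x" for x
    unfolding r4[symmetric] by (simp add: algebra_simps)
  have b1: "qbinom q 1 (Suc 0) 0 = 1" "qbinom q 1 (Suc 0) (Suc 0) = 1"
     "qbinom q 3 (Suc 0) 0 = 1" "qbinom q 3 (Suc 0) (Suc 0) = 1"
    using assms(3,4) by (simp_all add: qbinom_def)
  have nt: "nat 2 = 2" "nat 4 = 4" by simp_all
  have s: "sum f {0..4} = f 0 + f 1 + f 2 + f 3 + f (4::nat)" "sum f {0..2} = f 0 + f 1 + f (2::nat)" 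
     "sum f {0..1} = f 0 + f (1::nat)" for f :: "nat \<Rightarrow> complex^8^8"
    by (simp_all add: eval_nat_numeral)
  have p: "mpow A 4 = A ** (A ** (A ** A))" "mpow A 3 = A ** (A ** A)" "mpow A 2 = A ** A" "mpow A 1 = A" "mpow A 0 = mat 1" for A :: "complex^8^8"
    by (simp_all add: eval_nat_numeral mpow_simps)
  show "serre q (Eop r2 r3 a)" "serre q (Fop r2 r3 a)"
  using assms(1,6)
  apply (simp_all add: serre_def Bsym_def dsym_def Let_def doubleton_eq_iff)
  apply (simp_all only: nt s)
  apply (simp_all add: p b ops mzero mpow_simps del: One_nat_def)
  apply (simp_all add: mat_scal vec_eq_iff forall_8 munit_def)
  apply (simp_all add: field_simps)
  apply (simp_all add: algebra_simps r4 r5 b1)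
  done
qed

lemma L1_rep:
  assumes "q \<noteq> 0" "\<And>n :: nat. n > 0 \<Longrightarrow> q ^ n \<noteq> 1"
    and "r2\<^sup>2 = qint q 1 2" "r3\<^sup>2 = qint q 1 3" "a \<noteq> 0"
  shows "Uq_D43_rep q (Eop r2 r3 a) (Fop r2 r3 a) (Kop q) (Kop (inverse q))"
proof -
  note r = roots[OF assms(1) assms(2)[of 2] assms(2)[of 4] assms(3,4), simplified]
  have q6: "q ^ 3 - inverse q ^ 3 \<noteq> 0"
    using assms(1) assms(2)[of 6] by (simp add: field_simps flip: power_add)
  have q1: "qint q 1 1 = 1" "qint q 3 1 = 1"
    using r(4) q6 by (simp_all add: qint_def power_int_minus power_inverse)
  have r3: "r3 * r3 = r2 * r2 * (r2 * r2) - 1" using r by simp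
  have r4: "q - inverse q \<noteq> 0" using r(4) by simp
  show ?thesis
    unfolding Uq_D43_rep_def
  proof (intro conjI ballI)
    fix i j :: nat assume ij: "i \<in> {0,1,2}" "j \<in> {0,1,2}"
    show "Eop r2 r3 a i ** Fop r2 r3 a j - Fop r2 r3 a j ** Eop r2 r3 a i =
        (if i = j then mat (1 / (q ^ dsym i - inverse q ^ dsym i)) ** (Kop q i - Kop (inverse q) i)
         else 0)"
      unfolding EF[OF assms(1) r(1-3) assms(5) ij] Kdiff[OF assms(1) r4 q6 ij(1)] ..
  qed (rule K_KK[OF assms(1)] K_prod[OF assms(1)] K_comm K_E[OF assms(1)]
      serre_E[OF r(1) assms(3) q1 r3 assms(5)]; assumption?)+
qed

definition kron :: "complex^'n^'n \<Rightarrow> complex^'m^'m \<Rightarrow> complex^('n \<times> 'm)^('n \<times> 'm)" where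
  "kron A B = (\<chi> k l. A $ fst k $ fst l * B $ snd k $ snd l)"

definition vv :: "8 \<Rightarrow> 8 \<Rightarrow> complex^(8 \<times> 8)" where
  "vv i j = axis (i, j) 1"

text \<open>The operators \<open>\<Delta>E\<^sub>i\<close>, \<open>\<Delta>F\<^sub>i\<close>, \<open>\<Delta>K\<^sub>i\<close> on \<open>L\<^sub>1(a) \<otimes> L\<^sub>1(b)\<close>; the last does not depend on \<open>a\<close>, \<open>b\<close>.\<close>

definition DE :: "complex \<Rightarrow> complex \<Rightarrow> complex \<Rightarrow> complex \<Rightarrow> complex \<Rightarrow> nat \<Rightarrow> complex^(8 \<times> 8)^(8 \<times> 8)" where
  "DE h r2 r3 a b i =
     kron (Eop r2 r3 a i) (Kop h i) + kron (Kop (inverse h) i) (Eop r2 r3 b i)"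

definition DF :: "complex \<Rightarrow> complex \<Rightarrow> complex \<Rightarrow> complex \<Rightarrow> complex \<Rightarrow> nat \<Rightarrow> complex^(8 \<times> 8)^(8 \<times> 8)" where
  "DF h r2 r3 a b i =
     kron (Fop r2 r3 a i) (Kop h i) + kron (Kop (inverse h) i) (Fop r2 r3 b i)"

definition DK :: "complex \<Rightarrow> nat \<Rightarrow> complex^(8 \<times> 8)^(8 \<times> 8)" where
  "DK q i = kron (Kop q i) (Kop q i)"

definition intertwiner ::
  "complex \<Rightarrow> complex \<Rightarrow> complex \<Rightarrow> complex \<Rightarrow> complex \<Rightarrow> complex \<Rightarrow>
   complex^(8 \<times> 8)^(8 \<times> 8) \<Rightarrow> bool" where
  "intertwiner q h r2 r3 a b T \<longleftrightarrow> (\<forall>i\<in>{0,1,2}.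
     T ** DE h r2 r3 a b i = DE h r2 r3 b a i ** T \<and>
     T ** DF h r2 r3 a b i = DF h r2 r3 b a i ** T \<and>
     T ** DK q i = DK q i ** T \<and>
     T ** DK (inverse q) i = DK (inverse q) i ** T)"

text \<open>
  Rational functions are represented by functions on \<open>\<complex>\<close> whose values on a finite set are
  irrelevant; two of them are equal if they agree outside a finite set.
\<close>

definition rational_fun :: "(complex \<Rightarrow> complex) \<Rightarrow> bool" where
  "rational_fun f \<longleftrightarrow>
     (\<exists>p d :: complex poly. d \<noteq> 0 \<and> (\<forall>\<^sub>F z in cofinite. f z = poly p z / poly d z))"

definition is_R_matrix ::
  "complex \<Rightarrow> complex \<Rightarrow> complex \<Rightarrow> complex \<Rightarrow> (complex \<Rightarrow> complex^(8 \<times> 8)^(8 \<times> 8)) \<Rightarrow> bool" where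
  "is_R_matrix q h r2 r3 R \<longleftrightarrow>
     (\<forall>k l. rational_fun (\<lambda>z. R z $ k $ l)) \<and>
     (\<exists>S. finite S \<and> (\<forall>a b. a \<noteq> 0 \<and> b \<noteq> 0 \<and> a / b \<notin> S \<longrightarrow>
        intertwiner q h r2 r3 a b (R (a / b)) \<and> R (a / b) *v vv 1 1 = vv 1 1 \<and>
        (\<forall>T. intertwiner q h r2 r3 a b T \<and> T *v vv 1 1 = vv 1 1 \<longrightarrow> T = R (a / b))))"

inductive_set alg_span :: "(complex^'n^'n) set \<Rightarrow> (complex^'n^'n) set" for G where
  gen: "X \<in> G \<Longrightarrow> X \<in> alg_span G"
| scalar: "mat c \<in> alg_span G"
| add: "X \<in> alg_span G \<Longrightarrow> Y \<in> alg_span G \<Longrightarrow> X + Y \<in> alg_span G"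
| mult: "X \<in> alg_span G \<Longrightarrow> Y \<in> alg_span G \<Longrightarrow> X ** Y \<in> alg_span G"

text \<open>
  The operators by which \<open>U\<^sub>q(G\<^sub>2)\<close> acts; for \<open>i = 1, 2\<close> the operators \<open>E\<^sub>i\<close> and \<open>F\<^sub>i\<close> do not
  depend on the spectral parameters, here set to 1.
\<close>

definition UqG2 :: "complex \<Rightarrow> complex \<Rightarrow> complex \<Rightarrow> complex \<Rightarrow> (complex^(8 \<times> 8)^(8 \<times> 8)) set" where
  "UqG2 q h r2 r3 =
     alg_span (\<Union>i\<in>{1,2}. {DE h r2 r3 1 1 i, DF h r2 r3 1 1 i, DK q i, DK (inverse q) i})"

definition G2_submodule ::
  "complex \<Rightarrow> complex \<Rightarrow> complex \<Rightarrow> complex \<Rightarrow> (complex^(8 \<times> 8)) set \<Rightarrow> bool" where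
  "G2_submodule q h r2 r3 W \<longleftrightarrow>
     vec.subspace W \<and> (\<forall>X\<in>UqG2 q h r2 r3. \<forall>x\<in>W. X *v x \<in> W)"

definition G2_irreducible ::
  "complex \<Rightarrow> complex \<Rightarrow> complex \<Rightarrow> complex \<Rightarrow> (complex^(8 \<times> 8)) set \<Rightarrow> bool" where
  "G2_irreducible q h r2 r3 W \<longleftrightarrow>
     G2_submodule q h r2 r3 W \<and> W \<noteq> {0} \<and>
     (\<forall>U. G2_submodule q h r2 r3 U \<and> U \<subseteq> W \<longrightarrow> U = {0} \<or> U = W)"

text \<open>A weight \<open>(m, n)\<close> stands for \<open>m\<omega>\<^sub>1 + n\<omega>\<^sub>2\<close>.\<close>

definition G2_singular ::
  "complex \<Rightarrow> complex \<Rightarrow> complex \<Rightarrow> complex \<Rightarrow> nat \<times> nat \<Rightarrow> complex^(8 \<times> 8) \<Rightarrow> bool" where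
  "G2_singular q h r2 r3 \<mu> x \<longleftrightarrow>
     DE h r2 r3 1 1 1 *v x = 0 \<and> DE h r2 r3 1 1 2 *v x = 0 \<and>
     DK q 1 *v x = (q ^ dsym 1) ^ fst \<mu> *s x \<and> DK q 2 *v x = (q ^ dsym 2) ^ snd \<mu> *s x"

text \<open>\<open>W\<close> is a submodule isomorphic to \<open>L\<^sub>\<mu>\<close>, i.e. irreducible of type 1 with highest weight \<open>\<mu>\<close>.\<close>

definition G2_copy ::
  "complex \<Rightarrow> complex \<Rightarrow> complex \<Rightarrow> complex \<Rightarrow> nat \<times> nat \<Rightarrow> (complex^(8 \<times> 8)) set \<Rightarrow> bool" where
  "G2_copy q h r2 r3 \<mu> W \<longleftrightarrow>
     G2_irreducible q h r2 r3 W \<and> (\<exists>x\<in>W. x \<noteq> 0 \<and> G2_singular q h r2 r3 \<mu> x)"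

definition isotypic ::
  "complex \<Rightarrow> complex \<Rightarrow> complex \<Rightarrow> complex \<Rightarrow> nat \<times> nat \<Rightarrow> (complex^(8 \<times> 8)) set" where
  "isotypic q h r2 r3 \<mu> = vec.span (\<Union> {W. G2_copy q h r2 r3 \<mu> W})"

definition proj_iso ::
  "complex \<Rightarrow> complex \<Rightarrow> complex \<Rightarrow> complex \<Rightarrow> nat \<times> nat \<Rightarrow> complex^(8 \<times> 8)^(8 \<times> 8)" where
  "proj_iso q h r2 r3 \<mu> = (THE P.
     (\<forall>x\<in>isotypic q h r2 r3 \<mu>. P *v x = x) \<and>
     (\<forall>\<nu>. \<nu> \<noteq> \<mu> \<longrightarrow> (\<forall>x\<in>isotypic q h r2 r3 \<nu>. P *v x = 0)))"

text \<open>
  \<open>tensor_proj q h r2 r3 \<mu> u f\<close> is \<open>f \<otimes> P\<^sub>\<mu>\<close>, where the entries of \<open>u\<close> are the chosen singular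
  vectors of weight \<open>\<mu>\<close>.
\<close>

definition tensor_proj ::
  "complex \<Rightarrow> complex \<Rightarrow> complex \<Rightarrow> complex \<Rightarrow> nat \<times> nat \<Rightarrow> (complex^(8 \<times> 8))^'m \<Rightarrow> complex^'m^'m \<Rightarrow>
   complex^(8 \<times> 8)^(8 \<times> 8)" where
  "tensor_proj q h r2 r3 \<mu> u f = (THE T.
     (\<forall>X\<in>UqG2 q h r2 r3. \<forall>j. T *v (X *v (u $ j)) = (\<Sum>i\<in>UNIV. f $ i $ j *s (X *v (u $ i)))) \<and>
     (\<forall>\<nu>. \<nu> \<noteq> \<mu> \<longrightarrow> (\<forall>x\<in>isotypic q h r2 r3 \<nu>. T *v x = 0)))"

definition sing1 :: "complex \<Rightarrow> complex \<Rightarrow> complex \<Rightarrow> complex \<Rightarrow> (complex^(8 \<times> 8))^3" where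
  "sing1 q h r2 r3 = vector
     [(1 / r3) *s (q powi 3 *s vv 1 4 - (h powi 3 * r2) *s vv 2 3
                   + (h powi (-3) * r2) *s vv 3 2 - q powi (-3) *s vv 4 1),
      vv 1 8,
      vv 8 1]"

definition sing0 :: "complex \<Rightarrow> (complex^(8 \<times> 8))^2" where
  "sing0 q = vector
     [q powi 5 *s vv 1 7 - q powi 4 *s vv 2 6 + q *s vv 3 5 - vv 4 4
      + q powi (-1) *s vv 5 3 - q powi (-4) *s vv 6 2 + q powi (-5) *s vv 7 1,
      vv 8 8]"

definition c_alpha :: "complex \<Rightarrow> complex" where
  "c_alpha q = qint_i q 1 2 * qint_i q 3 2 / qint q 1 2"

definition c_beta :: "complex \<Rightarrow> complex" where
  "c_beta q = qint_i q 3 2 / qint q 1 2"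

definition c_gamma :: "complex \<Rightarrow> complex" where
  "c_gamma q = qint_i q 3 2 * qint q 4 2 / qint q 1 2"

definition c_kappa :: "complex \<Rightarrow> complex" where
  "c_kappa q = qint q 2 2 / qint q 1 2"

definition c_zeta :: "complex \<Rightarrow> complex" where
  "c_zeta q = qint q 4 2 / qint q 1 2"

definition c_eta :: "complex \<Rightarrow> complex" where
  "c_eta q = qint_i q 3 2 / qint q 1 2"

definition c_rho :: "complex \<Rightarrow> complex" where
  "c_rho q = qint_i q 3 2 * qint_i q 2 3 * qint q 1 7 / qint q 1 2"

definition c_xi :: "complex \<Rightarrow> complex" where
  "c_xi q = qint_i q 1 2 * qint_i q 3 2 * qint q 4 2"

definition f_omega1 :: "complex \<Rightarrow> complex \<Rightarrow> complex^3^3" where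
  "f_omega1 q z =
     (let \<alpha> = c_alpha q; \<beta> = c_beta q; \<gamma> = c_gamma q; \<kappa> = c_kappa q in
      vector
       [vector [- (q powi (-3)) - q powi (-2) * \<alpha> * z + q powi 2 * \<alpha> * z ^ 2 + q powi 3 * z ^ 3,
                \<beta> * z * (1 - z),
                \<beta> * z * (1 - z)],
        vector [\<gamma> * z * (1 - z),
                \<beta> * z * (q powi 3 + q powi (-3) * z),
                (1 - z) * (q powi 3 + \<kappa> * z + q powi (-3) * z ^ 2)],
        vector [\<gamma> * z * (1 - z),
                (1 - z) * (q powi 3 + \<kappa> * z + q powi (-3) * z ^ 2),
                \<beta> * z * (q powi 3 + q powi (-3) * z)]])"

definition f_omega0 :: "complex \<Rightarrow> complex \<Rightarrow> complex^2^2" where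
  "f_omega0 q z =
     (let \<zeta> = c_zeta q; \<eta> = c_eta q; \<rho> = c_rho q; \<xi> = c_xi q in
      vector
       [vector [q powi (-6) - q powi (-3) * \<zeta> * z + \<xi> * z ^ 2 - q powi 3 * \<zeta> * z ^ 3 + q powi 6 * z ^ 4,
                \<eta> * z * (1 - z ^ 2)],
        vector [\<rho> * z * (1 - z ^ 2),
                q powi 6 - q powi 3 * \<zeta> * z + \<xi> * z ^ 2 - q powi (-3) * \<zeta> * z ^ 3 + q powi (-6) * z ^ 4]])"

end

theory Submission
  imports Defs
begin

text \<open>
  The bilinear form for which the vectors \<open>v\<^sub>i \<otimes> v\<^sub>j\<close> are orthonormal is contravariant for
  \<open>U\<^sub>q(G\<^sub>2)\<close>: transposition exchanges \<open>E\<^sub>i\<close> and \<open>F\<^sub>i\<close>.  Hence pairwise orthogonal singular vectors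
  generate pairwise orthogonal submodules, and as the seven singular vectors \<open>u\<^sub>j\<close> at hand are anisotropic and
  span all singular vectors, the tensor square is the orthogonal sum of the submodules that they generate.  The operators
  commuting with \<open>U\<^sub>q(G\<^sub>2)\<close> are therefore the matrices \<open>f\<close> acting on the multiplicity spaces.

  Since \<open>E\<^sub>0\<close> commutes with \<open>F\<^sub>1\<close> and \<open>F\<^sub>2\<close>, such an operator intertwines \<open>E\<^sub>0\<close> as soon as it does so on the
  \<open>u\<^sub>j\<close>.  Writing \<open>E\<^sub>0 u\<^sub>j\<close> as a combination, with coefficients \<open>C\<^sub>k\<^sub>j(a, b)\<close>, of vectors \<open>X u\<^sub>k\<close>, where \<open>X\<close> depends only
  on the weights of \<open>u\<^sub>j\<close> and \<open>u\<^sub>k\<close>, turns this into the matrix equation \<open>f C(a, b) = C(b, a) f\<close>.  It holds for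
  the matrix of the theorem, and for generic \<open>a / b\<close> it determines \<open>f\<close> up to a factor.  The relation for \<open>F\<^sub>0\<close>
  follows by transposition.
\<close>

section \<open>Modules with a contravariant form\<close>

text \<open>The form is bilinear, not Hermitian, because q is an arbitrary complex number that is
  not a root of unity. Nonzero vectors may be isotropic, so semisimplicity does not come for free.
  It rests on three computed facts: the seven singular vectors are pairwise orthogonal, their norms
  are products of powers of h and cyclotomic factors, and no nonzero singular vector is orthogonal
  to all of them.

  The bridge from singular vectors to operators is the Shapovalov form. The pairing of
  \<open>X u\<close> with \<open>Y u\<close> is the norm of u times a scalar that depends only on X,
  Y and the weight of u. Hence singular vectors of equal weight have equal annihilators, and this is
  what makes the action of a matrix f on a multiplicity space well defined.

  Transposition yields the relation for F_0 because F_0(a) is the transpose of E_0(1/a) and because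
  the blocks of the formula are symmetric for the Gram matrix of the singular vectors.

  Uniqueness is an explicit elimination. Its determinants are, up to nonzero factors, the quadratic
  denominator of the formula at weight omega_1 and a^2 - h^24 b^2 at weight 0; the exceptional
  ratios a / b come from these and from the other poles.\<close>

definition bdot :: "complex^'n \<Rightarrow> complex^'n \<Rightarrow> complex" where
  "bdot x y = (\<Sum>k\<in>UNIV. x $ k * y $ k)"

lemma bdot_simps:
  "bdot (x + y) z = bdot x z + bdot y z" "bdot z (x + y) = bdot z x + bdot z y"
  "bdot (x - y) z = bdot x z - bdot y z" "bdot z (x - y) = bdot z x - bdot z y"
  "bdot (c *s x) z = c * bdot x z" "bdot z (c *s x) = c * bdot z x"
  "bdot 0 z = 0" "bdot z 0 = 0" "bdot (- x) z = - bdot x z" "bdot z (- x) = - bdot z x"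
  by (simp_all add: bdot_def sum.distrib sum_subtractf sum_negf sum_distrib_left algebra_simps)

lemma bdot_sum:
  "bdot (\<Sum>i\<in>I. f i) z = (\<Sum>i\<in>I. bdot (f i) z)" "bdot z (\<Sum>i\<in>I. f i) = (\<Sum>i\<in>I. bdot z (f i))"
  by (induction I rule: infinite_finite_induct; simp add: bdot_simps)+

lemma bdot_commute: "bdot x y = bdot y x"
  by (simp add: bdot_def mult.commute)

lemma bdot_axis: "bdot x (axis k 1) = x $ k"
  by (simp add: bdot_def axis_def if_distrib cong: if_cong)

lemma bdot_eq_0D: "(\<And>y. bdot x y = 0) \<Longrightarrow> x = 0"
  by (simp add: vec_eq_iff) (metis bdot_axis)

lemma bdot_matrix: "bdot (X *v x) y = bdot x (transpose X *v y)"
proof -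
  have "bdot (X *v x) y = (\<Sum>k\<in>UNIV. \<Sum>l\<in>UNIV. X $ k $ l * x $ l * y $ k)"
    by (simp add: bdot_def matrix_vector_mult_def sum_distrib_right)
  also have "\<dots> = (\<Sum>l\<in>UNIV. \<Sum>k\<in>UNIV. X $ k $ l * x $ l * y $ k)"
    by (rule sum.swap)
  also have "\<dots> = bdot x (transpose X *v y)"
    by (simp add: bdot_def matrix_vector_mult_def transpose_def sum_distrib_left algebra_simps)
  finally show ?thesis .
qed

lemma mat_mult_vector: "mat c *v x = c *s x" for x :: "complex^'n"
  by (simp add: vec_eq_iff matrix_vector_mult_def mat_def if_mult)

lemma mat_commute: "mat c ** A = A ** mat c" for A :: "complex^'n^'n"
  by (simp add: vec_eq_iff matrix_matrix_mult_def mat_def if_mult mult.commute)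

lemma matrix_vector_sum: "A *v (\<Sum>i\<in>I. f i) = (\<Sum>i\<in>I. A *v f i)" for A :: "complex^'n^'m"
  by (induction I rule: infinite_finite_induct; simp add: matrix_vector_right_distrib)

lemma matrix_vector_scale: "A *v (c *s x) = c *s (A *v x)" for A :: "complex^'n^'m"
  by (simp add: vec_eq_iff matrix_vector_mult_def sum_distrib_left algebra_simps)

lemmas mv_simps = matrix_vector_mul_assoc[symmetric] matrix_vector_right_distrib
  matrix_vector_mult_add_rdistrib matrix_vector_mult_diff_rdistrib matrix_vector_mult_diff_distrib
  mat_mult_vector matrix_vector_scale vec.scale_right_distrib vec.scale_left_distrib

lemma separating_vector:
  fixes y :: "complex^'n"
  assumes "vec.subspace W" "y \<notin> W"
  obtains g where "\<And>w. w \<in> W \<Longrightarrow> bdot g w = 0" "bdot g y \<noteq> 0"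
proof -
  obtain B where B: "B \<subseteq> W" "vec.independent B" "W \<subseteq> vec.span B"
    using vec.maximal_independent_subset[of W] by blast
  have "vec.span B \<subseteq> W" using B(1) assms(1) by (rule vec.span_minimal)
  then have y: "y \<notin> vec.span B" using assms(2) by blast
  then have "vec.independent (insert y B)" using B(2) by (rule vec.independent_insertI)
  then obtain f where f: "Vector_Spaces.linear (*s) (*s) f"
      "\<forall>x\<in>insert y B. f x = (if x = y then y else 0)"
    using vec.linear_independent_extend[of "insert y B" "\<lambda>x. if x = y then y else 0"] by auto
  have fW: "f w = 0" if "w \<in> W" for w
  proof (rule vec.linear_eq_0_on_span[OF f(1), of B])
    show "f x = 0" if "x \<in> B" for x using f(2) that y vec.span_base by fastforce
    show "w \<in> vec.span B" using that B(3) by blast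
  qed
  have "y \<noteq> 0" using assms vec.subspace_0 by blast
  \<comment> \<open>A coordinate in which y does not vanish turns f into a scalar functional; its
    representing vector is row k of the matrix of f.\<close>
  then obtain k where k: "y $ k \<noteq> 0" by (auto simp: vec_eq_iff)
  have g: "bdot (matrix f $ k) x = f x $ k" for x
    using matrix_works[OF f(1), of x] by (simp add: bdot_def matrix_vector_mult_def vec_eq_iff)
  show thesis
    by (rule that[of "matrix f $ k"]) (use fW f(2) k in \<open>auto simp: g\<close>)
qed

lemma alg_span_neg: "X \<in> alg_span G \<Longrightarrow> - X \<in> alg_span G"
  using alg_span.mult[OF alg_span.scalar[of "-1" G], of X] by (simp add: mat_scal uminus_vec_def)

lemma alg_span_diff: "X \<in> alg_span G \<Longrightarrow> Y \<in> alg_span G \<Longrightarrow> X - Y \<in> alg_span G"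
  using alg_span.add[OF _ alg_span_neg, of X G Y] by simp

lemma alg_span_zero: "0 \<in> alg_span G"
  using alg_span.scalar[of 0 G] by (simp add: mat_def zero_vec_def cong: if_cong)

lemma alg_span_mono: "X \<in> alg_span G \<Longrightarrow> G \<subseteq> H \<Longrightarrow> X \<in> alg_span H"
  by (induction rule: alg_span.induct) (auto intro: alg_span.intros)

text \<open>Separates the structural argument from the coordinates. \<open>cl k\<close> is the
  weight of the singular vector \<open>u k\<close>, and \<open>wt i\<close> evaluates a weight at
  \<open>K i\<close>. Together with orthogonality and anisotropy, \<open>complete\<close> says that
  the \<open>u k\<close> span all singular vectors. \<open>level\<close> decreases along every
  \<open>E i\<close>, so repeated application of the \<open>E i\<close> must end. The constants in
  the commutation relations are existential since only the shape of the relations enters.\<close>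

locale contravariant_module =
  fixes I :: "nat set" and E F K K' :: "nat \<Rightarrow> complex^'n^'n"
    and wt :: "nat \<Rightarrow> 'c \<Rightarrow> complex"
    and m :: nat and u :: "nat \<Rightarrow> complex^'n" and cl :: "nat \<Rightarrow> 'c"
    and level :: "'n \<Rightarrow> nat"
  assumes transpose_F: "i \<in> I \<Longrightarrow> transpose (F i) = E i"
    and transpose_K: "i \<in> I \<Longrightarrow> transpose (K i) = K i"
    and transpose_K': "i \<in> I \<Longrightarrow> transpose (K' i) = K' i"
    and K_inverse: "i \<in> I \<Longrightarrow> K i ** K' i = mat 1" "i \<in> I \<Longrightarrow> K' i ** K i = mat 1"
    and KF: "i \<in> I \<Longrightarrow> j \<in> I \<Longrightarrow> \<exists>c. K i ** F j = mat c ** (F j ** K i)"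
    and KF': "i \<in> I \<Longrightarrow> j \<in> I \<Longrightarrow> \<exists>c. K' i ** F j = mat c ** (F j ** K' i)"
    and EF: "i \<in> I \<Longrightarrow> j \<in> I \<Longrightarrow> \<exists>c. E i ** F j = F j ** E i + mat c ** (K i - K' i)"
    and E_u: "i \<in> I \<Longrightarrow> k < m \<Longrightarrow> E i *v u k = 0"
    and K_u: "i \<in> I \<Longrightarrow> k < m \<Longrightarrow> K i *v u k = wt i (cl k) *s u k"
    and wt_inj: "(\<And>i. i \<in> I \<Longrightarrow> wt i \<mu> = wt i \<nu>) \<Longrightarrow> \<mu> = \<nu>"
    and u_orth: "j < m \<Longrightarrow> k < m \<Longrightarrow> j \<noteq> k \<Longrightarrow> bdot (u j) (u k) = 0"
    and u_norm: "k < m \<Longrightarrow> bdot (u k) (u k) \<noteq> 0"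
    and complete: "(\<And>i. i \<in> I \<Longrightarrow> E i *v x = 0) \<Longrightarrow> (\<And>k. k < m \<Longrightarrow> bdot (u k) x = 0) \<Longrightarrow> x = 0"
    and level: "i \<in> I \<Longrightarrow> E i $ r $ s \<noteq> 0 \<Longrightarrow> level r < level s"
begin

definition alg :: "(complex^'n^'n) set" where
  "alg = alg_span (\<Union>i\<in>I. {E i, F i, K i, K' i})"

lemma alg_intros:
  "i \<in> I \<Longrightarrow> E i \<in> alg" "i \<in> I \<Longrightarrow> F i \<in> alg" "i \<in> I \<Longrightarrow> K i \<in> alg" "i \<in> I \<Longrightarrow> K' i \<in> alg"
  "mat c \<in> alg" "0 \<in> alg"
  "X \<in> alg \<Longrightarrow> Y \<in> alg \<Longrightarrow> X + Y \<in> alg" "X \<in> alg \<Longrightarrow> Y \<in> alg \<Longrightarrow> X ** Y \<in> alg"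
  "X \<in> alg \<Longrightarrow> Y \<in> alg \<Longrightarrow> X - Y \<in> alg"
  by (auto simp: alg_def intro: alg_span.intros alg_span_diff alg_span_zero)

lemma alg_induct [consumes 1, case_names E F K K' scalar add mult]:
  assumes "X \<in> alg"
    and "\<And>i. i \<in> I \<Longrightarrow> P (E i)" "\<And>i. i \<in> I \<Longrightarrow> P (F i)" "\<And>i. i \<in> I \<Longrightarrow> P (K i)" "\<And>i. i \<in> I \<Longrightarrow> P (K' i)"
    and "\<And>c. P (mat c)"
    and "\<And>X Y. X \<in> alg \<Longrightarrow> Y \<in> alg \<Longrightarrow> P X \<Longrightarrow> P Y \<Longrightarrow> P (X + Y)"
    and "\<And>X Y. X \<in> alg \<Longrightarrow> Y \<in> alg \<Longrightarrow> P X \<Longrightarrow> P Y \<Longrightarrow> P (X ** Y)"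
  shows "P X"
  using assms(1) unfolding alg_def
  by (induction rule: alg_span.induct) (use assms(2-) in \<open>auto simp: alg_def\<close>)

lemma transpose_E: "i \<in> I \<Longrightarrow> transpose (E i) = F i"
  using transpose_F transpose_transpose by metis

lemma alg_transpose: "X \<in> alg \<Longrightarrow> transpose X \<in> alg"
proof (induction rule: alg_induct)
  case (scalar c)
  show ?case by (simp add: transpose_mat alg_intros)
qed (auto simp: transpose_E transpose_F transpose_K transpose_K' transpose_add matrix_transpose_mul
      intro: alg_intros)

lemma K'_u: assumes "i \<in> I" "k < m" shows "K' i *v u k = inverse (wt i (cl k)) *s u k"
proof -
  have 1: "u k = wt i (cl k) *s (K' i *v u k)"
    using K_u[OF assms] K_inverse(2)[OF assms(1)]
    by (metis matrix_vector_mul_assoc matrix_vector_mul_lid matrix_vector_scale)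
  have "wt i (cl k) \<noteq> 0"
  proof
    assume "wt i (cl k) = 0"
    then have "u k = 0" using 1 by simp
    then show False using u_norm[OF assms(2)] by (simp add: bdot_simps)
  qed
  then show ?thesis by (subst (2) 1) simp
qed

definition neg :: "(complex^'n^'n) set" where "neg = alg_span (F ` I)"

lemma neg_intros:
  "i \<in> I \<Longrightarrow> F i \<in> neg" "mat c \<in> neg" "0 \<in> neg"
  "X \<in> neg \<Longrightarrow> Y \<in> neg \<Longrightarrow> X + Y \<in> neg" "X \<in> neg \<Longrightarrow> Y \<in> neg \<Longrightarrow> X ** Y \<in> neg"
  by (auto simp: neg_def intro: alg_span.intros alg_span_zero)

lemma neg_induct [consumes 1, case_names F scalar add mult]:
  assumes "X \<in> neg" and "\<And>i. i \<in> I \<Longrightarrow> P (F i)" and "\<And>c. P (mat c)"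
    and "\<And>X Y. X \<in> neg \<Longrightarrow> Y \<in> neg \<Longrightarrow> P X \<Longrightarrow> P Y \<Longrightarrow> P (X + Y)"
    and "\<And>X Y. X \<in> neg \<Longrightarrow> Y \<in> neg \<Longrightarrow> P X \<Longrightarrow> P Y \<Longrightarrow> P (X ** Y)"
  shows "P X"
  using assms(1) unfolding neg_def
  by (induction rule: alg_span.induct) (use assms(2-) in \<open>auto simp: neg_def\<close>)

lemma neg_alg: "X \<in> neg \<Longrightarrow> X \<in> alg"
  unfolding neg_def alg_def by (erule alg_span_mono) auto

text \<open>Moving L to the right rescales each monomial in the \<open>F j\<close> by a factor that
  depends on the monomial. The result is therefore another element Z of \<open>neg\<close> and not a
  multiple of Y.\<close>

lemma neg_twist:
  assumes L: "\<And>j. j \<in> I \<Longrightarrow> \<exists>c. L ** F j = mat c ** (F j ** L)" and "Y \<in> neg"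
  shows "\<exists>Z\<in>neg. L ** Y = Z ** L"
  using assms(2)
proof (induction rule: neg_induct)
  case (F i)
  obtain c where "L ** F i = mat c ** (F i ** L)" using L F by blast
  then have "L ** F i = (mat c ** F i) ** L" by (simp add: matrix_mul_assoc)
  then show ?case using F by (intro bexI) (auto intro: neg_intros)
next
  case (scalar c)
  show ?case by (intro bexI[of _ "mat c"]) (auto intro: neg_intros simp: mat_commute)
next
  case (add X Y)
  then show ?case by (metis madd neg_intros(4))
next
  case (mult X Y)
  then show ?case by (metis matrix_mul_assoc neg_intros(5))
qed

text \<open>The Leibniz rule for the commutator with \<open>E i\<close>. The correction terms are
  arranged with \<open>K i\<close> and \<open>K' i\<close> on the right, where they become scalars
  on a weight vector, while the main term ends in \<open>E i\<close> and vanishes on a singular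
  vector.\<close>

lemma E_neg:
  assumes i: "i \<in> I" and "Y \<in> neg"
  shows "\<exists>Z\<in>neg. \<exists>Z'\<in>neg. E i ** Y = Y ** E i + Z ** K i + Z' ** K' i"
  using assms(2)
proof (induction rule: neg_induct)
  case (F j)
  obtain c where "E i ** F j = F j ** E i + mat c ** (K i - K' i)" using EF i F by blast
  moreover have "mat c ** (K i - K' i) = mat c ** K i + mat (- c) ** K' i"
    by (simp add: mat_scal vec_eq_iff algebra_simps)
  ultimately have "E i ** F j = F j ** E i + mat c ** K i + mat (- c) ** K' i" by (simp add: add.assoc)
  then show ?case using neg_intros(2) by blast
next
  case (scalar c)
  have "E i ** mat c = mat c ** E i + 0 ** K i + 0 ** K' i" by (simp add: mat_commute mzero)
  then show ?case using neg_intros(3) mat_commute by metis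
next
  case (add X Y)
  then obtain Z1 Z1' Z2 Z2' where Z: "Z1 \<in> neg" "Z1' \<in> neg" "Z2 \<in> neg" "Z2' \<in> neg"
    "E i ** X = X ** E i + Z1 ** K i + Z1' ** K' i" "E i ** Y = Y ** E i + Z2 ** K i + Z2' ** K' i"
    by blast
  then have "E i ** (X + Y) = (X + Y) ** E i + (Z1 + Z2) ** K i + (Z1' + Z2') ** K' i"
    by (simp add: madd)
  then show ?case using Z neg_intros(4) by blast
next
  case (mult X Y)
  then obtain Z1 Z1' Z2 Z2' where Z: "Z1 \<in> neg" "Z1' \<in> neg" "Z2 \<in> neg" "Z2' \<in> neg"
    "E i ** X = X ** E i + Z1 ** K i + Z1' ** K' i" "E i ** Y = Y ** E i + Z2 ** K i + Z2' ** K' i"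
    by blast
  obtain Y1 where Y1: "Y1 \<in> neg" "K i ** Y = Y1 ** K i" using neg_twist[OF KF[OF i]] mult by blast
  obtain Y2 where Y2: "Y2 \<in> neg" "K' i ** Y = Y2 ** K' i" using neg_twist[OF KF'[OF i]] mult by blast
  have "E i ** (X ** Y) = X ** (E i ** Y) + Z1 ** (K i ** Y) + Z1' ** (K' i ** Y)"
    by (simp add: matrix_mul_assoc Z(5) madd)
  also have "\<dots> = (X ** Y) ** E i + (X ** Z2 + Z1 ** Y1) ** K i + (X ** Z2' + Z1' ** Y2) ** K' i"
    by (simp add: Z(6) Y1(2) Y2(2) madd matrix_mul_assoc)
  finally show ?case
    by (intro bexI[of _ "X ** Z2 + Z1 ** Y1"] bexI[of _ "X ** Z2' + Z1' ** Y2"])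
      (use Z Y1 Y2 mult in \<open>auto intro!: neg_intros\<close>)
qed

text \<open>The triangular decomposition, as far as it is visible on vectors of weight \<open>\<mu>\<close> killed by all \<open>E i\<close>.\<close>

lemma alg_neg:
  assumes "X \<in> alg" "Y \<in> neg"
  shows "\<exists>Z\<in>neg. \<forall>k<m. cl k = \<mu> \<longrightarrow> X *v (Y *v u k) = Z *v u k"
  using assms
proof (induction arbitrary: Y rule: alg_induct)
  case (E i)
  obtain Z Z' where Z: "Z \<in> neg" "Z' \<in> neg" "E i ** Y = Y ** E i + Z ** K i + Z' ** K' i"
    using E_neg E by blast
  have "E i *v (Y *v u k) = (mat (wt i \<mu>) ** Z + mat (inverse (wt i \<mu>)) ** Z') *v u k"
    if "k < m" "cl k = \<mu>" for k
    using that E(1) by (simp add: matrix_vector_mul_assoc Z(3))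
      (simp add: mv_simps E_u K_u K'_u mult.commute)
  then show ?case using Z
    by (intro bexI[of _ "mat (wt i \<mu>) ** Z + mat (inverse (wt i \<mu>)) ** Z'"]) (auto intro: neg_intros)
next
  case (F i)
  then show ?case by (intro bexI[of _ "F i ** Y"]) (auto intro: neg_intros simp: matrix_vector_mul_assoc)
next
  case (K i)
  then obtain Z where Z: "Z \<in> neg" "K i ** Y = Z ** K i" using neg_twist[OF KF[OF K(1)]] by blast
  have "K i *v (Y *v u k) = (mat (wt i \<mu>) ** Z) *v u k" if "k < m" "cl k = \<mu>" for k
    using that K(1) by (simp add: matrix_vector_mul_assoc Z(2)) (simp add: mv_simps K_u)
  then show ?case using Z by (intro bexI[of _ "mat (wt i \<mu>) ** Z"]) (auto intro: neg_intros)
next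
  case (K' i)
  then obtain Z where Z: "Z \<in> neg" "K' i ** Y = Z ** K' i" using neg_twist[OF KF'[OF K'(1)]] by blast
  have "K' i *v (Y *v u k) = (mat (inverse (wt i \<mu>)) ** Z) *v u k" if "k < m" "cl k = \<mu>" for k
    using that K'(1) by (simp add: matrix_vector_mul_assoc Z(2)) (simp add: mv_simps K'_u)
  then show ?case using Z by (intro bexI[of _ "mat (inverse (wt i \<mu>)) ** Z"]) (auto intro: neg_intros)
next
  case (scalar c)
  then show ?case by (intro bexI[of _ "mat c ** Y"]) (auto intro: neg_intros simp: matrix_vector_mul_assoc)
next
  case (add X1 X2)
  obtain Z1 Z2 where "Z1 \<in> neg" "Z2 \<in> neg"
     "\<forall>k<m. cl k = \<mu> \<longrightarrow> X1 *v (Y *v u k) = Z1 *v u k" "\<forall>k<m. cl k = \<mu> \<longrightarrow> X2 *v (Y *v u k) = Z2 *v u k"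
    using add.IH(1)[OF add.prems] add.IH(2)[OF add.prems] by blast
  then show ?case by (intro bexI[of _ "Z1 + Z2"]) (auto intro: neg_intros simp: mv_simps)
next
  case (mult X1 X2)
  obtain Z2 where Z2: "Z2 \<in> neg" "\<forall>k<m. cl k = \<mu> \<longrightarrow> X2 *v (Y *v u k) = Z2 *v u k"
    using mult.IH(2)[OF mult.prems] by blast
  obtain Z1 where "Z1 \<in> neg" "\<forall>k<m. cl k = \<mu> \<longrightarrow> X1 *v (Z2 *v u k) = Z1 *v u k"
    using mult.IH(1)[OF Z2(1)] by blast
  then show ?case using Z2 by (intro bexI[of _ Z1]) (auto simp: mv_simps)
qed

text \<open>One Z serves all singular vectors of weight \<mu>; this uniformity lets them be compared
  with each other later.\<close>

lemma alg_as_neg: "X \<in> alg \<Longrightarrow> \<exists>Z\<in>neg. \<forall>k<m. cl k = \<mu> \<longrightarrow> X *v u k = Z *v u k"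
  using alg_neg[of X "mat 1" \<mu>] neg_intros(2)[of 1] by simp

text \<open>Transposed to the other side, an \<open>F i\<close> becomes \<open>E i\<close> and kills
  \<open>u k\<close>. Only the constant term c of X survives.\<close>

lemma bdot_neg: "X \<in> neg \<Longrightarrow> \<exists>c. \<forall>k<m. \<forall>x. bdot (u k) (X *v x) = c * bdot (u k) x"
proof (induction rule: neg_induct)
  case (F i)
  have "bdot (u k) (F i *v x) = 0" if "k < m" for k x
    using bdot_matrix[of "E i" "u k" x] F that by (simp add: transpose_E E_u bdot_simps del: transpose_matrix_vector)
  then show ?case by (intro exI[of _ 0]) simp
next
  case (scalar c)
  show ?case by (intro exI[of _ c]) (simp add: mv_simps bdot_simps)
next
  case (add X Y)
  then obtain c d where "\<forall>k<m. \<forall>x. bdot (u k) (X *v x) = c * bdot (u k) x"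
    "\<forall>k<m. \<forall>x. bdot (u k) (Y *v x) = d * bdot (u k) x" by blast
  then show ?case by (intro exI[of _ "c + d"]) (simp add: mv_simps bdot_simps algebra_simps)
next
  case (mult X Y)
  then obtain c d where "\<forall>k<m. \<forall>x. bdot (u k) (X *v x) = c * bdot (u k) x"
    "\<forall>k<m. \<forall>x. bdot (u k) (Y *v x) = d * bdot (u k) x" by blast
  then show ?case by (intro exI[of _ "c * d"]) (simp add: mv_simps bdot_simps)
qed

text \<open>The scalar c is the constant term of X after the triangular decomposition at weight
  \<mu>. It depends on the weight only, as for the Shapovalov form of a highest weight
  module.\<close>

lemma shapovalov:
  assumes "X \<in> alg"
  shows "\<exists>c. \<forall>j<m. \<forall>k<m. cl k = \<mu> \<longrightarrow> bdot (u j) (X *v u k) = c * bdot (u j) (u k)"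
proof -
  obtain Z where Z: "Z \<in> neg" "\<forall>k<m. cl k = \<mu> \<longrightarrow> X *v u k = Z *v u k"
    using alg_as_neg[OF assms] by blast
  then show ?thesis using bdot_neg[of Z] by metis
qed

lemma bdot_cyclic:
  "bdot (X *v u j) (Y *v u k) = bdot (u j) ((transpose X ** Y) *v u k)"
  by (simp add: bdot_matrix matrix_vector_mul_assoc del: transpose_matrix_vector)

lemma cyclic_orth:
  assumes "X \<in> alg" "Y \<in> alg" "j < m" "k < m" "j \<noteq> k"
  shows "bdot (X *v u j) (Y *v u k) = 0"
  using shapovalov[OF alg_intros(8)[OF alg_transpose[OF assms(1)] assms(2)], of "cl k"]
    u_orth[OF assms(3-5)] assms by (auto simp: bdot_cyclic)

text \<open>Both pairings are the same Shapovalov scalar times the norm of the generator, so two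
  cyclic modules of equal weight have proportional forms. Written without division.\<close>

lemma cyclic_same:
  assumes "X \<in> alg" "Y \<in> alg" "j < m" "k < m" "cl j = cl k"
  shows "bdot (X *v u j) (Y *v u j) * bdot (u k) (u k) = bdot (X *v u k) (Y *v u k) * bdot (u j) (u j)"
  using shapovalov[OF alg_intros(8)[OF alg_transpose[OF assms(1)] assms(2)], of "cl k"] assms
  by (auto simp: bdot_cyclic)

text \<open>While some \<open>E i\<close> does not kill the vector, apply it: the levels of the
  coordinates that occur become smaller. The induction is on a strict bound for these
  levels.\<close>

lemma highest_vector_in_orbit:
  assumes "x \<noteq> 0"
  shows "\<exists>X\<in>alg. X *v x \<noteq> 0 \<and> (\<forall>i\<in>I. E i *v (X *v x) = 0)"
proof -
  have "\<forall>k. x $ k \<noteq> 0 \<longrightarrow> level k < n \<Longrightarrow> ?thesis" for n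
    using assms
  proof (induction n arbitrary: x)
    case 0
    then show ?case by (auto simp: vec_eq_iff)
  next
    case (Suc n)
    show ?case
    proof (cases "\<forall>i\<in>I. E i *v x = 0")
      case True
      then show ?thesis using Suc(3) by (intro bexI[of _ "mat 1"]) (auto intro: alg_intros)
    next
      case False
      then obtain i where i: "i \<in> I" "E i *v x \<noteq> 0" by blast
      have "level k < n" if "(E i *v x) $ k \<noteq> 0" for k
      proof -
        have "(\<Sum>l\<in>UNIV. E i $ k $ l * x $ l) \<noteq> 0"
          using that by (simp add: matrix_vector_mult_def)
        then obtain l where l: "E i $ k $ l * x $ l \<noteq> 0"
          by (rule sum.not_neutral_contains_not_neutral)
        then show ?thesis using level[OF i(1), of k l] Suc(2)[rule_format, of l] by auto
      qed
      then obtain X where "X \<in> alg" "X *v (E i *v x) \<noteq> 0" "\<forall>j\<in>I. E j *v (X *v (E i *v x)) = 0"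
        using Suc(1)[of "E i *v x"] i by blast
      then show ?thesis using i
        by (intro bexI[of _ "X ** E i"]) (auto intro: alg_intros simp: matrix_vector_mul_assoc[symmetric])
    qed
  qed
  from this[of "Suc (Max (range level))"] have "finite (UNIV :: 'n set) \<Longrightarrow> ?thesis"
    by (simp add: less_Suc_eq_le)
  then show ?thesis by simp
qed

lemma singular_in_span:
  assumes "\<And>i. i \<in> I \<Longrightarrow> E i *v x = 0"
  shows "x = (\<Sum>k<m. (bdot (u k) x / bdot (u k) (u k)) *s u k)"
proof -
  let ?y = "\<Sum>k<m. (bdot (u k) x / bdot (u k) (u k)) *s u k"
  have "x - ?y = 0"
  proof (rule complete)
    show "E i *v (x - ?y) = 0" if "i \<in> I" for i
      using assms[OF that] E_u[OF that] by (simp add: mv_simps matrix_vector_sum)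
    show "bdot (u k) (x - ?y) = 0" if "k < m" for k
    proof -
      have "bdot (u k) ?y = (\<Sum>j<m. if j = k then bdot (u k) x else 0)"
        unfolding bdot_sum using that u_orth u_norm by (intro sum.cong) (auto simp: bdot_simps)
      then show ?thesis using that by (simp add: bdot_simps)
    qed
  qed
  then show ?thesis by simp
qed

text \<open>The \<open>K i\<close> are symmetric, so eigenvectors with different eigenvalues are
  orthogonal; the expansion in the \<open>u k\<close> therefore involves only the class
  \<mu>.\<close>

lemma singular_weight_in_span:
  assumes "\<And>i. i \<in> I \<Longrightarrow> E i *v x = 0" "\<And>i. i \<in> I \<Longrightarrow> K i *v x = wt i \<mu> *s x"
  shows "x = (\<Sum>k<m. if cl k = \<mu> then (bdot (u k) x / bdot (u k) (u k)) *s u k else 0)"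
proof -
  have "bdot (u k) x = 0" if "k < m" "cl k \<noteq> \<mu>" for k
  proof -
    obtain i where i: "i \<in> I" "wt i (cl k) \<noteq> wt i \<mu>" using wt_inj \<open>cl k \<noteq> \<mu>\<close> by blast
    have "wt i (cl k) * bdot (u k) x = bdot (K i *v u k) x"
      using i that by (simp add: K_u bdot_simps)
    also have "\<dots> = wt i \<mu> * bdot (u k) x"
      using i assms(2)[OF i(1)] by (simp add: bdot_matrix transpose_K bdot_simps del: transpose_matrix_vector)
    finally show ?thesis using i by simp
  qed
  then have "(\<Sum>k<m. if cl k = \<mu> then (bdot (u k) x / bdot (u k) (u k)) *s u k else 0) =
     (\<Sum>k<m. (bdot (u k) x / bdot (u k) (u k)) *s u k)"
    by (intro sum.cong) auto
  then show ?thesis using singular_in_span[OF assms(1)] by simp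
qed

definition cyc_sum :: "(nat \<Rightarrow> complex^'n^'n) \<Rightarrow> complex^'n" where
  "cyc_sum X = (\<Sum>k<m. X k *v u k)"

text \<open>Otherwise a nonzero g is orthogonal to all the cyclic modules. By contravariance its
  whole orbit is too, and the orbit contains a nonzero singular vector, contradicting
  \<open>complete\<close>.\<close>

lemma cyclic_total: "\<exists>X. (\<forall>k. X k \<in> alg) \<and> x = cyc_sum X"
proof (rule ccontr)
  define W where "W = {cyc_sum X | X. \<forall>k. X k \<in> alg}"
  have add: "cyc_sum X + cyc_sum Y = cyc_sum (\<lambda>k. X k + Y k)" for X Y
    by (simp add: cyc_sum_def mv_simps sum.distrib)
  have scale: "c *s cyc_sum X = cyc_sum (\<lambda>k. mat c ** X k)" for c X
    by (simp add: cyc_sum_def mv_simps vec.scale_sum_right)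
  have zero: "0 = cyc_sum (\<lambda>k. 0)"
    by (simp add: cyc_sum_def)
  have sub: "vec.subspace W"
  proof (rule vec.subspaceI)
    show "0 \<in> W" unfolding W_def zero using alg_intros(6) by blast
  next
    fix x y assume "x \<in> W" "y \<in> W"
    then obtain X Y where "\<forall>k. X k \<in> alg" "x = cyc_sum X" "\<forall>k. Y k \<in> alg" "y = cyc_sum Y"
      unfolding W_def by blast
    then show "x + y \<in> W" unfolding W_def using add alg_intros(7) by blast
  next
    fix c x assume "x \<in> W"
    then obtain X where "\<forall>k. X k \<in> alg" "x = cyc_sum X" unfolding W_def by blast
    then show "c *s x \<in> W" unfolding W_def using scale alg_intros(5,8) by blast
  qed
  assume "\<nexists>X. (\<forall>k. X k \<in> alg) \<and> x = cyc_sum X"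
  then have "x \<notin> W" by (auto simp: W_def)
  then obtain g where g: "\<And>w. w \<in> W \<Longrightarrow> bdot g w = 0" "bdot g x \<noteq> 0"
    using separating_vector[OF sub] by blast
  then have "g \<noteq> 0" by (auto simp: bdot_simps)
  then obtain X where X: "X \<in> alg" "X *v g \<noteq> 0" "\<forall>i\<in>I. E i *v (X *v g) = 0"
    using highest_vector_in_orbit by blast
  have "bdot (u k) (X *v g) = 0" if "k < m" for k
  proof -
    have "transpose X *v u k = cyc_sum (\<lambda>j. if j = k then transpose X else 0)"
      using that by (simp add: cyc_sum_def if_distrib[of "\<lambda>A. A *v _"] cong: if_cong del: transpose_matrix_vector)
    then have "transpose X *v u k \<in> W"
      unfolding W_def mem_Collect_eq
      using alg_transpose[OF X(1)] alg_intros(6)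
      by (intro exI[of _ "\<lambda>j. if j = k then transpose X else 0"] conjI) auto
    then have "bdot g (transpose X *v u k) = 0" by (rule g)
    then show ?thesis by (simp add: bdot_matrix[symmetric] bdot_commute del: transpose_matrix_vector)
  qed
  then show False using complete X by blast
qed

text \<open>The sum of the cyclic modules is direct (the case j = k), and what kills
  \<open>u k\<close> kills every \<open>u j\<close> of the same weight. Orthogonality isolates the
  k-th term, \<open>cyclic_same\<close> transfers its vanishing pairings to \<open>u j\<close>, and
  by \<open>cyclic_total\<close> the vector then pairs to zero with everything.\<close>

lemma cyc_sum_0:
  assumes "\<And>k. X k \<in> alg" "cyc_sum X = 0" "j < m" "k < m" "cl j = cl k"
  shows "X k *v u j = 0"
proof -
  have orth: "bdot (X k *v u k) (Y *v u k) = 0" if "Y \<in> alg" for Y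
  proof -
    have "bdot (cyc_sum X) (Y *v u k) = (\<Sum>i<m. if i = k then bdot (X k *v u k) (Y *v u k) else 0)"
      unfolding cyc_sum_def bdot_sum using assms(4) that assms(1) cyclic_orth by (intro sum.cong) auto
    then show ?thesis using assms(2,4) by (simp add: bdot_simps)
  qed
  show ?thesis
  proof (rule bdot_eq_0D)
    fix y
    obtain Y where Y: "\<forall>k. Y k \<in> alg" "y = cyc_sum Y" using cyclic_total by blast
    have "bdot (X k *v u j) (Y j *v u j) = 0"
      using cyclic_same[OF assms(1) _ assms(3-5), of "Y j" k] Y orth u_norm[OF assms(4)] by auto
    then have "bdot (X k *v u j) (Y i *v u i) = 0" if "i < m" for i
      using that cyclic_orth[of "X k" "Y i" j i] Y assms by (cases "i = j") auto
    then show "bdot (X k *v u j) y = 0"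
      by (simp add: Y(2) cyc_sum_def bdot_sum)
  qed
qed

lemma matrix_eqI_cyclic:
  assumes "\<And>X k. X \<in> alg \<Longrightarrow> k < m \<Longrightarrow> S *v (X *v u k) = T *v (X *v u k)"
  shows "S = T"
proof -
  have "S *v x = T *v x" for x
  proof -
    obtain X where X: "\<forall>k. X k \<in> alg" "x = cyc_sum X" using cyclic_total by blast
    then show ?thesis using assms by (simp add: cyc_sum_def matrix_vector_sum)
  qed
  then show ?thesis by (simp add: matrix_eq)
qed

text \<open>Only the entries \<open>f i k\<close> with \<open>cl i = cl k\<close> matter.\<close>

definition opF :: "(nat \<Rightarrow> nat \<Rightarrow> complex) \<Rightarrow> complex^'n^'n" where
  "opF f = (THE T. \<forall>X\<in>alg. \<forall>k<m.
     T *v (X *v u k) = (\<Sum>i<m. if cl i = cl k then f i k *s (X *v u i) else 0))"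

text \<open>Representing a vector as \<open>cyc_sum X\<close> leaves much freedom in X. The point is
  \<open>t0\<close>: by \<open>cyc_sum_0\<close> the prescribed image does not depend on the
  representative, and linearity follows by choosing convenient ones.\<close>

lemma opF_exists:
  "\<exists>T. \<forall>X\<in>alg. \<forall>k<m. T *v (X *v u k) = (\<Sum>i<m. if cl i = cl k then f i k *s (X *v u i) else 0)"
proof -
  define \<phi> where "\<phi> x = (SOME X. (\<forall>k. X k \<in> alg) \<and> x = cyc_sum X)" for x
  have phi: "\<phi> x k \<in> alg" "cyc_sum (\<phi> x) = x" for x k
    using someI_ex[OF cyclic_total[of x]] by (auto simp: \<phi>_def)
  define t where "t X = (\<Sum>k<m. \<Sum>i<m. if cl i = cl k then f i k *s (X k *v u i) else 0)" for X :: "nat \<Rightarrow> complex^'n^'n"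
  have t0: "t X = t Y" if "\<And>k. X k \<in> alg" "\<And>k. Y k \<in> alg" "cyc_sum X = cyc_sum Y" for X Y
  proof -
    have "cyc_sum (\<lambda>k. X k - Y k) = 0" using that(3) by (simp add: cyc_sum_def mv_simps sum_subtractf)
    then have *: "X k *v u i = Y k *v u i" if "i < m" "k < m" "cl i = cl k" for i k
      using cyc_sum_0[OF _ _ that, of "\<lambda>k. X k - Y k"] \<open>\<And>k. X k \<in> alg\<close> \<open>\<And>k. Y k \<in> alg\<close>
      by (simp add: alg_intros mv_simps)
    show ?thesis unfolding t_def by (intro sum.cong refl) (auto simp: *)
  qed
  define T where "T x = t (\<phi> x)" for x
  have lin: "Vector_Spaces.linear (*s) (*s) T"
    unfolding Vector_Spaces.linear_iff
  proof (intro conjI allI vec.vector_space_axioms)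
    fix x y
    have "T (x + y) = t (\<lambda>k. \<phi> x k + \<phi> y k)" unfolding T_def
    proof (rule t0)
      show "cyc_sum (\<phi> (x + y)) = cyc_sum (\<lambda>k. \<phi> x k + \<phi> y k)"
        using phi(2) by (simp add: cyc_sum_def mv_simps sum.distrib)
    qed (auto intro: phi alg_intros)
    also have "\<dots> = T x + T y"
      unfolding T_def t_def sum.distrib[symmetric] by (intro sum.cong refl) (auto simp: mv_simps)
    finally show "T (x + y) = T x + T y" .
  next
    fix c x
    have "T (c *s x) = t (\<lambda>k. mat c ** \<phi> x k)" unfolding T_def
    proof (rule t0)
      show "cyc_sum (\<phi> (c *s x)) = cyc_sum (\<lambda>k. mat c ** \<phi> x k)"
        using phi(2)[of "c *s x"] phi(2)[of x] by (simp add: cyc_sum_def mv_simps vec.scale_sum_right[symmetric])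
    qed (auto intro: phi alg_intros)
    also have "\<dots> = c *s T x"
      unfolding T_def t_def vec.scale_sum_right by (intro sum.cong refl) (auto simp: mv_simps mult.commute)
    finally show "T (c *s x) = c *s T x" .
  qed
  have "matrix T *v (X *v u k) = (\<Sum>i<m. if cl i = cl k then f i k *s (X *v u i) else 0)"
    if "X \<in> alg" "k < m" for X k
  proof -
    have "T (X *v u k) = t (\<lambda>j. if j = k then X else 0)"
      unfolding T_def
    proof (rule t0)
      show "cyc_sum (\<phi> (X *v u k)) = cyc_sum (\<lambda>j. if j = k then X else 0)"
        unfolding phi using that by (simp add: cyc_sum_def if_distrib[of "\<lambda>A. A *v _"] cong: if_cong)
    qed (use phi that alg_intros in auto)
    also have "\<dots> = (\<Sum>j<m. if j = k then (\<Sum>i<m. if cl i = cl k then f i k *s (X *v u i) else 0) else 0)"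
      unfolding t_def by (intro sum.cong refl) (auto intro!: sum.neutral sum.cong)
    finally show ?thesis using that by (simp add: matrix_works[OF lin])
  qed
  then show ?thesis by blast
qed

lemma opF:
  assumes "X \<in> alg" "k < m"
  shows "opF f *v (X *v u k) = (\<Sum>i<m. if cl i = cl k then f i k *s (X *v u i) else 0)"
proof -
  obtain T where T: "\<forall>X\<in>alg. \<forall>k<m. T *v (X *v u k) = (\<Sum>i<m. if cl i = cl k then f i k *s (X *v u i) else 0)"
    using opF_exists by blast
  have "opF f = T" unfolding opF_def
    by (rule the_equality[where P = "\<lambda>T. \<forall>X\<in>alg. \<forall>k<m. T *v (X *v u k) = (\<Sum>i<m. if cl i = cl k then f i k *s (X *v u i) else 0)", OF T])
      (rule matrix_eqI_cyclic, simp add: T)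
  then show ?thesis using T assms by blast
qed

lemma opF_u:
  assumes "k < m"
  shows "opF f *v u k = (\<Sum>i<m. if cl i = cl k then f i k *s u i else 0)"
  using opF[OF alg_intros(5)[of 1] assms, of f] by (simp cong: sum.cong if_cong)

lemma opF_eqI:
  assumes "\<And>X k. X \<in> alg \<Longrightarrow> k < m \<Longrightarrow> T *v (X *v u k) = (\<Sum>i<m. if cl i = cl k then f i k *s (X *v u i) else 0)"
  shows "T = opF f"
  by (rule matrix_eqI_cyclic) (simp add: assms opF)

lemma opF_cong:
  assumes "\<And>i k. i < m \<Longrightarrow> k < m \<Longrightarrow> cl i = cl k \<Longrightarrow> f i k = g i k"
  shows "opF f = opF g"
  by (rule opF_eqI) (auto simp: opF assms intro!: sum.cong)

lemma opF_add: "opF f + opF g = opF (\<lambda>i k. f i k + g i k)"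
  by (rule opF_eqI) (auto simp: opF mv_simps sum.distrib[symmetric] intro!: sum.cong)

lemma opF_scale: "mat c ** opF f = opF (\<lambda>i k. c * f i k)"
  by (rule opF_eqI) (auto simp: opF mv_simps vec.scale_sum_right intro!: sum.cong)

lemma opF_diff: "opF f - opF g = opF (\<lambda>i k. f i k - g i k)"
  by (rule opF_eqI) (auto simp: opF mv_simps sum_subtractf[symmetric] vec.scale_left_diff_distrib intro!: sum.cong)

lemma opF_commute:
  assumes "Y \<in> alg"
  shows "opF f ** Y = Y ** opF f"
proof (rule matrix_eqI_cyclic)
  fix X k assume X: "X \<in> alg" "k < m"
  have "opF f *v ((Y ** X) *v u k) = (\<Sum>i<m. if cl i = cl k then f i k *s ((Y ** X) *v u i) else 0)"
    using X assms by (intro opF alg_intros)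
  also have "\<dots> = Y *v (opF f *v (X *v u k))"
    by (auto simp: opF X matrix_vector_sum mv_simps intro!: sum.cong)
  finally show "(opF f ** Y) *v (X *v u k) = (Y ** opF f) *v (X *v u k)"
    by (simp add: matrix_vector_mul_assoc[symmetric])
qed

text \<open>Schur's lemma with multiplicities: T maps \<open>u k\<close> to a singular vector of the
  same weight, hence to a combination of the \<open>u i\<close> in its class, and commutation
  extends this to the orbit.\<close>

lemma commuting_opF:
  assumes comm: "\<And>X. X \<in> alg \<Longrightarrow> T ** X = X ** T"
  shows "T = opF (\<lambda>i k. bdot (u i) (T *v u k) / bdot (u i) (u i))"
proof (rule opF_eqI)
  fix X k assume X: "X \<in> alg" "k < m"
  have c: "Y *v (T *v x) = T *v (Y *v x)" if "Y \<in> alg" for x Y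
    using comm[OF that] by (metis matrix_vector_mul_assoc)
  have "T *v u k = (\<Sum>i<m. if cl i = cl k then (bdot (u i) (T *v u k) / bdot (u i) (u i)) *s u i else 0)"
    by (rule singular_weight_in_span) (use X in \<open>simp_all add: c alg_intros E_u K_u mv_simps\<close>)
  then have "X *v (T *v u k) = X *v (\<Sum>i<m. if cl i = cl k then (bdot (u i) (T *v u k) / bdot (u i) (u i)) *s u i else 0)"
    by simp
  also have "\<dots> = (\<Sum>i<m. if cl i = cl k then (bdot (u i) (T *v u k) / bdot (u i) (u i)) *s (X *v u i) else 0)"
    unfolding matrix_vector_sum by (auto simp: mv_simps intro!: sum.cong)
  finally show "T *v (X *v u k) =
    (\<Sum>i<m. if cl i = cl k then (bdot (u i) (T *v u k) / bdot (u i) (u i)) *s (X *v u i) else 0)"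
    using c X by simp
qed

text \<open>The hypothesis says that f is symmetric for the form on the multiplicity space whose
  Gram matrix is the diagonal matrix of the norms; the norms enter because the \<open>u i\<close>
  are not normalized.\<close>

lemma opF_transpose:
  assumes sym: "\<And>i k. i < m \<Longrightarrow> k < m \<Longrightarrow> cl i = cl k \<Longrightarrow> f i k * bdot (u i) (u i) = f k i * bdot (u k) (u k)"
  shows "transpose (opF f) = opF f"
proof -
  have "bdot (opF f *v x) y = bdot x (opF f *v y)" for x y
  proof -
    obtain X Y where X: "\<forall>k. X k \<in> alg" "x = cyc_sum X" and Y: "\<forall>k. Y k \<in> alg" "y = cyc_sum Y"
      using cyclic_total by metis
    have "bdot (opF f *v (X k *v u k)) (Y j *v u j) = bdot (X k *v u k) (opF f *v (Y j *v u j))"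
      if "k < m" "j < m" for j k
    proof -
      have "bdot (opF f *v (X k *v u k)) (Y j *v u j) =
          (\<Sum>i<m. bdot (if cl i = cl k then f i k *s (X k *v u i) else 0) (Y j *v u j))"
        using X that by (simp add: opF bdot_sum)
      also have "\<dots> = (\<Sum>i<m. if i = j then (if cl j = cl k then f j k * bdot (X k *v u j) (Y j *v u j) else 0) else 0)"
        using X Y that by (intro sum.cong) (auto simp: bdot_simps cyclic_orth)
      finally have 1: "bdot (opF f *v (X k *v u k)) (Y j *v u j) = (if cl j = cl k then f j k * bdot (X k *v u j) (Y j *v u j) else 0)"
        using that by simp
      have "bdot (X k *v u k) (opF f *v (Y j *v u j)) =
          (\<Sum>i<m. bdot (X k *v u k) (if cl i = cl j then f i j *s (Y j *v u i) else 0))"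
        using Y that by (simp add: opF bdot_sum)
      also have "\<dots> = (\<Sum>i<m. if i = k then (if cl k = cl j then f k j * bdot (X k *v u k) (Y j *v u k) else 0) else 0)"
        using X Y that by (intro sum.cong) (auto simp: bdot_simps cyclic_orth)
      finally have 2: "bdot (X k *v u k) (opF f *v (Y j *v u j)) = (if cl k = cl j then f k j * bdot (X k *v u k) (Y j *v u k) else 0)"
        using that by simp
      show ?thesis
      proof (cases "cl j = cl k")
        case True
        \<comment> \<open>Both sides are multiplied by the norm of \<open>u k\<close> so that
          \<open>cyclic_same\<close> applies; \<open>u_norm\<close> allows cancelling it
          afterwards.\<close>
        have "f j k * bdot (X k *v u j) (Y j *v u j) * bdot (u k) (u k) = f j k * bdot (u j) (u j) * bdot (X k *v u k) (Y j *v u k)"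
          using cyclic_same[of "X k" "Y j" j k] X Y that True by (simp add: algebra_simps)
        also have "\<dots> = f k j * bdot (X k *v u k) (Y j *v u k) * bdot (u k) (u k)"
          using sym[OF that(2,1) True] by simp
        finally show ?thesis using 1 2 True u_norm[OF that(1)] by simp
      qed (use 1 2 in auto)
    qed
    then show ?thesis unfolding X(2) Y(2) cyc_sum_def matrix_vector_sum bdot_sum
      by (intro sum.cong) auto
  qed
  then have "bdot x (transpose (opF f) *v y - opF f *v y) = 0" for x y
    by (simp add: bdot_simps bdot_matrix del: transpose_matrix_vector)
  then have "transpose (opF f) *v y - opF f *v y = 0" for y
    by (rule bdot_eq_0D[OF trans[OF bdot_commute]])
  then show ?thesis unfolding matrix_eq by (simp del: transpose_matrix_vector)
qed

text \<open>A nonzero submodule U contains a nonzero singular vector. Inside the cyclic module of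
  \<open>u k\<close> this is orthogonal to all other \<open>u j\<close>, hence a multiple of
  \<open>u k\<close>, so U contains the generator.\<close>

lemma span_singular_cyclic:
  assumes sub: "vec.subspace U" "\<And>X x. X \<in> alg \<Longrightarrow> x \<in> U \<Longrightarrow> X *v x \<in> U"
    and "U \<subseteq> {X *v u k | X. X \<in> alg}" "U \<noteq> {0}" "k < m"
  shows "U = {X *v u k | X. X \<in> alg}"
proof -
  obtain x where x: "x \<in> U" "x \<noteq> 0" using assms(4) sub(1) vec.subspace_0 by blast
  obtain X where X: "X \<in> alg" "X *v x \<noteq> 0" "\<forall>i\<in>I. E i *v (X *v x) = 0"
    using highest_vector_in_orbit[OF x(2)] by blast
  have XU: "X *v x \<in> U" using sub X x by blast
  then obtain Y where Y: "Y \<in> alg" "X *v x = Y *v u k" using assms(3) by blast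
  have "X *v x = (\<Sum>j<m. (bdot (u j) (X *v x) / bdot (u j) (u j)) *s u j)"
    by (rule singular_in_span) (use X in blast)
  also have "\<dots> = (\<Sum>j<m. if j = k then (bdot (u k) (X *v x) / bdot (u k) (u k)) *s u k else 0)"
    using cyclic_orth[OF alg_intros(5)[of 1] Y(1)] assms(5) by (intro sum.cong) (auto simp: Y)
  finally have *: "X *v x = (bdot (u k) (X *v x) / bdot (u k) (u k)) *s u k" using assms(5) by simp
  define c where "c = bdot (u k) (X *v x) / bdot (u k) (u k)"
  have c: "X *v x = c *s u k" "c \<noteq> 0" using * X(2) by (auto simp: c_def)
  then have "u k = inverse c *s (X *v x)" by simp
  then have "u k \<in> U" using XU sub(1) vec.subspace_scale by metis
  then show ?thesis using sub(2) assms(3) by blast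
qed

end

section \<open>Operators commuting with the lowering operators, and isotypic components\<close>

context contravariant_module
begin

lemma commutes_neg:
  assumes "\<And>i. i \<in> I \<Longrightarrow> G ** F i = F i ** G" "Z \<in> neg"
  shows "G ** Z = Z ** G"
  using assms(2)
proof (induction rule: neg_induct)
  case (mult X Y)
  then show ?case by (metis matrix_mul_assoc)
qed (simp_all add: assms(1) mat_commute madd)

text \<open>By \<open>alg_as_neg\<close> every vector of the cyclic module is \<open>Z u k\<close>
  with Z a polynomial in the \<open>F i\<close>. As \<open>opF f\<close>, G and G' all commute with
  Z, only the generators have to be tested.\<close>

lemma opF_intertwines_iff:
  assumes "\<And>i. i \<in> I \<Longrightarrow> G ** F i = F i ** G" "\<And>i. i \<in> I \<Longrightarrow> G' ** F i = F i ** G'"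
  shows "opF f ** G = G' ** opF f \<longleftrightarrow> (\<forall>k<m. opF f *v (G *v u k) = G' *v (opF f *v u k))"
proof (intro iffI allI impI)
  assume *: "\<forall>k<m. opF f *v (G *v u k) = G' *v (opF f *v u k)"
  show "opF f ** G = G' ** opF f"
  proof (rule matrix_eqI_cyclic)
    fix X k assume X: "X \<in> alg" "k < m"
    then obtain Z where Z: "Z \<in> neg" "X *v u k = Z *v u k" using alg_as_neg by blast
    have c: "opF f ** Z = Z ** opF f" "G ** Z = Z ** G" "G' ** Z = Z ** G'"
      using Z(1) opF_commute neg_alg commutes_neg assms by blast+
    have "(opF f ** G) *v (Z *v u k) = Z *v (opF f *v (G *v u k))"
      by (metis c(1,2) matrix_vector_mul_assoc)
    also have "\<dots> = Z *v (G' *v (opF f *v u k))" using * X by simp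
    also have "\<dots> = (G' ** opF f) *v (Z *v u k)"
      by (metis c(1,3) matrix_vector_mul_assoc)
    finally show "(opF f ** G) *v (X *v u k) = (G' ** opF f) *v (X *v u k)" using Z by simp
  qed
qed (metis matrix_vector_mul_assoc)

text \<open>\<open>C\<close> and \<open>C'\<close> are the reduced matrix elements of \<open>G\<close> and \<open>G'\<close>; the operators \<open>X\<close> depend
  only on the classes, which makes the condition on \<open>f\<close> a matrix equation.\<close>

lemma opF_reduced:
  assumes X: "\<And>\<mu> \<nu>. X \<mu> \<nu> \<in> alg"
    and G: "\<And>j. j < m \<Longrightarrow> G *v u j = (\<Sum>k<m. C k j *s (X (cl k) (cl j) *v u k))"
    and G': "\<And>j. j < m \<Longrightarrow> G' *v u j = (\<Sum>k<m. C' k j *s (X (cl k) (cl j) *v u k))"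
    and "j < m"
  shows "opF f *v (G *v u j) =
      (\<Sum>i<m. (\<Sum>k<m. if cl i = cl k then f i k * C k j else 0) *s (X (cl i) (cl j) *v u i))"
    "G' *v (opF f *v u j) =
      (\<Sum>i<m. (\<Sum>k<m. if cl k = cl j then C' i k * f k j else 0) *s (X (cl i) (cl j) *v u i))"
proof -
  have "opF f *v (G *v u j) =
      (\<Sum>k<m. \<Sum>i<m. (if cl i = cl k then f i k * C k j else 0) *s (X (cl i) (cl j) *v u i))"
    unfolding G[OF assms(4)] matrix_vector_sum matrix_vector_scale
    by (rule sum.cong[OF refl], subst opF)
      (auto simp: X vec.scale_sum_right mult.commute intro!: sum.cong)
  then show "opF f *v (G *v u j) =
      (\<Sum>i<m. (\<Sum>k<m. if cl i = cl k then f i k * C k j else 0) *s (X (cl i) (cl j) *v u i))"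
    unfolding vec.scale_sum_left by (subst sum.swap) simp
  have "G' *v (opF f *v u j) =
      (\<Sum>k<m. \<Sum>i<m. (if cl k = cl j then C' i k * f k j else 0) *s (X (cl i) (cl j) *v u i))"
    unfolding opF_u[OF assms(4)] matrix_vector_sum
    by (rule sum.cong[OF refl])
      (auto simp: G' mv_simps vec.scale_sum_right mult.commute intro!: sum.cong)
  then show "G' *v (opF f *v u j) =
      (\<Sum>i<m. (\<Sum>k<m. if cl k = cl j then C' i k * f k j else 0) *s (X (cl i) (cl j) *v u i))"
    unfolding vec.scale_sum_left by (subst sum.swap) simp
qed

text \<open>Coefficients can be compared because the cyclic modules form a direct sum, but only
  where the operator X does not kill \<open>u i\<close>. This is why nonvanishing has to be verified
  before the matrix equation can be used for uniqueness.\<close>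

lemma reduced_coeff_unique:
  assumes X: "\<And>\<mu> \<nu>. X \<mu> \<nu> \<in> alg"
    and "(\<Sum>i<m. \<alpha> i *s (X (cl i) \<nu> *v u i)) = (\<Sum>i<m. \<beta> i *s (X (cl i) \<nu> *v u i))"
    and "i < m" "X (cl i) \<nu> *v u i \<noteq> 0"
  shows "\<alpha> i = \<beta> i"
proof -
  have "cyc_sum (\<lambda>i. mat (\<alpha> i - \<beta> i) ** X (cl i) \<nu>) = 0"
    using assms(2) by (simp add: cyc_sum_def mv_simps vec.scale_left_diff_distrib sum_subtractf)
  from cyc_sum_0[OF _ this assms(3) assms(3) refl]
  have "(\<alpha> i - \<beta> i) *s (X (cl i) \<nu> *v u i) = 0"
    using X by (simp add: alg_intros mv_simps)
  then show ?thesis using assms(4) by simp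
qed

text \<open>\<open>submod\<close>, \<open>irred\<close> and \<open>iso\<close> transcribe
  \<open>G2_submodule\<close>, \<open>G2_irreducible\<close> and \<open>isotypic\<close> to the
  locale.\<close>

definition submod :: "(complex^'n) set \<Rightarrow> bool" where
  "submod W \<longleftrightarrow> vec.subspace W \<and> (\<forall>X\<in>alg. \<forall>x\<in>W. X *v x \<in> W)"

definition irred :: "(complex^'n) set \<Rightarrow> bool" where
  "irred W \<longleftrightarrow> submod W \<and> W \<noteq> {0} \<and> (\<forall>U. submod U \<and> U \<subseteq> W \<longrightarrow> U = {0} \<or> U = W)"

definition iso :: "'c \<Rightarrow> (complex^'n) set" where
  "iso \<mu> = vec.span (\<Union> {W. irred W \<and>
     (\<exists>x\<in>W. x \<noteq> 0 \<and> (\<forall>i\<in>I. E i *v x = 0 \<and> K i *v x = wt i \<mu> *s x))})"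

lemma u_nonzero: "k < m \<Longrightarrow> u k \<noteq> 0"
  using u_norm bdot_simps(7) by metis

lemma submod_cyclic: "submod {X *v x | X. X \<in> alg}"
  unfolding submod_def vec.subspace_def
proof (intro conjI ballI allI impI)
  show "0 \<in> {X *v x | X. X \<in> alg}" using alg_intros(6) by force
next
  fix y z assume "y \<in> {X *v x | X. X \<in> alg}" "z \<in> {X *v x | X. X \<in> alg}"
  then obtain Y Z where "Y \<in> alg" "y = Y *v x" "Z \<in> alg" "z = Z *v x" by blast
  then have "y + z = (Y + Z) *v x" "Y + Z \<in> alg" by (simp_all add: mv_simps alg_intros)
  then show "y + z \<in> {X *v x | X. X \<in> alg}" by blast
next
  fix y c assume "y \<in> {X *v x | X. X \<in> alg}"
  then obtain Y where "Y \<in> alg" "y = Y *v x" by blast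
  then have "c *s y = (mat c ** Y) *v x" "mat c ** Y \<in> alg" by (simp_all add: mv_simps alg_intros)
  then show "c *s y \<in> {X *v x | X. X \<in> alg}" by blast
next
  fix y Z assume "y \<in> {X *v x | X. X \<in> alg}" "Z \<in> alg"
  then obtain Y where "Y \<in> alg" "y = Y *v x" by blast
  then have "Z *v y = (Z ** Y) *v x" "Z ** Y \<in> alg" using \<open>Z \<in> alg\<close> by (simp_all add: mv_simps alg_intros)
  then show "Z *v y \<in> {X *v x | X. X \<in> alg}" by blast
qed

lemma mem_cyclic: "x \<in> {X *v x | X. X \<in> alg}"
  using alg_intros(5)[of 1] by force

lemma irred_cyclic:
  assumes "k < m"
  shows "irred {X *v u k | X. X \<in> alg}"
  unfolding irred_def
proof (intro conjI allI impI submod_cyclic)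
  show "{X *v u k | X. X \<in> alg} \<noteq> {0}" using mem_cyclic[of "u k"] u_nonzero[OF assms] by blast
next
  fix U assume U: "submod U \<and> U \<subseteq> {X *v u k | X. X \<in> alg}"
  have "U = {X *v u k | X. X \<in> alg}" if "U \<noteq> {0}"
    by (rule span_singular_cyclic[OF _ _ _ that assms]) (use U in \<open>auto simp: submod_def\<close>)
  then show "U = {0} \<or> U = {X *v u k | X. X \<in> alg}" by blast
qed

text \<open>An irreducible W with highest weight \<mu> is generated by its highest vector, which is
  a combination of the \<open>u k\<close> of class \<mu>; conversely each such \<open>u k\<close>
  generates an irreducible submodule.\<close>

lemma iso_eq: "iso \<mu> = vec.span {X *v u k | X k. X \<in> alg \<and> k < m \<and> cl k = \<mu>}"
proof (rule antisym)
  let ?S = "{X *v u k | X k. X \<in> alg \<and> k < m \<and> cl k = \<mu>}"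
  show "iso \<mu> \<subseteq> vec.span ?S"
    unfolding iso_def
  proof (rule vec.span_minimal[OF _ vec.subspace_span], rule Union_least, clarify)
    fix W x y assume W: "irred W" "x \<in> W" "x \<noteq> 0" "\<forall>i\<in>I. E i *v x = 0 \<and> K i *v x = wt i \<mu> *s x" "y \<in> W"
    have "submod {X *v x | X. X \<in> alg}" by (rule submod_cyclic)
    moreover have "{X *v x | X. X \<in> alg} \<subseteq> W" using W(1,2) by (auto simp: irred_def submod_def)
    moreover have "{X *v x | X. X \<in> alg} \<noteq> {0}" using mem_cyclic[of x] W(3) by blast
    moreover have "\<And>U. submod U \<Longrightarrow> U \<subseteq> W \<Longrightarrow> U = {0} \<or> U = W"
      using W(1) by (simp add: irred_def)
    ultimately have "{X *v x | X. X \<in> alg} = W" by (metis (no_types))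
    then obtain X where X: "X \<in> alg" "y = X *v x" using W(5) by blast
    define c where "c k = bdot (u k) x / bdot (u k) (u k)" for k
    have "x = (\<Sum>k<m. if cl k = \<mu> then c k *s u k else 0)"
      unfolding c_def by (rule singular_weight_in_span) (use W(4) in auto)
    then have "y = X *v (\<Sum>k<m. if cl k = \<mu> then c k *s u k else 0)" using X by simp
    also have "\<dots> = (\<Sum>k<m. if cl k = \<mu> then c k *s (X *v u k) else 0)"
      unfolding matrix_vector_sum by (auto simp: mv_simps intro!: sum.cong)
    also have "\<dots> \<in> vec.span ?S"
    proof (rule vec.span_sum)
      fix k assume k: "k \<in> {..<m}"
      have "c k *s (X *v u k) \<in> vec.span ?S" if "cl k = \<mu>"
        by (rule vec.span_scale, rule vec.span_base) (use X(1) k that in blast)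
      then show "(if cl k = \<mu> then c k *s (X *v u k) else 0) \<in> vec.span ?S"
        by (simp add: vec.span_zero)
    qed
    finally show "y \<in> vec.span ?S" .
  qed
  show "vec.span ?S \<subseteq> iso \<mu>"
    unfolding iso_def
  proof (rule vec.span_mono, rule subsetI)
    fix y assume "y \<in> ?S"
    then obtain X k where k: "X \<in> alg" "y = X *v u k" "k < m" "cl k = \<mu>" by blast
    show "y \<in> \<Union> {W. irred W \<and> (\<exists>x\<in>W. x \<noteq> 0 \<and> (\<forall>i\<in>I. E i *v x = 0 \<and> K i *v x = wt i \<mu> *s x))}"
    proof (rule UnionI[OF CollectI])
      show "y \<in> {X *v u k | X. X \<in> alg}" using k by blast
      show "irred {X *v u k | X. X \<in> alg} \<and> (\<exists>x\<in>{X *v u k | X. X \<in> alg}. x \<noteq> 0 \<and>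
          (\<forall>i\<in>I. E i *v x = 0 \<and> K i *v x = wt i \<mu> *s x))"
        by (rule conjI[OF irred_cyclic[OF k(3)] bexI[OF _ mem_cyclic[of "u k"]]])
          (simp add: u_nonzero[OF k(3)] E_u K_u k(3,4))
    qed
  qed
qed

lemma iso_eq_on:
  "(\<forall>x\<in>iso \<mu>. S *v x = T *v x) \<longleftrightarrow> (\<forall>X\<in>alg. \<forall>k<m. cl k = \<mu> \<longrightarrow> S *v (X *v u k) = T *v (X *v u k))"
proof
  assume "\<forall>x\<in>iso \<mu>. S *v x = T *v x"
  then show "\<forall>X\<in>alg. \<forall>k<m. cl k = \<mu> \<longrightarrow> S *v (X *v u k) = T *v (X *v u k)"
    unfolding iso_eq by (auto intro: vec.span_base)
next
  assume *: "\<forall>X\<in>alg. \<forall>k<m. cl k = \<mu> \<longrightarrow> S *v (X *v u k) = T *v (X *v u k)"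
  have "iso \<mu> \<subseteq> {x. S *v x = T *v x}"
    unfolding iso_eq
    by (rule vec.span_minimal) (use * in \<open>auto simp: vec.subspace_def mv_simps\<close>)
  then show "\<forall>x\<in>iso \<mu>. S *v x = T *v x" by blast
qed

lemma iso_zero:
  "(\<forall>x\<in>iso \<mu>. T *v x = 0) \<longleftrightarrow> (\<forall>X\<in>alg. \<forall>k<m. cl k = \<mu> \<longrightarrow> T *v (X *v u k) = 0)"
  using iso_eq_on[of \<mu> T 0] by simp

text \<open>The two conditions prescribe P on all \<open>X u k\<close>, and these vectors span the
  space, so the definite description is proper. A weight that does not occur has a zero isotypic
  component and imposes nothing.\<close>

lemma iso_projector:
  "(THE P. (\<forall>x\<in>iso \<mu>. P *v x = x) \<and> (\<forall>\<nu>. \<nu> \<noteq> \<mu> \<longrightarrow> (\<forall>x\<in>iso \<nu>. P *v x = 0))) =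
     opF (\<lambda>i k. if i = k \<and> cl k = \<mu> then 1 else 0)"
proof -
  have *: "((\<forall>x\<in>iso \<mu>. P *v x = x) \<and> (\<forall>\<nu>. \<nu> \<noteq> \<mu> \<longrightarrow> (\<forall>x\<in>iso \<nu>. P *v x = 0))) \<longleftrightarrow>
      (\<forall>X\<in>alg. \<forall>k<m. P *v (X *v u k) = (if cl k = \<mu> then X *v u k else 0))" for P
    using iso_eq_on[of \<mu> P "mat 1"] unfolding iso_zero by auto
  have "opF (\<lambda>i k. if i = k \<and> cl k = \<mu> then 1 else 0) *v (X *v u k) = (if cl k = \<mu> then X *v u k else 0)"
    if "X \<in> alg" "k < m" for X k
  proof -
    have "opF (\<lambda>i k. if i = k \<and> cl k = \<mu> then 1 else 0) *v (X *v u k) =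
        (\<Sum>i<m. if i = k then (if cl k = \<mu> then X *v u k else 0) else 0)"
      unfolding opF[OF that] by (intro sum.cong) auto
    then show ?thesis using that by simp
  qed
  then show ?thesis unfolding *
    by (intro the_equality) (auto intro!: matrix_eqI_cyclic)
qed

text \<open>Here e numbers the singular vectors of class \<mu> by the index type of f. The given
  vectors w may differ from them by a common factor c, which cancels; individual factors would
  conjugate f.\<close>

lemma iso_tensor_projector:
  fixes e :: "'m::finite \<Rightarrow> nat" and f :: "complex^'m^'m"
  assumes e: "inj e" "range e = {k. k < m \<and> cl k = \<mu>}"
    and w: "\<And>j. w $ j = c *s u (e j)" "c \<noteq> 0"
    and g: "\<And>i j. g (e i) (e j) = f $ i $ j"
  shows "(THE T. (\<forall>X\<in>alg. \<forall>j. T *v (X *v (w $ j)) = (\<Sum>i\<in>UNIV. f $ i $ j *s (X *v (w $ i)))) \<and>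
      (\<forall>\<nu>. \<nu> \<noteq> \<mu> \<longrightarrow> (\<forall>x\<in>iso \<nu>. T *v x = 0))) =
     opF (\<lambda>i k. if cl k = \<mu> then g i k else 0)"
proof -
  have sum: "(\<Sum>i<m. if cl i = \<mu> then h i else 0) = (\<Sum>i\<in>UNIV. h (e i))" for h :: "nat \<Rightarrow> complex^'n"
  proof -
    have "(\<Sum>i<m. if cl i = \<mu> then h i else 0) = (\<Sum>i\<in>range e. h i)"
      unfolding e(2) by (rule sum.mono_neutral_cong_right) auto
    then show ?thesis by (simp add: sum.reindex[OF e(1)])
  qed
  have ecl: "e j < m" "cl (e j) = \<mu>" for j
    using e(2) by blast+
  have ex: "\<exists>j. k = e j" if "k < m" "cl k = \<mu>" for k
    using that e(2) by (metis (mono_tags, lifting) image_iff mem_Collect_eq)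
  have scaled: "T *v (X *v (w $ j)) = (\<Sum>i\<in>UNIV. f $ i $ j *s (X *v (w $ i))) \<longleftrightarrow>
      T *v (X *v u (e j)) = (\<Sum>i\<in>UNIV. g (e i) (e j) *s (X *v u (e i)))" for T X :: "complex^'n^'n" and j
  proof -
    have "(\<Sum>i\<in>UNIV. f $ i $ j *s (X *v (w $ i))) = c *s (\<Sum>i\<in>UNIV. g (e i) (e j) *s (X *v u (e i)))"
      by (auto simp: w g mv_simps vec.scale_sum_right mult.commute intro!: sum.cong)
    moreover have "T *v (X *v (w $ j)) = c *s (T *v (X *v u (e j)))" by (simp add: w mv_simps)
    ultimately show ?thesis using w(2) by simp
  qed
  let ?T = "\<lambda>X k. if cl k = \<mu> then (\<Sum>i<m. if cl i = \<mu> then g i k *s (X *v u i) else 0) else 0"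
  have *: "((\<forall>X\<in>alg. \<forall>j. T *v (X *v (w $ j)) = (\<Sum>i\<in>UNIV. f $ i $ j *s (X *v (w $ i)))) \<and>
      (\<forall>\<nu>. \<nu> \<noteq> \<mu> \<longrightarrow> (\<forall>x\<in>iso \<nu>. T *v x = 0))) \<longleftrightarrow>
      (\<forall>X\<in>alg. \<forall>k<m. T *v (X *v u k) = ?T X k)" for T
  proof -
    have P: "(\<forall>j. P (e j)) \<longleftrightarrow> (\<forall>k<m. cl k = \<mu> \<longrightarrow> P k)" for P
      using ecl ex by blast
    have "(\<forall>j. T *v (X *v u (e j)) = (\<Sum>i\<in>UNIV. g (e i) (e j) *s (X *v u (e i)))) \<longleftrightarrow>
        (\<forall>k<m. cl k = \<mu> \<longrightarrow> T *v (X *v u k) = (\<Sum>i\<in>UNIV. g (e i) k *s (X *v u (e i))))" for X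
      by (rule P[of "\<lambda>k. T *v (X *v u k) = (\<Sum>i\<in>UNIV. g (e i) k *s (X *v u (e i)))"])
    then show ?thesis unfolding scaled iso_zero sum by (simp only: split: if_splits) blast
  qed
  have "opF (\<lambda>i k. if cl k = \<mu> then g i k else 0) *v (X *v u k) = ?T X k" if "X \<in> alg" "k < m" for X k
    unfolding opF[OF that] by (auto intro!: sum.cong sum.neutral)
  then show ?thesis unfolding *
    by (intro the_equality) (auto intro!: matrix_eqI_cyclic)
qed

end

section \<open>Tensor products\<close>

definition tens :: "complex^'n \<Rightarrow> complex^'m \<Rightarrow> complex^('n \<times> 'm)" where
  "tens x y = (\<chi> p. x $ fst p * y $ snd p)"

lemma tens_simps:
  "tens (x + x') y = tens x y + tens x' y" "tens x (y + y') = tens x y + tens x y'"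
  "tens (c *s x) y = c *s tens x y" "tens x (c *s y) = c *s tens x y"
  "tens 0 y = 0" "tens x 0 = 0"
  by (simp_all add: tens_def vec_eq_iff algebra_simps)

lemma kron_tens: "kron A B *v tens x y = tens (A *v x) (B *v y)"
proof -
  have "(kron A B *v tens x y) $ p = tens (A *v x) (B *v y) $ p" for p
  proof -
    have "(kron A B *v tens x y) $ p =
        (\<Sum>i\<in>UNIV. \<Sum>j\<in>UNIV. A $ fst p $ i * B $ snd p $ j * (x $ i * y $ j))"
      by (simp add: kron_def tens_def matrix_vector_mult_def sum.cartesian_product UNIV_Times_UNIV[symmetric]
          case_prod_unfold del: UNIV_Times_UNIV)
    also have "\<dots> = tens (A *v x) (B *v y) $ p"
      by (simp add: tens_def matrix_vector_mult_def sum_product algebra_simps)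
    finally show ?thesis .
  qed
  then show ?thesis by (simp add: vec_eq_iff)
qed

lemma bdot_tens: "bdot (tens x y) (tens x' y') = bdot x x' * bdot y y'"
  by (simp add: bdot_def tens_def sum_product sum.cartesian_product UNIV_Times_UNIV[symmetric]
      case_prod_unfold algebra_simps del: UNIV_Times_UNIV)

lemma kron_mult: "kron A B ** kron C D = kron (A ** C) (B ** D)"
proof -
  have "(kron A B ** kron C D) $ p $ r = kron (A ** C) (B ** D) $ p $ r" for p r
    by (simp add: kron_def matrix_matrix_mult_def sum_product sum.cartesian_product
        UNIV_Times_UNIV[symmetric] case_prod_unfold algebra_simps del: UNIV_Times_UNIV)
  then show ?thesis by (simp add: vec_eq_iff)
qed

lemma kron_transpose: "transpose (kron A B) = kron (transpose A) (transpose B)"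
  by (simp add: kron_def transpose_def vec_eq_iff)

lemma kron_simps:
  "kron (A + A') B = kron A B + kron A' B" "kron A (B + B') = kron A B + kron A B'"
  "kron (A - A') B = kron A B - kron A' B" "kron A (B - B') = kron A B - kron A B'"
  "kron (mat c ** A) B = mat c ** kron A B" "kron A (mat c ** B) = mat c ** kron A B"
  by (simp_all add: kron_def vec_eq_iff mat_scal algebra_simps)

lemma kron_zero: "kron 0 B = 0" "kron A 0 = 0"
  by (simp_all add: kron_def vec_eq_iff)

lemma kron_one: "kron (mat 1) (mat 1) = mat 1"
  by (auto simp: kron_def vec_eq_iff mat_def prod_eq_iff)

lemma Kop_commute: "Kop p i ** Kop r j = Kop r j ** Kop p i"
  unfolding Kop_mult by (auto simp: vec_eq_iff Kop_def)

lemma transpose_Kop: "transpose (Kop p i) = Kop p i"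
  by (auto simp: transpose_def Kop_def vec_eq_iff)

lemma Kop_conj:
  assumes "p \<noteq> 0" "i \<in> {0,1,2}" "j \<in> {0,1,2}"
  shows "Kop p i ** Eop r2 r3 a j = mat (p powi (Bsym i j)) ** (Eop r2 r3 a j ** Kop p i)"
    "Kop p i ** Fop r2 r3 a j = mat (p powi (- Bsym i j)) ** (Fop r2 r3 a j ** Kop p i)"
proof -
  have *: "Kop p i ** A = (Kop p i ** A ** Kop (inverse p) i) ** Kop p i" for A
    by (simp add: matrix_mul_assoc[symmetric] K_KK[OF assms(1)])
  show "Kop p i ** Eop r2 r3 a j = mat (p powi (Bsym i j)) ** (Eop r2 r3 a j ** Kop p i)"
    "Kop p i ** Fop r2 r3 a j = mat (p powi (- Bsym i j)) ** (Fop r2 r3 a j ** Kop p i)"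
    by (subst *, simp only: K_E[OF assms] matrix_mul_assoc)+
qed

lemma Bsym_commute: "Bsym i j = Bsym j i"
  by (auto simp: Bsym_def insert_commute)

lemma Fop_nonzero_index: "j \<noteq> 0 \<Longrightarrow> Fop r2 r3 a j = Fop r2 r3 b j"
  by (simp add: Fop_def)

lemma Eop_nonzero_index: "j \<noteq> 0 \<Longrightarrow> Eop r2 r3 a j = Eop r2 r3 b j"
  by (simp add: Eop_def)

lemma Fop_transpose: "j \<noteq> 0 \<Longrightarrow> transpose (Fop r2 r3 a j) = Eop r2 r3 b j"
  by (simp add: Fop_def Eop_def)

lemma E0op_scale: "E0op r2 r3 a = mat a ** E0op r2 r3 1"
  by (simp add: E0op_def madd mat_munit)

text \<open>E_0(a) is linear in a, so the factor 1 / a^2 turns it into E_0(1/a). Transposition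
  therefore inverts the spectral parameters.\<close>

lemma Fop_zero: "a \<noteq> 0 \<Longrightarrow> Fop r2 r3 a 0 = transpose (Eop r2 r3 (1 / a) 0)"
proof -
  assume "a \<noteq> 0"
  then have "mat (1 / a\<^sup>2) ** E0op r2 r3 a = E0op r2 r3 (1 / a)"
    by (simp add: E0op_def madd mat_munit power2_eq_square)
  then show ?thesis by (simp add: Fop_def Eop_def)
qed

lemma DF_transpose: "i \<noteq> 0 \<Longrightarrow> transpose (DF h r2 r3 a b i) = DE h r2 r3 c d i"
  by (simp add: DE_def DF_def transpose_add kron_transpose transpose_Kop
      Fop_transpose[of i r2 r3 a c] Fop_transpose[of i r2 r3 b d])

lemma DF_zero: "a \<noteq> 0 \<Longrightarrow> b \<noteq> 0 \<Longrightarrow> DF h r2 r3 a b 0 = transpose (DE h r2 r3 (1 / a) (1 / b) 0)"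
  by (simp add: DE_def DF_def transpose_add kron_transpose transpose_Kop Fop_zero)

lemma DF_const: "i \<noteq> 0 \<Longrightarrow> DF h r2 r3 a b i = DF h r2 r3 c d i"
  and DE_const: "i \<noteq> 0 \<Longrightarrow> DE h r2 r3 a b i = DE h r2 r3 c d i"
  by (simp_all add: DE_def DF_def Fop_nonzero_index[of i r2 r3 a c] Fop_nonzero_index[of i r2 r3 b d]
      Eop_nonzero_index[of i r2 r3 a c] Eop_nonzero_index[of i r2 r3 b d])

lemma DK_transpose: "transpose (DK p i) = DK p i"
  by (simp add: DK_def kron_transpose transpose_Kop)

lemma DK_inverse: "p \<noteq> 0 \<Longrightarrow> DK p i ** DK (inverse p) i = mat 1" "p \<noteq> 0 \<Longrightarrow> DK (inverse p) i ** DK p i = mat 1"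
  by (simp_all add: DK_def kron_mult K_KK kron_one)

lemma Kop_square: "h\<^sup>2 = p \<Longrightarrow> Kop h i ** Kop h i = Kop p i"
  unfolding Kop_mult
  by (auto simp: vec_eq_iff Kop_def power_int_mult_distrib[symmetric] power2_eq_square)

lemma DK_DF:
  assumes "p \<noteq> 0" "i \<in> {0,1,2}" "j \<in> {0,1,2}"
  shows "DK p i ** DF h r2 r3 a b j = mat (p powi (- Bsym i j)) ** (DF h r2 r3 a b j ** DK p i)"
  by (simp add: DK_def DF_def madd kron_mult Kop_conj[OF assms] kron_simps
      Kop_commute[of p i h j] Kop_commute[of p i "inverse h" j])

text \<open>The mixed terms on the two sides acquire the same powers of h, by symmetry of
  \<open>Bsym\<close>, and cancel. The remaining commutators telescope: (K - K') tensor K plus K'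
  tensor (K - K') is K tensor K minus K' tensor K'. Admitting i = 0 gives the commutation of E_0
  with F_1 and F_2.\<close>

lemma DE_DF:
  assumes q: "q \<noteq> 0" "\<And>n :: nat. n > 0 \<Longrightarrow> q ^ n \<noteq> 1" "h\<^sup>2 = q"
    and r: "r2\<^sup>2 = qint q 1 2" "r3\<^sup>2 = qint q 1 3" and ab: "a \<noteq> 0" "b \<noteq> 0"
    and i: "i \<in> {0,1,2}" and j: "j \<in> {1,2}"
  shows "DE h r2 r3 a b i ** DF h r2 r3 c d j = DF h r2 r3 c d j ** DE h r2 r3 a b i +
     (if i = j then mat (1 / (q ^ dsym i - inverse q ^ dsym i)) ** (DK q i - DK (inverse q) i) else 0)"
proof -
  have h: "h \<noteq> 0" "inverse h \<noteq> 0" using q by auto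
  have h': "(inverse h)\<^sup>2 = inverse q" unfolding q(3)[symmetric] by (simp add: power_inverse)
  have j': "j \<in> {0,1,2}" "j \<noteq> 0" using j by auto
  let ?c = "if i = j then mat (1 / (q ^ dsym i - inverse q ^ dsym i)) ** (Kop q i - Kop (inverse q) i) else 0"
  have EF: "Eop r2 r3 e i ** Fop r2 r3 e j = Fop r2 r3 e j ** Eop r2 r3 e i + ?c" if "e \<noteq> 0" for e
  proof -
    have "Eop r2 r3 e i ** Fop r2 r3 e j - Fop r2 r3 e j ** Eop r2 r3 e i = ?c"
      using L1_rep[OF q(1,2) r that] i j' unfolding Uq_D43_rep_def by blast
    then show ?thesis by (simp add: algebra_simps)
  qed
  have F: "Fop r2 r3 c j = Fop r2 r3 a j" "Fop r2 r3 d j = Fop r2 r3 b j"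
    using Fop_nonzero_index[OF j'(2)] by blast+
  let ?k = "h powi Bsym i j" and ?k' = "inverse h powi Bsym i j"
  have kk: "h powi (- Bsym i j) = ?k'" "inverse h powi (- Bsym i j) = ?k"
    by (simp_all add: power_int_minus power_int_inverse)
  have K1: "Kop h i ** Fop r2 r3 e j = mat ?k' ** (Fop r2 r3 e j ** Kop h i)"
    "Kop (inverse h) i ** Fop r2 r3 e j = mat ?k ** (Fop r2 r3 e j ** Kop (inverse h) i)" for e
    using Kop_conj(2)[OF h(1) i j'(1)] Kop_conj(2)[OF h(2) i j'(1)] by (simp_all only: kk)
  have K2: "Kop h j ** Eop r2 r3 e i = mat ?k ** (Eop r2 r3 e i ** Kop h j)"
    "Kop (inverse h) j ** Eop r2 r3 e i = mat ?k' ** (Eop r2 r3 e i ** Kop (inverse h) j)" for e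
    using Kop_conj(1)[OF h(1) j'(1) i] Kop_conj(1)[OF h(2) j'(1) i] by (simp_all only: Bsym_commute[of j i])
  have "DE h r2 r3 a b i ** DF h r2 r3 c d j =
      kron (Eop r2 r3 a i ** Fop r2 r3 a j) (Kop h i ** Kop h j)
      + mat ?k' ** kron (Eop r2 r3 a i ** Kop (inverse h) j) (Fop r2 r3 b j ** Kop h i)
      + (mat ?k ** kron (Fop r2 r3 a j ** Kop (inverse h) i) (Eop r2 r3 b i ** Kop h j)
      + kron (Kop (inverse h) i ** Kop (inverse h) j) (Eop r2 r3 b i ** Fop r2 r3 b j))"
    by (simp add: DE_def DF_def F madd kron_mult K1 kron_simps)
  moreover have "DF h r2 r3 c d j ** DE h r2 r3 a b i =
      kron (Fop r2 r3 a j ** Eop r2 r3 a i) (Kop h j ** Kop h i)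
      + mat ?k ** kron (Fop r2 r3 a j ** Kop (inverse h) i) (Eop r2 r3 b i ** Kop h j)
      + (mat ?k' ** kron (Eop r2 r3 a i ** Kop (inverse h) j) (Fop r2 r3 b j ** Kop h i)
      + kron (Kop (inverse h) j ** Kop (inverse h) i) (Fop r2 r3 b j ** Eop r2 r3 b i))"
    by (simp add: DE_def DF_def F madd kron_mult K2 kron_simps)
  ultimately have 1: "DE h r2 r3 a b i ** DF h r2 r3 c d j = DF h r2 r3 c d j ** DE h r2 r3 a b i +
      (kron ?c (Kop h i ** Kop h j) + kron (Kop (inverse h) i ** Kop (inverse h) j) ?c)"
    unfolding EF[OF ab(1)] EF[OF ab(2)]
    by (simp only: kron_simps Kop_commute[of h j h i] Kop_commute[of "inverse h" j "inverse h" i] ac_simps)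
  show ?thesis
  proof (cases "i = j")
    case True
    then show ?thesis unfolding 1
      by (simp add: Kop_square[OF q(3)] Kop_square[OF h'] kron_simps DK_def madd)
        (simp add: mat_scal vec_eq_iff algebra_simps)
  next
    case False
    then show ?thesis unfolding 1 by (simp add: kron_zero)
  qed
qed


lemma munit_axis: "munit c i j *v axis k 1 = (if j = k then c *s axis i 1 else 0)"
proof -
  have "(\<Sum>l\<in>UNIV. munit c i j $ x $ l * axis k 1 $ l) = (if j = k \<and> x = i then c else 0)" for x
  proof -
    have "(\<Sum>l\<in>UNIV. munit c i j $ x $ l * axis k 1 $ l) =
        (\<Sum>l\<in>UNIV. if l = k then (if j = k \<and> x = i then c else 0) else 0)"
      by (rule sum.cong) (auto simp: munit_def axis_def)
    then show ?thesis by simp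
  qed
  then show ?thesis by (auto simp: vec_eq_iff matrix_vector_mult_def axis_def)
qed

lemma mv_neg: "A *v (- x) = - (A *v x)" for A :: "complex^'n^'m"
  using matrix_vector_scale[of A "-1" x] by simp

lemma tens_axis: "tens (axis k 1) (axis l 1) = axis (k, l) 1"
  by (auto simp: tens_def vec_eq_iff axis_def)

lemma Kop_axis: "Kop p i *v axis k 1 = p powi (int (dsym i) * wt i $ k) *s axis k 1"
proof -
  have "(\<Sum>l\<in>UNIV. Kop p i $ x $ l * axis k 1 $ l) =
      (\<Sum>l\<in>UNIV. if l = k then (if x = k then p powi (int (dsym i) * wt i $ k) else 0) else 0)" for x
    by (rule sum.cong) (auto simp: Kop_def axis_def)
  then show ?thesis by (auto simp: vec_eq_iff matrix_vector_mult_def axis_def)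
qed

section \<open>Coordinates in which all operators are rational in h\<close>

locale D43_parameters =
  fixes q h r2 r3 :: complex
  assumes q_nonzero: "q \<noteq> 0"
    and q_generic: "\<And>n :: nat. n > 0 \<Longrightarrow> q ^ n \<noteq> 1"
    and h_square: "h\<^sup>2 = q"
    and r2_square: "r2\<^sup>2 = qint q 1 2"
    and r3_square: "r3\<^sup>2 = qint q 1 3"
begin

lemma h_nonzero [simp]: "h \<noteq> 0"
  using q_nonzero h_square by auto

lemma h_generic: "n > 0 \<Longrightarrow> h ^ n \<noteq> 1"
  using q_generic[of n] h_square by (metis power_mult mult.commute power_one)

lemma h_minus: "n > 0 \<Longrightarrow> h ^ n \<noteq> - 1"
  using h_generic[of "n * 2"] by (auto simp: power_mult)

text \<open>The factors of the norms and denominators below. Each divides some h^n - 1 with n > 0,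
  so it is nonzero because q, and hence h, is not a root of unity.\<close>

lemma nonzero_factors [simp]:
  "1 + h ^ 4 \<noteq> 0" "h ^ 4 + 1 \<noteq> 0" "1 + h ^ 16 \<noteq> 0" "1 + h ^ 4 + h ^ 8 \<noteq> 0" "h ^ 8 + h ^ 4 + 1 \<noteq> 0" "1 - h ^ 8 + h ^ 16 \<noteq> 0"
  "1 + h ^ 4 + h ^ 8 + h ^ 12 + h ^ 16 + h ^ 20 + h ^ 24 \<noteq> 0"
proof -
  have *: "a + b = 0 \<Longrightarrow> b = - a" for a b :: complex by (simp add: eq_neg_iff_add_eq_0 add.commute)
  show "1 + h ^ 4 \<noteq> 0" "1 + h ^ 16 \<noteq> 0" using h_minus[of 4] h_minus[of 16] * by auto
  then show "h ^ 4 + 1 \<noteq> 0" by (simp add: add.commute)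
  have "(1 + h ^ 4 + h ^ 8) * (1 - h ^ 4) = 1 - h ^ 12" by algebra
  then show "1 + h ^ 4 + h ^ 8 \<noteq> 0" using h_generic[of 12] by auto
  then show "h ^ 8 + h ^ 4 + 1 \<noteq> 0" by (simp add: ac_simps)
  have "(1 - h ^ 8 + h ^ 16) * (1 + h ^ 8) = 1 + h ^ 24" by algebra
  then show "1 - h ^ 8 + h ^ 16 \<noteq> 0" using h_minus[of 24] * by fastforce
  have "(1 + h ^ 4 + h ^ 8 + h ^ 12 + h ^ 16 + h ^ 20 + h ^ 24) * (1 - h ^ 4) = 1 - h ^ 28" by algebra
  then show "1 + h ^ 4 + h ^ 8 + h ^ 12 + h ^ 16 + h ^ 20 + h ^ 24 \<noteq> 0" using h_generic[of 28] by auto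
qed

lemma r2_mult: "r2 * r2 = (h ^ 4 + 1) / h\<^sup>2"
  and r3_mult: "r3 * r3 = (h ^ 8 + h ^ 4 + 1) / h ^ 4"
proof -
  note r = roots[OF q_nonzero q_generic[of 2] q_generic[of 4] r2_square r3_square, simplified]
  show "r2 * r2 = (h ^ 4 + 1) / h\<^sup>2"
    unfolding r(2) h_square[symmetric] by (simp add: field_simps)
  show "r3 * r3 = (h ^ 8 + h ^ 4 + 1) / h ^ 4"
    unfolding r(3) h_square[symmetric] by (simp add: field_simps)
qed

lemma r_nonzero [simp]: "r2 \<noteq> 0" "r3 \<noteq> 0"
  using r2_mult r3_mult by auto

definition sc :: "nat \<Rightarrow> complex" where
  "sc n = (if n = 4 then r2 else if n = 8 then r2 * r3 else 1)"

text \<open>In the basis \<open>v\<^sub>1, v\<^sub>2, v\<^sub>3, r2 v\<^sub>4, v\<^sub>5, v\<^sub>6, v\<^sub>7, r2 r3 v\<^sub>8\<close> all operators have entries in \<open>\<rat>(h)\<close>.\<close>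

definition bv :: "nat \<Rightarrow> complex^8" where
  "bv n = sc n *s axis (of_nat n) 1"

lemma F1op_bv:
  "F1op r2 *v bv 1 = bv 2" "F1op r2 *v bv 2 = 0" "F1op r2 *v bv 3 = bv 4"
  "F1op r2 *v bv 4 = ((h ^ 4 + 1) / h\<^sup>2) *s bv 5" "F1op r2 *v bv 5 = 0" "F1op r2 *v bv 6 = bv 7"
  "F1op r2 *v bv 7 = 0" "F1op r2 *v bv 8 = 0"
  by (simp_all add: F1op_def bv_def sc_def mv_simps munit_axis r2_mult)

lemma F2op_bv:
  "F2op *v bv 1 = 0" "F2op *v bv 2 = bv 3" "F2op *v bv 3 = 0" "F2op *v bv 4 = 0"
  "F2op *v bv 5 = bv 6" "F2op *v bv 6 = 0" "F2op *v bv 7 = 0" "F2op *v bv 8 = 0"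
  by (simp_all add: F2op_def bv_def sc_def mv_simps munit_axis)

lemma E0op_bv:
  "E0op r2 r3 1 *v bv 1 = (h\<^sup>2 / (h ^ 4 + 1)) *s (bv 4 + bv 8)"
  "E0op r2 r3 1 *v bv 2 = bv 5" "E0op r2 r3 1 *v bv 3 = bv 6" "E0op r2 r3 1 *v bv 4 = bv 7"
  "E0op r2 r3 1 *v bv 5 = 0" "E0op r2 r3 1 *v bv 6 = 0" "E0op r2 r3 1 *v bv 7 = 0"
  "E0op r2 r3 1 *v bv 8 = ((h ^ 8 + h ^ 4 + 1) / h ^ 4) *s bv 7"
proof -
  have "h\<^sup>2 / (h ^ 4 + 1) = 1 / (r2 * r2)" by (simp add: r2_mult)
  then show "E0op r2 r3 1 *v bv 1 = (h\<^sup>2 / (h ^ 4 + 1)) *s (bv 4 + bv 8)"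
    by (simp add: E0op_def bv_def sc_def mv_simps munit_axis)
qed (simp_all add: E0op_def bv_def sc_def mv_simps munit_axis r3_mult)

lemma K0_bv:
  "Kop h 0 *v bv 1 = (1 / h\<^sup>2) *s bv 1" "Kop h 0 *v bv 2 = (1 / h) *s bv 2" "Kop h 0 *v bv 3 = (1 / h) *s bv 3"
  "Kop h 0 *v bv 4 = bv 4" "Kop h 0 *v bv 5 = h *s bv 5" "Kop h 0 *v bv 6 = h *s bv 6"
  "Kop h 0 *v bv 7 = h\<^sup>2 *s bv 7" "Kop h 0 *v bv 8 = bv 8"
  "Kop (inverse h) 0 *v bv 1 = h\<^sup>2 *s bv 1" "Kop (inverse h) 0 *v bv 2 = h *s bv 2" "Kop (inverse h) 0 *v bv 3 = h *s bv 3"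
  "Kop (inverse h) 0 *v bv 4 = bv 4" "Kop (inverse h) 0 *v bv 5 = (1 / h) *s bv 5" "Kop (inverse h) 0 *v bv 6 = (1 / h) *s bv 6"
  "Kop (inverse h) 0 *v bv 7 = (1 / h\<^sup>2) *s bv 7" "Kop (inverse h) 0 *v bv 8 = bv 8"
  by (simp_all add: bv_def mv_simps Kop_axis wt_simps dsym_def power_int_minus field_simps)

lemma K1_bv:
  "Kop h 1 *v bv 1 = h *s bv 1" "Kop h 1 *v bv 2 = (1 / h) *s bv 2" "Kop h 1 *v bv 3 = h\<^sup>2 *s bv 3"
  "Kop h 1 *v bv 4 = bv 4" "Kop h 1 *v bv 5 = (1 / h\<^sup>2) *s bv 5" "Kop h 1 *v bv 6 = h *s bv 6"
  "Kop h 1 *v bv 7 = (1 / h) *s bv 7" "Kop h 1 *v bv 8 = bv 8"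
  "Kop (inverse h) 1 *v bv 1 = (1 / h) *s bv 1" "Kop (inverse h) 1 *v bv 2 = h *s bv 2" "Kop (inverse h) 1 *v bv 3 = (1 / h\<^sup>2) *s bv 3"
  "Kop (inverse h) 1 *v bv 4 = bv 4" "Kop (inverse h) 1 *v bv 5 = h\<^sup>2 *s bv 5" "Kop (inverse h) 1 *v bv 6 = (1 / h) *s bv 6"
  "Kop (inverse h) 1 *v bv 7 = h *s bv 7" "Kop (inverse h) 1 *v bv 8 = bv 8"
  by (simp_all add: bv_def mv_simps Kop_axis wt_simps dsym_def power_int_minus field_simps)

lemma K2_bv:
  "Kop h 2 *v bv 1 = bv 1" "Kop h 2 *v bv 2 = h ^ 3 *s bv 2" "Kop h 2 *v bv 3 = (1 / h ^ 3) *s bv 3"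
  "Kop h 2 *v bv 4 = bv 4" "Kop h 2 *v bv 5 = h ^ 3 *s bv 5" "Kop h 2 *v bv 6 = (1 / h ^ 3) *s bv 6"
  "Kop h 2 *v bv 7 = bv 7" "Kop h 2 *v bv 8 = bv 8"
  "Kop (inverse h) 2 *v bv 1 = bv 1" "Kop (inverse h) 2 *v bv 2 = (1 / h ^ 3) *s bv 2" "Kop (inverse h) 2 *v bv 3 = h ^ 3 *s bv 3"
  "Kop (inverse h) 2 *v bv 4 = bv 4" "Kop (inverse h) 2 *v bv 5 = (1 / h ^ 3) *s bv 5" "Kop (inverse h) 2 *v bv 6 = h ^ 3 *s bv 6"
  "Kop (inverse h) 2 *v bv 7 = bv 7" "Kop (inverse h) 2 *v bv 8 = bv 8"
  by (simp_all add: bv_def mv_simps Kop_axis wt_simps dsym_def power_int_minus field_simps)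

abbreviation T :: "nat \<Rightarrow> nat \<Rightarrow> complex^(8 \<times> 8)" where
  "T i j \<equiv> tens (bv i) (bv j)"

abbreviation "F1 \<equiv> DF h r2 r3 1 1 1"
abbreviation "F2 \<equiv> DF h r2 r3 1 1 2"
abbreviation "EL \<equiv> kron (E0op r2 r3 1) (Kop h 0)"
abbreviation "ER \<equiv> kron (Kop (inverse h) 0) (E0op r2 r3 1)"

lemma DE0_split: "DE h r2 r3 a b 0 = mat a ** EL + mat b ** ER"
  by (simp add: DE_def Eop_def E0op_scale[of r2 r3 a] E0op_scale[of r2 r3 b] kron_simps)

lemma F1_tens: "F1 *v tens x y =
    tens (F1op r2 *v x) (Kop h 1 *v y) + tens (Kop (inverse h) 1 *v x) (F1op r2 *v y)"
  and F2_tens: "F2 *v tens x y =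
    tens (F2op *v x) (Kop h 2 *v y) + tens (Kop (inverse h) 2 *v x) (F2op *v y)"
  by (simp_all add: DF_def Fop_def mv_simps kron_tens)

text \<open>The norm of \<open>bv n\<close> for \<open>bdot\<close>.\<close>

definition ns :: "nat \<Rightarrow> complex" where "ns n = sc n * sc n"

lemma sc_nonzero [simp]: "sc n \<noteq> 0"
  by (simp add: sc_def)

text \<open>The coordinates with respect to the vectors \<open>T i j\<close>.\<close>

definition co :: "complex^(8 \<times> 8) \<Rightarrow> nat \<Rightarrow> nat \<Rightarrow> complex" where
  "co x i j = bdot x (T i j) / (ns i * ns j)"

lemma bv_bdot: "bdot (bv i) (bv j) = (if (of_nat i :: 8) = of_nat j then sc i * sc j else 0)"
  by (simp add: bv_def bdot_simps bdot_axis) (simp add: axis_def)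

lemma of_nat_8_inj: "i \<in> {1..8} \<Longrightarrow> j \<in> {1..8} \<Longrightarrow> (of_nat i :: 8) = of_nat j \<longleftrightarrow> i = j"
proof -
  have e: "{1..8} = {1,2,3,4,5,6,7,8::nat}" by auto
  show "i \<in> {1..8} \<Longrightarrow> j \<in> {1..8} \<Longrightarrow> (of_nat i :: 8) = of_nat j \<longleftrightarrow> i = j"
    unfolding e by (elim insertE emptyE) simp_all
qed

lemma co_T: "i \<in> {1..8} \<Longrightarrow> j \<in> {1..8} \<Longrightarrow> k \<in> {1..8} \<Longrightarrow> l \<in> {1..8} \<Longrightarrow>
    co (T i j) k l = (if i = k \<and> j = l then 1 else 0)"
  by (simp add: co_def bdot_tens bv_bdot of_nat_8_inj ns_def)

text \<open>Turns the componentwise product with a numeral into a scaling, for which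
  \<open>co\<close> has a simplification rule.\<close>

lemma vec_numeral: "numeral w * x = numeral w *s x" for x :: "complex^'n"
  by (simp add: vec_eq_iff)

lemma co_simps:
  "numeral w * x = numeral w *s x"
  "co (x + y) i j = co x i j + co y i j" "co (x - y) i j = co x i j - co y i j"
  "co (c *s x) i j = c * co x i j" "co 0 i j = 0" "co (- x) i j = - co x i j"
  by (simp_all add: vec_numeral co_def bdot_simps add_divide_distrib diff_divide_distrib)

lemmas F1_simps = mv_neg F1_tens F1op_bv K1_bv tens_simps mv_simps co_simps co_T
lemmas F2_simps = mv_neg F2_tens F2op_bv K2_bv tens_simps mv_simps co_simps co_T
lemmas E0_simps = mv_neg kron_tens E0op_bv K0_bv tens_simps mv_simps co_simps co_T

lemma co_eqI:
  assumes "\<And>i j. i \<in> {1..8} \<Longrightarrow> j \<in> {1..8} \<Longrightarrow> co x i j = co y i j"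
  shows "x = y"
proof -
  have *: "x $ (of_nat i, of_nat j) = y $ (of_nat i, of_nat j)" if "i \<in> {1..8}" "j \<in> {1..8}" for i j
  proof -
    have "bdot z (T i j) = sc i * sc j * z $ (of_nat i, of_nat j)" for z
    proof -
      have "T i j = (sc i * sc j) *s axis (of_nat i, of_nat j) 1"
        by (simp add: bv_def tens_simps tens_axis mult.commute)
      then show ?thesis by (simp add: bdot_simps bdot_axis)
    qed
    then show ?thesis using assms[OF that] by (simp add: co_def ns_def)
  qed
  have ex: "\<exists>i\<in>{1..8}. k = of_nat i" for k :: 8
  proof -
    have e: "{1..8} = {1,2,3,4,5,6,7,8::nat}" by auto
    have "\<forall>k::8. \<exists>i\<in>{1..8}. k = of_nat i"
      unfolding forall_8 e by simp
    then show ?thesis by blast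
  qed
  have "x $ p = y $ p" for p
    using ex[of "fst p"] ex[of "snd p"] * by (metis prod.collapse)
  then show ?thesis by (simp add: vec_eq_iff)
qed

text \<open>Explicit lists let the simplifier unfold the claim into 64 scalar equations.\<close>

lemma co_eqI':
  assumes "list_all (\<lambda>i. list_all (\<lambda>j. co x i j = co y i j) [1,2,3,4,5,6,7,8]) [1,2,3,4,5,6,7,8]"
  shows "x = y"
proof -
  have e: "{1..8} = set [1,2,3,4,5,6,7,8::nat]" by auto
  show ?thesis by (rule co_eqI) (use assms in \<open>simp only: list_all_iff e\<close>)
qed

end

section \<open>Singular vectors\<close>

context D43_parameters
begin

text \<open>The singular vectors of weights \<open>2\<omega>\<^sub>1\<close>, \<open>\<omega>\<^sub>2\<close>, \<open>\<omega>\<^sub>1\<close> (three) and 0 (two); those of weight \<open>\<omega>\<^sub>1\<close> are the vectors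
  \<open>u\<^sub>j\<close> of the statement times \<open>r2 r3\<close>, which makes their coordinates rational in \<open>h\<close>.\<close>

definition sv :: "nat \<Rightarrow> complex^(8 \<times> 8)" where
  "sv k = (if k = 0 then T 1 1
    else if k = 1 then h *s T 1 2 + (- 1 / h) *s T 2 1
    else if k = 2 then (h ^ 6) *s T 1 4 + (- h - h ^ 5) *s T 2 3 + ((1 + h ^ 4) / h ^ 5) *s T 3 2 + (- 1 / h ^ 6) *s T 4 1
    else if k = 3 then T 1 8
    else if k = 4 then T 8 1
    else if k = 5 then (h ^ 10) *s T 1 7 + (- (h ^ 8)) *s T 2 6 + h\<^sup>2 *s T 3 5 + (1 / h\<^sup>2) *s T 5 3
      + (- 1 / h ^ 8) *s T 6 2 + (1 / h ^ 10) *s T 7 1 + (- h\<^sup>2 / (h ^ 4 + 1)) *s T 4 4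
    else (h ^ 6 / ((h ^ 4 + 1) * (h ^ 8 + h ^ 4 + 1))) *s T 8 8)"

text \<open>In these lemmas the name \<open>wordk_w\<close> stands for the monomial with index
  string w in \<open>F1\<close> and \<open>F2\<close>, applied to \<open>sv k\<close>. Each word is
  computed from the one without its first letter. The list consists of the words needed for the
  operators \<open>Y\<close> below, together with their suffixes.\<close>

lemma word0_1:
  "F1 *v sv 0 =
      (1 / h) *s T 1 2 + h *s T 2 1"
  unfolding sv_def
  by (rule co_eqI', simp add: F1_simps del: One_nat_def,
    ((intro conjI)?; (simp add: field_simps)?; algebra?)?)

lemma word0_11:
  "F1 *v (F1 *v sv 0) =
      ((1 + h ^ 4) / h\<^sup>2) *s T 2 2"
  unfolding word0_1
  by (rule co_eqI', simp add: F1_simps del: One_nat_def,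
    ((intro conjI)?; (simp add: field_simps)?; algebra?)?)

lemma word0_21:
  "F2 *v (F1 *v sv 0) =
      (1 / h) *s T 1 3 + h *s T 3 1"
  unfolding word0_1
  by (rule co_eqI', simp add: F2_simps del: One_nat_def,
    ((intro conjI)?; (simp add: field_simps)?; algebra?)?)

lemma word0_211:
  "F2 *v (F1 *v (F1 *v sv 0)) =
      ((1 + h ^ 4) / h ^ 5) *s T 2 3 + (h + h ^ 5) *s T 3 2"
  unfolding word0_11
  by (rule co_eqI', simp add: F2_simps del: One_nat_def,
    ((intro conjI)?; (simp add: field_simps)?; algebra?)?)

lemma word0_121:
  "F1 *v (F2 *v (F1 *v sv 0)) =
      (1 / h\<^sup>2) *s T 1 4 + h *s T 2 3 + (1 / h) *s T 3 2 + h\<^sup>2 *s T 4 1"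
  unfolding word0_21
  by (rule co_eqI', simp add: F1_simps del: One_nat_def,
    ((intro conjI)?; (simp add: field_simps)?; algebra?)?)

lemma word0_1121:
  "F1 *v (F1 *v (F2 *v (F1 *v sv 0))) =
      ((1 + h ^ 4) / h ^ 5) *s T 1 5 + ((1 + h ^ 4) / h\<^sup>2) *s T 2 4
      + ((1 + h ^ 4) / h\<^sup>2) *s T 4 2 + (h + h ^ 5) *s T 5 1"
  unfolding word0_121
  by (rule co_eqI', simp add: F1_simps del: One_nat_def,
    ((intro conjI)?; (simp add: field_simps)?; algebra?)?)

lemma word0_1211:
  "F1 *v (F2 *v (F1 *v (F1 *v sv 0))) =
      ((1 + h ^ 4) / h ^ 4) *s T 2 4 + (1 + h ^ 4) *s T 4 2"
  unfolding word0_211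
  by (rule co_eqI', simp add: F1_simps del: One_nat_def,
    ((intro conjI)?; (simp add: field_simps)?; algebra?)?)

lemma word0_2121:
  "F2 *v (F1 *v (F2 *v (F1 *v sv 0))) =
      ((1 + h ^ 4) / h\<^sup>2) *s T 3 3"
  unfolding word0_121
  by (rule co_eqI', simp add: F2_simps del: One_nat_def,
    ((intro conjI)?; (simp add: field_simps)?; algebra?)?)

lemma word0_12121:
  "F1 *v (F2 *v (F1 *v (F2 *v (F1 *v sv 0)))) =
      ((1 + h ^ 4) / h ^ 4) *s T 3 4 + (1 + h ^ 4) *s T 4 3"
  unfolding word0_2121
  by (rule co_eqI', simp add: F1_simps del: One_nat_def,
    ((intro conjI)?; (simp add: field_simps)?; algebra?)?)

lemma word0_21121:
  "F2 *v (F1 *v (F1 *v (F2 *v (F1 *v sv 0)))) =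
      ((1 + h ^ 4) / h ^ 5) *s T 1 6 + ((1 + h ^ 4) / h\<^sup>2) *s T 3 4
      + ((1 + h ^ 4) / h\<^sup>2) *s T 4 3 + (h + h ^ 5) *s T 6 1"
  unfolding word0_1121
  by (rule co_eqI', simp add: F2_simps del: One_nat_def,
    ((intro conjI)?; (simp add: field_simps)?; algebra?)?)

lemma word0_11121:
  "F1 *v (F1 *v (F1 *v (F2 *v (F1 *v sv 0)))) =
      ((1 + 2 * h ^ 4 + 2 * h ^ 8 + h ^ 12) / h ^ 7) *s T 2 5
      + ((1 + 2 * h ^ 4 + 2 * h ^ 8 + h ^ 12) / h ^ 5) *s T 5 2"
  unfolding word0_1121
  by (rule co_eqI', simp add: F1_simps del: One_nat_def,
    ((intro conjI)?; (simp add: field_simps)?; algebra?)?)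

lemma word0_112121:
  "F1 *v (F1 *v (F2 *v (F1 *v (F2 *v (F1 *v sv 0))))) =
      ((1 + 2 * h ^ 4 + h ^ 8) / h ^ 8) *s T 3 5 + ((1 + 2 * h ^ 4 + h ^ 8) / h ^ 4) *s T 4 4
      + (1 + 2 * h ^ 4 + h ^ 8) *s T 5 3"
  unfolding word0_12121
  by (rule co_eqI', simp add: F1_simps del: One_nat_def,
    ((intro conjI)?; (simp add: field_simps)?; algebra?)?)

lemma word0_121121:
  "F1 *v (F2 *v (F1 *v (F1 *v (F2 *v (F1 *v sv 0))))) =
      ((1 + h ^ 4) / h ^ 6) *s T 1 7 + ((1 + h ^ 4) / h ^ 4) *s T 2 6
      + ((1 + 2 * h ^ 4 + h ^ 8) / h ^ 6) *s T 3 5 + ((2 + 2 * h ^ 4) / h\<^sup>2) *s T 4 4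
      + ((1 + 2 * h ^ 4 + h ^ 8) / h\<^sup>2) *s T 5 3 + (1 + h ^ 4) *s T 6 2
      + (h\<^sup>2 + h ^ 6) *s T 7 1"
  unfolding word0_21121
  by (rule co_eqI', simp add: F1_simps del: One_nat_def,
    ((intro conjI)?; (simp add: field_simps)?; algebra?)?)

lemma word0_211121:
  "F2 *v (F1 *v (F1 *v (F1 *v (F2 *v (F1 *v sv 0))))) =
      ((1 + 2 * h ^ 4 + 2 * h ^ 8 + h ^ 12) / h ^ 10) *s T 2 6
      + ((1 + 2 * h ^ 4 + 2 * h ^ 8 + h ^ 12) / h ^ 4) *s T 3 5
      + ((1 + 2 * h ^ 4 + 2 * h ^ 8 + h ^ 12) / h ^ 8) *s T 5 3
      + ((1 + 2 * h ^ 4 + 2 * h ^ 8 + h ^ 12) / h\<^sup>2) *s T 6 2"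
  unfolding word0_11121
  by (rule co_eqI', simp add: F2_simps del: One_nat_def,
    ((intro conjI)?; (simp add: field_simps)?; algebra?)?)

lemma word1_2:
  "F2 *v sv 1 =
      h *s T 1 3 + (- 1 / h) *s T 3 1"
  unfolding sv_def
  by (rule co_eqI', simp add: F2_simps del: One_nat_def,
    ((intro conjI)?; (simp add: field_simps)?; algebra?)?)

lemma word1_12:
  "F1 *v (F2 *v sv 1) =
      T 1 4 + (h ^ 3) *s T 2 3 + (- 1 / h ^ 3) *s T 3 2 + (- 1) *s T 4 1"
  unfolding word1_2
  by (rule co_eqI', simp add: F1_simps del: One_nat_def,
    ((intro conjI)?; (simp add: field_simps)?; algebra?)?)

lemma word1_112:
  "F1 *v (F1 *v (F2 *v sv 1)) =
      ((1 + h ^ 4) / h ^ 3) *s T 1 5 + (1 + h ^ 4) *s T 2 4 + ((- 1 - h ^ 4) / h ^ 4) *s T 4 2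
      + ((- 1 - h ^ 4) / h) *s T 5 1"
  unfolding word1_12
  by (rule co_eqI', simp add: F1_simps del: One_nat_def,
    ((intro conjI)?; (simp add: field_simps)?; algebra?)?)

lemma word1_2112:
  "F2 *v (F1 *v (F1 *v (F2 *v sv 1))) =
      ((1 + h ^ 4) / h ^ 3) *s T 1 6 + (1 + h ^ 4) *s T 3 4 + ((- 1 - h ^ 4) / h ^ 4) *s T 4 3
      + ((- 1 - h ^ 4) / h) *s T 6 1"
  unfolding word1_112
  by (rule co_eqI', simp add: F2_simps del: One_nat_def,
    ((intro conjI)?; (simp add: field_simps)?; algebra?)?)

lemma word1_1112:
  "F1 *v (F1 *v (F1 *v (F2 *v sv 1))) =
      ((1 + 2 * h ^ 4 + 2 * h ^ 8 + h ^ 12) / h ^ 5) *s T 2 5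
      + ((- 1 - 2 * h ^ 4 - 2 * h ^ 8 - h ^ 12) / h ^ 7) *s T 5 2"
  unfolding word1_112
  by (rule co_eqI', simp add: F1_simps del: One_nat_def,
    ((intro conjI)?; (simp add: field_simps)?; algebra?)?)

lemma word1_12112:
  "F1 *v (F2 *v (F1 *v (F1 *v (F2 *v sv 1)))) =
      ((1 + h ^ 4) / h ^ 4) *s T 1 7 + ((1 + h ^ 4) / h\<^sup>2) *s T 2 6
      + ((1 + 2 * h ^ 4 + h ^ 8) / h ^ 4) *s T 3 5 + ((- 1 + h ^ 8) / h ^ 4) *s T 4 4
      + ((- 1 - 2 * h ^ 4 - h ^ 8) / h ^ 4) *s T 5 3 + ((- 1 - h ^ 4) / h\<^sup>2) *s T 6 2
      + (- 1 - h ^ 4) *s T 7 1"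
  unfolding word1_2112
  by (rule co_eqI', simp add: F1_simps del: One_nat_def,
    ((intro conjI)?; (simp add: field_simps)?; algebra?)?)

lemma word1_21112:
  "F2 *v (F1 *v (F1 *v (F1 *v (F2 *v sv 1)))) =
      ((1 + 2 * h ^ 4 + 2 * h ^ 8 + h ^ 12) / h ^ 8) *s T 2 6
      + ((1 + 2 * h ^ 4 + 2 * h ^ 8 + h ^ 12) / h\<^sup>2) *s T 3 5
      + ((- 1 - 2 * h ^ 4 - 2 * h ^ 8 - h ^ 12) / h ^ 10) *s T 5 3
      + ((- 1 - 2 * h ^ 4 - 2 * h ^ 8 - h ^ 12) / h ^ 4) *s T 6 2"
  unfolding word1_1112
  by (rule co_eqI', simp add: F2_simps del: One_nat_def,
    ((intro conjI)?; (simp add: field_simps)?; algebra?)?)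

lemma word2_1:
  "F1 *v sv 2 =
      (h ^ 3 + h ^ 7) *s T 1 5 + (- (h\<^sup>2)) *s T 2 4 + (1 / h\<^sup>2) *s T 4 2
      + ((- 1 - h ^ 4) / h ^ 7) *s T 5 1"
  unfolding sv_def
  by (rule co_eqI', simp add: F1_simps del: One_nat_def,
    ((intro conjI)?; (simp add: field_simps)?; algebra?)?)

lemma word2_21:
  "F2 *v (F1 *v sv 2) =
      (h ^ 3 + h ^ 7) *s T 1 6 + (- (h\<^sup>2)) *s T 3 4 + (1 / h\<^sup>2) *s T 4 3
      + ((- 1 - h ^ 4) / h ^ 7) *s T 6 1"
  unfolding word2_1
  by (rule co_eqI', simp add: F2_simps del: One_nat_def,
    ((intro conjI)?; (simp add: field_simps)?; algebra?)?)

lemma word2_121: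
  "F1 *v (F2 *v (F1 *v sv 2)) =
      (h\<^sup>2 + h ^ 6) *s T 1 7 + (h ^ 4 + h ^ 8) *s T 2 6 + ((- 1 - h ^ 4) / h\<^sup>2) *s T 3 5
      + ((1 - h ^ 4) / h\<^sup>2) *s T 4 4 + ((1 + h ^ 4) / h\<^sup>2) *s T 5 3
      + ((- 1 - h ^ 4) / h ^ 8) *s T 6 2 + ((- 1 - h ^ 4) / h ^ 6) *s T 7 1"
  unfolding word2_21
  by (rule co_eqI', simp add: F1_simps del: One_nat_def,
    ((intro conjI)?; (simp add: field_simps)?; algebra?)?)

lemma word2_1121:
  "F1 *v (F1 *v (F2 *v (F1 *v sv 2))) =
      (h + 2 * h ^ 5 + h ^ 9) *s T 2 7 + (- 1 - h ^ 4) *s T 4 5 + ((1 + h ^ 4) / h ^ 4) *s T 5 4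
      + ((- 1 - 2 * h ^ 4 - h ^ 8) / h ^ 9) *s T 7 2"
  unfolding word2_121
  by (rule co_eqI', simp add: F1_simps del: One_nat_def,
    ((intro conjI)?; (simp add: field_simps)?; algebra?)?)

lemma word2_21121:
  "F2 *v (F1 *v (F1 *v (F2 *v (F1 *v sv 2)))) =
      (h + 2 * h ^ 5 + h ^ 9) *s T 3 7 + (- 1 - h ^ 4) *s T 4 6 + ((1 + h ^ 4) / h ^ 4) *s T 6 4
      + ((- 1 - 2 * h ^ 4 - h ^ 8) / h ^ 9) *s T 7 3"
  unfolding word2_1121
  by (rule co_eqI', simp add: F2_simps del: One_nat_def,
    ((intro conjI)?; (simp add: field_simps)?; algebra?)?)

lemma word2_121121:
  "F1 *v (F2 *v (F1 *v (F1 *v (F2 *v (F1 *v sv 2))))) =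
      (h ^ 4 + h ^ 8) *s T 4 7 + ((- 1 - 2 * h ^ 4 - h ^ 8) / h) *s T 5 6
      + ((1 + 2 * h ^ 4 + h ^ 8) / h ^ 7) *s T 6 5 + ((- 1 - h ^ 4) / h ^ 8) *s T 7 4"
  unfolding word2_21121
  by (rule co_eqI', simp add: F1_simps del: One_nat_def,
    ((intro conjI)?; (simp add: field_simps)?; algebra?)?)

lemma word3_1:
  "F1 *v sv 3 =
      T 2 8"
  unfolding sv_def
  by (rule co_eqI', simp add: F1_simps del: One_nat_def,
    ((intro conjI)?; (simp add: field_simps)?; algebra?)?)

lemma word3_21:
  "F2 *v (F1 *v sv 3) =
      T 3 8"
  unfolding word3_1
  by (rule co_eqI', simp add: F2_simps del: One_nat_def,
    ((intro conjI)?; (simp add: field_simps)?; algebra?)?)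

lemma word3_121:
  "F1 *v (F2 *v (F1 *v sv 3)) =
      T 4 8"
  unfolding word3_21
  by (rule co_eqI', simp add: F1_simps del: One_nat_def,
    ((intro conjI)?; (simp add: field_simps)?; algebra?)?)

lemma word3_1121:
  "F1 *v (F1 *v (F2 *v (F1 *v sv 3))) =
      ((1 + h ^ 4) / h\<^sup>2) *s T 5 8"
  unfolding word3_121
  by (rule co_eqI', simp add: F1_simps del: One_nat_def,
    ((intro conjI)?; (simp add: field_simps)?; algebra?)?)

lemma word3_21121:
  "F2 *v (F1 *v (F1 *v (F2 *v (F1 *v sv 3)))) =
      ((1 + h ^ 4) / h\<^sup>2) *s T 6 8"
  unfolding word3_1121
  by (rule co_eqI', simp add: F2_simps del: One_nat_def,
    ((intro conjI)?; (simp add: field_simps)?; algebra?)?)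

lemma word3_121121:
  "F1 *v (F2 *v (F1 *v (F1 *v (F2 *v (F1 *v sv 3))))) =
      ((1 + h ^ 4) / h\<^sup>2) *s T 7 8"
  unfolding word3_21121
  by (rule co_eqI', simp add: F1_simps del: One_nat_def,
    ((intro conjI)?; (simp add: field_simps)?; algebra?)?)

lemma word4_1:
  "F1 *v sv 4 =
      T 8 2"
  unfolding sv_def
  by (rule co_eqI', simp add: F1_simps del: One_nat_def,
    ((intro conjI)?; (simp add: field_simps)?; algebra?)?)

lemma word4_21:
  "F2 *v (F1 *v sv 4) =
      T 8 3"
  unfolding word4_1
  by (rule co_eqI', simp add: F2_simps del: One_nat_def,
    ((intro conjI)?; (simp add: field_simps)?; algebra?)?)

lemma word4_121:
  "F1 *v (F2 *v (F1 *v sv 4)) =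
      T 8 4"
  unfolding word4_21
  by (rule co_eqI', simp add: F1_simps del: One_nat_def,
    ((intro conjI)?; (simp add: field_simps)?; algebra?)?)

lemma word4_1121:
  "F1 *v (F1 *v (F2 *v (F1 *v sv 4))) =
      ((1 + h ^ 4) / h\<^sup>2) *s T 8 5"
  unfolding word4_121
  by (rule co_eqI', simp add: F1_simps del: One_nat_def,
    ((intro conjI)?; (simp add: field_simps)?; algebra?)?)

lemma word4_21121:
  "F2 *v (F1 *v (F1 *v (F2 *v (F1 *v sv 4)))) =
      ((1 + h ^ 4) / h\<^sup>2) *s T 8 6"
  unfolding word4_1121
  by (rule co_eqI', simp add: F2_simps del: One_nat_def,
    ((intro conjI)?; (simp add: field_simps)?; algebra?)?)

lemma word4_121121:
  "F1 *v (F2 *v (F1 *v (F1 *v (F2 *v (F1 *v sv 4))))) =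
      ((1 + h ^ 4) / h\<^sup>2) *s T 8 7"
  unfolding word4_21121
  by (rule co_eqI', simp add: F1_simps del: One_nat_def,
    ((intro conjI)?; (simp add: field_simps)?; algebra?)?)

end
section \<open>Reduced matrix elements of the affine generator\<close>

context D43_parameters
begin

lemma sum7: "(\<Sum>k<7. f k) = f 0 + f 1 + f 2 + f 3 + f 4 + f 5 + f (6::nat)" for f :: "nat \<Rightarrow> 'a::comm_monoid_add"
  by (simp add: eval_nat_numeral)

text \<open>The highest weights of the \<open>sv k\<close>. The classes have 1, 1, 3 and 2 elements,
  the multiplicities of the four kinds of summands.\<close>

definition cl :: "nat \<Rightarrow> nat \<times> nat" where
  "cl k = [(2, 0), (0, 1), (1, 0), (1, 0), (1, 0), (0, 0), (0, 0)] ! k"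

text \<open>
  \<open>E\<^sub>0\<close> spans the lowest weight space of a copy of \<open>L\<^bsub>\<omega>1\<^esub>\<close>, and \<open>L\<^sub>\<kappa>\<close> occurs at most once in \<open>L\<^bsub>\<omega>1\<^esub> \<otimes> L\<^sub>\<mu>\<close>,
  which is why one operator \<open>Y \<kappa> \<mu>\<close> for each pair of weights suffices.  The coefficients of the \<open>Y \<kappa> \<mu>\<close> were found
  by solving linear equations; their common denominators \<open>Dn \<mu>\<close> are split off, and the scaling of \<open>Y \<kappa> \<mu>\<close> is
  chosen to keep \<open>Cm\<close> simple.
\<close>

definition Cm :: "complex \<Rightarrow> complex \<Rightarrow> nat \<Rightarrow> nat \<Rightarrow> complex" where
  "Cm a b k j =
    [[a + b, (- (h ^ 4)) * a + b, (- (h ^ 16)) * a + b, (- (h\<^sup>2)) * (1 + h ^ 4 + h ^ 8) * b,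
      (- (h ^ 6)) * (1 + h ^ 4 + h ^ 8) * a, 0, 0],
     [- a + h ^ 4 * b, 0, h ^ 12 * a + b, h ^ 6 * b, (- (h ^ 6)) * a, 0, 0],
     [(- (h ^ 6)) * a + h ^ 22 * b, h\<^sup>2 * a + h ^ 14 * b, (- (h ^ 10) + h ^ 14 - h ^ 18) * a
      + (- (h ^ 10) + h ^ 14 - h ^ 18) * b, h ^ 20 * b, (- (h ^ 8)) * a, h ^ 18 * a + (- (h ^ 6)) * b, 0],
     [h ^ 4 * (1 + h ^ 4 + h ^ 8) * (1 + h ^ 16) * b, - (1 + h ^ 16) * b, - (1 + h ^ 16) * b,
      h ^ 6 * (1 + h ^ 16) * a, 0, b, h ^ 12 * a],
     [(1 + h ^ 4 + h ^ 8) * (1 + h ^ 16) * a, (1 + h ^ 16) * a, h ^ 12 * (1 + h ^ 16) * a, 0,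
      h ^ 6 * (1 + h ^ 16) * b, h ^ 24 * a, h ^ 12 * b],
     [0, 0, (- (h ^ 6)) * (1 + h ^ 16) * a + h ^ 18 * (1 + h ^ 16) * b, h ^ 32 * b, h ^ 8 * a, 0, 0],
     [0, 0, 0, (1 - h ^ 8 + h ^ 16) * (1 + h ^ 4 + h ^ 8 + h ^ 12 + h ^ 16 + h ^ 20 + h ^ 24) * a,
      (1 - h ^ 8 + h ^ 16) * (1 + h ^ 4 + h ^ 8 + h ^ 12 + h ^ 16 + h ^ 20 + h ^ 24) * b, 0, 0]] ! k ! j"

definition Dn :: "nat \<times> nat \<Rightarrow> complex" where
  "Dn \<mu> = (if \<mu> = (2, 0) then (1 + h ^ 4)\<^sup>2 * (1 + h ^ 4 + h ^ 8) * (1 + h ^ 16)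
    else if \<mu> = (0, 1) then (1 + h ^ 4)\<^sup>2 * (1 + h ^ 16)
    else if \<mu> = (1, 0) then (1 + h ^ 4)\<^sup>2 * (1 + h ^ 16) * (1 - h ^ 8 + h ^ 16) * (1 + h ^ 4 + h ^ 8 + h ^ 12 + h ^ 16 + h ^ 20 + h ^ 24)
    else (1 + h ^ 4)\<^sup>2)"

definition Y :: "nat \<times> nat \<Rightarrow> nat \<times> nat \<Rightarrow> complex^(8 \<times> 8)^(8 \<times> 8)" where
  "Y \<kappa> \<mu> = (if (\<kappa>, \<mu>) = ((2, 0), (2, 0)) then
      mat ((h ^ 6 - h ^ 10 + h ^ 14) * (1 + h ^ 4) * (1 + h ^ 4 + h ^ 8)) ** (F1 ** F2 ** F1)
        + mat ((- (h ^ 12)) * (1 + h ^ 4 + h ^ 8)) ** (F2 ** F1 ** F1)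
    else if (\<kappa>, \<mu>) = ((0, 1), (2, 0)) then
      mat (h ^ 4 * (1 + h ^ 4) * (1 + h ^ 16)) ** (F1 ** F2)
    else if (\<kappa>, \<mu>) = ((1, 0), (2, 0)) then
      mat (1 + h ^ 4)
    else if (\<kappa>, \<mu>) = ((2, 0), (0, 1)) then
      mat (h ^ 8 * (1 + h ^ 4)) ** (F1 ** F1 ** F2 ** F1)
        + mat ((- (h ^ 6)) * (1 + h ^ 4 + h ^ 8)) ** (F1 ** F2 ** F1 ** F1)
    else if (\<kappa>, \<mu>) = ((1, 0), (0, 1)) then
      mat (h\<^sup>2 * (1 + h ^ 4)) ** F1
    else if (\<kappa>, \<mu>) = ((2, 0), (1, 0)) then
      mat ((h ^ 4 + h ^ 8 - h ^ 12 + h ^ 16 + h ^ 20) * (1 + h ^ 4 + h ^ 8) * (1 - h ^ 8 + h ^ 16)) ** (F1 ** F1 ** F2 ** F1 ** F2 ** F1)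
        + mat ((- (h\<^sup>2) - 2 * h ^ 10 + h ^ 14 - 2 * h ^ 18 - h ^ 26) * (1 + h ^ 4) * (1 - h ^ 8 + h ^ 16)) ** (F1 ** F2 ** F1 ** F1 ** F2 ** F1)
        + mat (h ^ 8 * (1 + h ^ 16) * (1 - h ^ 8 + h ^ 16)) ** (F2 ** F1 ** F1 ** F1 ** F2 ** F1)
    else if (\<kappa>, \<mu>) = ((0, 1), (1, 0)) then
      mat ((1 - h ^ 4 + h ^ 8) * (1 + h ^ 4) * (1 + h ^ 16) * (1 + h ^ 4 + h ^ 8 + h ^ 12 + h ^ 16 + h ^ 20 + h ^ 24)) ** (F1 ** F2 ** F1 ** F1 ** F2)
        + mat ((- (h ^ 6)) * (1 + h ^ 16) * (1 + h ^ 4 + h ^ 8 + h ^ 12 + h ^ 16 + h ^ 20 + h ^ 24)) ** (F2 ** F1 ** F1 ** F1 ** F2)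
    else if (\<kappa>, \<mu>) = ((1, 0), (1, 0)) then
      mat ((1 / h ^ 4) * (1 + h ^ 4) * (1 - h ^ 8 + h ^ 16) * (1 + h ^ 4 + h ^ 8 + h ^ 12 + h ^ 16 + h ^ 20 + h ^ 24)) ** (F1 ** F2 ** F1)
    else if (\<kappa>, \<mu>) = ((0, 0), (1, 0)) then
      mat ((1 / h ^ 4) * (1 + h ^ 4)\<^sup>2 * (1 + h ^ 4 + h ^ 8) * (1 + h ^ 16))
    else if (\<kappa>, \<mu>) = ((1, 0), (0, 0)) then
      mat (1 / h ^ 8) ** (F1 ** F2 ** F1 ** F1 ** F2 ** F1)
    else 0)"

text \<open>E_0 has weight -omega_1 = -(2 alpha_1 + alpha_2), so each word in
  \<open>Y \<kappa> \<mu>\<close> lowers the weight \<kappa> to \<mu> - omega_1. Since E_0 on the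
  tensor product is linear in (a, b), it is enough to treat its two parts \<open>EL\<close> and
  \<open>ER\<close>, at (1, 0) and (0, 1).\<close>

lemma EL_0: "Dn (cl 0) *s (EL *v sv 0) = (\<Sum>k<7. Cm 1 0 k 0 *s (Y (cl k) (cl 0) *v sv k))"
  apply (simp add: Cm_def cl_def Y_def Dn_def sum7 mv_simps
      word0_121 word0_211 word1_12 del: One_nat_def)
  apply (rule co_eqI', simp add: sv_def E0_simps del: One_nat_def)
  by ((intro conjI)?; (simp add: divide_simps)?; algebra?)

lemma ER_0: "Dn (cl 0) *s (ER *v sv 0) = (\<Sum>k<7. Cm 0 1 k 0 *s (Y (cl k) (cl 0) *v sv k))"
  apply (simp add: Cm_def cl_def Y_def Dn_def sum7 mv_simps
      word0_121 word0_211 word1_12 del: One_nat_def)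
  apply (rule co_eqI', simp add: sv_def E0_simps del: One_nat_def)
  by ((intro conjI)?; (simp add: divide_simps)?; algebra?)

lemma EL_1: "Dn (cl 1) *s (EL *v sv 1) = (\<Sum>k<7. Cm 1 0 k 1 *s (Y (cl k) (cl 1) *v sv k))"
  apply (simp add: Cm_def cl_def Y_def Dn_def sum7 mv_simps
      word0_1121 word0_1211 word2_1 word3_1 word4_1 del: One_nat_def)
  apply (rule co_eqI', simp add: sv_def E0_simps del: One_nat_def)
  by ((intro conjI)?; (simp add: divide_simps)?; algebra?)

lemma ER_1: "Dn (cl 1) *s (ER *v sv 1) = (\<Sum>k<7. Cm 0 1 k 1 *s (Y (cl k) (cl 1) *v sv k))"
  apply (simp add: Cm_def cl_def Y_def Dn_def sum7 mv_simps
      word0_1121 word0_1211 word2_1 word3_1 word4_1 del: One_nat_def)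
  apply (rule co_eqI', simp add: sv_def E0_simps del: One_nat_def)
  by ((intro conjI)?; (simp add: divide_simps)?; algebra?)

lemma EL_2: "Dn (cl 2) *s (EL *v sv 2) = (\<Sum>k<7. Cm 1 0 k 2 *s (Y (cl k) (cl 2) *v sv k))"
  apply (simp add: Cm_def cl_def Y_def Dn_def sum7 mv_simps
      word0_112121 word0_121121 word0_211121 word1_12112 word1_21112
      word2_121 word3_121 word4_121 del: One_nat_def)
  apply (rule co_eqI', simp add: sv_def E0_simps del: One_nat_def)
  by ((intro conjI)?; (simp add: divide_simps)?; algebra?)

lemma ER_2: "Dn (cl 2) *s (ER *v sv 2) = (\<Sum>k<7. Cm 0 1 k 2 *s (Y (cl k) (cl 2) *v sv k))"
  apply (simp add: Cm_def cl_def Y_def Dn_def sum7 mv_simps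
      word0_112121 word0_121121 word0_211121 word1_12112 word1_21112
      word2_121 word3_121 word4_121 del: One_nat_def)
  apply (rule co_eqI', simp add: sv_def E0_simps del: One_nat_def)
  by ((intro conjI)?; (simp add: divide_simps)?; algebra?)

lemma EL_3: "Dn (cl 3) *s (EL *v sv 3) = (\<Sum>k<7. Cm 1 0 k 3 *s (Y (cl k) (cl 3) *v sv k))"
  apply (simp add: Cm_def cl_def Y_def Dn_def sum7 mv_simps
      word0_112121 word0_121121 word0_211121 word1_12112 word1_21112
      word2_121 word3_121 word4_121 del: One_nat_def)
  apply (rule co_eqI', simp add: sv_def E0_simps del: One_nat_def)
  by ((intro conjI)?; (simp add: divide_simps)?; algebra?)

lemma ER_3: "Dn (cl 3) *s (ER *v sv 3) = (\<Sum>k<7. Cm 0 1 k 3 *s (Y (cl k) (cl 3) *v sv k))"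
  apply (simp add: Cm_def cl_def Y_def Dn_def sum7 mv_simps
      word0_112121 word0_121121 word0_211121 word1_12112 word1_21112
      word2_121 word3_121 word4_121 del: One_nat_def)
  apply (rule co_eqI', simp add: sv_def E0_simps del: One_nat_def)
  by ((intro conjI)?; (simp add: divide_simps)?; algebra?)

lemma EL_4: "Dn (cl 4) *s (EL *v sv 4) = (\<Sum>k<7. Cm 1 0 k 4 *s (Y (cl k) (cl 4) *v sv k))"
  apply (simp add: Cm_def cl_def Y_def Dn_def sum7 mv_simps
      word0_112121 word0_121121 word0_211121 word1_12112 word1_21112
      word2_121 word3_121 word4_121 del: One_nat_def)
  apply (rule co_eqI', simp add: sv_def E0_simps del: One_nat_def)
  by ((intro conjI)?; (simp add: divide_simps)?; algebra?)

lemma ER_4: "Dn (cl 4) *s (ER *v sv 4) = (\<Sum>k<7. Cm 0 1 k 4 *s (Y (cl k) (cl 4) *v sv k))"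
  apply (simp add: Cm_def cl_def Y_def Dn_def sum7 mv_simps
      word0_112121 word0_121121 word0_211121 word1_12112 word1_21112
      word2_121 word3_121 word4_121 del: One_nat_def)
  apply (rule co_eqI', simp add: sv_def E0_simps del: One_nat_def)
  by ((intro conjI)?; (simp add: divide_simps)?; algebra?)

lemma EL_5: "Dn (cl 5) *s (EL *v sv 5) = (\<Sum>k<7. Cm 1 0 k 5 *s (Y (cl k) (cl 5) *v sv k))"
  apply (simp add: Cm_def cl_def Y_def Dn_def sum7 mv_simps
      word2_121121 word3_121121 word4_121121 del: One_nat_def)
  apply (rule co_eqI', simp add: sv_def E0_simps del: One_nat_def)
  by ((intro conjI)?; (simp add: divide_simps)?; algebra?)

lemma ER_5: "Dn (cl 5) *s (ER *v sv 5) = (\<Sum>k<7. Cm 0 1 k 5 *s (Y (cl k) (cl 5) *v sv k))"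
  apply (simp add: Cm_def cl_def Y_def Dn_def sum7 mv_simps
      word2_121121 word3_121121 word4_121121 del: One_nat_def)
  apply (rule co_eqI', simp add: sv_def E0_simps del: One_nat_def)
  by ((intro conjI)?; (simp add: divide_simps)?; algebra?)

lemma EL_6: "Dn (cl 6) *s (EL *v sv 6) = (\<Sum>k<7. Cm 1 0 k 6 *s (Y (cl k) (cl 6) *v sv k))"
  apply (simp add: Cm_def cl_def Y_def Dn_def sum7 mv_simps
      word2_121121 word3_121121 word4_121121 del: One_nat_def)
  apply (rule co_eqI', simp add: sv_def E0_simps del: One_nat_def)
  by ((intro conjI)?; (simp add: divide_simps)?; algebra?)

lemma ER_6: "Dn (cl 6) *s (ER *v sv 6) = (\<Sum>k<7. Cm 0 1 k 6 *s (Y (cl k) (cl 6) *v sv k))"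
  apply (simp add: Cm_def cl_def Y_def Dn_def sum7 mv_simps
      word2_121121 word3_121121 word4_121121 del: One_nat_def)
  apply (rule co_eqI', simp add: sv_def E0_simps del: One_nat_def)
  by ((intro conjI)?; (simp add: divide_simps)?; algebra?)

end

section \<open>The tensor square as a contravariant module\<close>

context D43_parameters
begin

lemma E1op_bv:
  "transpose (F1op r2) *v bv 1 = 0" "transpose (F1op r2) *v bv 2 = bv 1" "transpose (F1op r2) *v bv 3 = 0"
  "transpose (F1op r2) *v bv 4 = ((h ^ 4 + 1) / h\<^sup>2) *s bv 3" "transpose (F1op r2) *v bv 5 = bv 4"
  "transpose (F1op r2) *v bv 6 = 0" "transpose (F1op r2) *v bv 7 = bv 6" "transpose (F1op r2) *v bv 8 = 0"
  by (simp_all add: F1op_def transpose_add transpose_munit bv_def sc_def mv_simps munit_axis r2_mult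
      del: transpose_matrix_vector)

lemma E2op_bv:
  "transpose F2op *v bv 1 = 0" "transpose F2op *v bv 2 = 0" "transpose F2op *v bv 3 = bv 2"
  "transpose F2op *v bv 4 = 0" "transpose F2op *v bv 5 = 0" "transpose F2op *v bv 6 = bv 5"
  "transpose F2op *v bv 7 = 0" "transpose F2op *v bv 8 = 0"
  by (simp_all add: F2op_def transpose_add transpose_munit bv_def sc_def mv_simps munit_axis
      del: transpose_matrix_vector)

lemma E1_tens: "DE h r2 r3 a b 1 *v tens x y =
    tens (transpose (F1op r2) *v x) (Kop h 1 *v y) + tens (Kop (inverse h) 1 *v x) (transpose (F1op r2) *v y)"
  and E2_tens: "DE h r2 r3 a b 2 *v tens x y =
    tens (transpose F2op *v x) (Kop h 2 *v y) + tens (Kop (inverse h) 2 *v x) (transpose F2op *v y)"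
  by (simp_all add: DE_def Eop_def mv_simps kron_tens del: transpose_matrix_vector)

lemma less7: "(\<forall>k<7. P k) \<longleftrightarrow> P 0 \<and> P 1 \<and> P 2 \<and> P 3 \<and> P 4 \<and> P 5 \<and> P (6::nat)"
proof -
  have "{..<7} = {0,1,2,3,4,5,6::nat}" by auto
  then have "(\<forall>k<7. P k) \<longleftrightarrow> (\<forall>k\<in>{0,1,2,3,4,5,6}. P k)" by (metis lessThan_iff)
  then show ?thesis by simp
qed

lemma E1_sv: "\<forall>k<7. DE h r2 r3 a b 1 *v sv k = 0"
  unfolding less7
  by (intro conjI; rule co_eqI', simp add: sv_def mv_neg E1_tens E1op_bv K1_bv tens_simps mv_simps co_simps co_T
      del: One_nat_def transpose_matrix_vector; (intro conjI)?; (simp add: divide_simps)?; algebra?)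

lemma E2_sv: "\<forall>k<7. DE h r2 r3 a b 2 *v sv k = 0"
  unfolding less7
  by (intro conjI; rule co_eqI', simp add: sv_def mv_neg E2_tens E2op_bv K2_bv tens_simps mv_simps co_simps co_T
      del: One_nat_def transpose_matrix_vector; (intro conjI)?; (simp add: divide_simps)?; algebra?)

definition wtq :: "nat \<Rightarrow> nat \<times> nat \<Rightarrow> complex" where
  "wtq i \<mu> = (q ^ dsym i) ^ (if i = 1 then fst \<mu> else snd \<mu>)"

lemma Kop_bv: "Kop p i *v bv n = p powi (int (dsym i) * wt i $ of_nat n) *s bv n"
  by (simp add: bv_def mv_simps Kop_axis mult.commute)

lemma DK_T: "DK q i *v T a b = q powi (int (dsym i) * (wt i $ of_nat a + wt i $ of_nat b)) *s T a b"
  using q_nonzero by (simp add: DK_def kron_tens Kop_bv tens_simps power_int_add distrib_left)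

lemma K_sv: "\<forall>k<7. \<forall>i\<in>{1, 2}. DK q i *v sv k = wtq i (cl k) *s sv k"
  unfolding less7
  by (simp add: sv_def DK_T mv_simps mv_neg wtq_def cl_def dsym_def wt_simps mult.commute
      vec.scale_right_diff_distrib)

lemma ns_simps: "ns 1 = 1" "ns 2 = 1" "ns 3 = 1" "ns 4 = (h ^ 4 + 1) / h\<^sup>2" "ns 5 = 1" "ns 6 = 1" "ns 7 = 1"
  "ns 8 = (h ^ 4 + 1) / h\<^sup>2 * ((h ^ 8 + h ^ 4 + 1) / h ^ 4)"
proof -
  have "ns 8 = (r2 * r2) * (r3 * r3)" by (simp add: ns_def sc_def)
  then show "ns 8 = (h ^ 4 + 1) / h\<^sup>2 * ((h ^ 8 + h ^ 4 + 1) / h ^ 4)" by (simp only: r2_mult r3_mult)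
qed (simp_all add: ns_def sc_def r2_mult)

lemma bdot_T: "i \<in> {1..8} \<Longrightarrow> j \<in> {1..8} \<Longrightarrow> k \<in> {1..8} \<Longrightarrow> l \<in> {1..8} \<Longrightarrow>
    bdot (T i j) (T k l) = (if i = k \<and> j = l then ns i * ns j else 0)"
  by (simp add: bdot_tens bv_bdot of_nat_8_inj ns_def)

definition nrm :: "nat \<Rightarrow> complex" where
  "nrm k = [1, (1 + h ^ 4) / h\<^sup>2, (1 + h ^ 4) * (1 + h ^ 4 + h ^ 8) * (1 + h ^ 16) / h ^ 14,
     (1 + h ^ 4) * (1 + h ^ 4 + h ^ 8) / h ^ 6, (1 + h ^ 4) * (1 + h ^ 4 + h ^ 8) / h ^ 6,
     (1 - h ^ 8 + h ^ 16) * (1 + h ^ 4 + h ^ 8 + h ^ 12 + h ^ 16 + h ^ 20 + h ^ 24) / h ^ 20, 1] ! k"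

text \<open>The Gram matrix. Its diagonal consists of powers of h times the factors in
  \<open>nonzero_factors\<close>; anisotropy thus depends on q not being a root of unity.\<close>

lemma bdot_sv: "\<forall>j<7. \<forall>k<7. bdot (sv j) (sv k) = (if j = k then nrm k else 0)"
  unfolding less7
  by (intro conjI; simp add: sv_def bdot_simps bdot_T ns_simps nrm_def del: One_nat_def;
      (simp add: divide_simps)?; algebra?)

lemma nrm_nonzero: "\<forall>k<7. nrm k \<noteq> 0"
  unfolding less7 by (simp add: nrm_def)

text \<open>In each tensor factor the level counts the lowering steps from v_1. The vector v_8 spans
  a trivial module, so any value would do for it; the default 0 is used.\<close>

definition level :: "8 \<times> 8 \<Rightarrow> nat" where
  "level p = (let f = (\<lambda>i. if i = 1 then 0 else if i = 2 then 1 else if i = 3 then 2 else if i = 4 then 3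
     else if i = 5 then 4 else if i = 6 then 5 else if i = 7 then 6 else 0) in f (fst p) + f (snd p))"

lemma level: "i \<in> {1, 2} \<Longrightarrow> DE h r2 r3 a b i $ k $ l \<noteq> 0 \<Longrightarrow> level k < level l"
proof -
  define f :: "8 \<Rightarrow> nat" where "f = (\<lambda>i. if i = 1 then 0 else if i = 2 then 1 else if i = 3 then 2 else if i = 4 then 3
     else if i = 5 then 4 else if i = 6 then 5 else if i = 7 then 6 else 0)"
  assume i: "i \<in> {1, 2}" and nz: "DE h r2 r3 a b i $ k $ l \<noteq> 0"
  have E: "Eop r2 r3 c i $ x $ y \<noteq> 0 \<Longrightarrow> f x < f y" for c x y
    unfolding Eop_def F1op_def F2op_def transpose_add transpose_munit munit_def f_def
    using i by (auto simp: transpose_def split: if_splits)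
  have K: "Kop p i $ x $ y \<noteq> 0 \<Longrightarrow> x = y" for p x y
    by (simp add: Kop_def split: if_splits)
  have "Eop r2 r3 a i $ fst k $ fst l \<noteq> 0 \<and> Kop h i $ snd k $ snd l \<noteq> 0 \<or>
      Kop (inverse h) i $ fst k $ fst l \<noteq> 0 \<and> Eop r2 r3 b i $ snd k $ snd l \<noteq> 0"
    using nz by (auto simp: DE_def kron_def)
  then have "f (fst k) + f (snd k) < f (fst l) + f (snd l)"
    using E K by fastforce
  then show ?thesis by (simp add: level_def f_def Let_def)
qed

text \<open>In coordinates, \<open>E\<^sub>1 x = E\<^sub>2 x = 0\<close> is a system of equations with one or two terms each: all coordinates
  vanish except for those occurring in the vectors \<open>sv k\<close>, which are determined up to a factor.\<close>

lemma singular_complete: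
  assumes "\<And>i. i \<in> {1, 2} \<Longrightarrow> DE h r2 r3 1 1 i *v x = 0" "\<And>k. k < 7 \<Longrightarrow> bdot (sv k) x = 0"
  shows "x = 0"
proof -
  define c where "c a b = bdot (T a b) x" for a b
  \<comment> \<open>By contravariance a singular x is orthogonal to the images of \<open>F1\<close>
    and \<open>F2\<close>. Each y = \<open>T a b\<close> then yields one linear equation in the
    coordinates.\<close>
  have F: "bdot (F1 *v y) x = 0" "bdot (F2 *v y) x = 0" for y
    using assms(1)[of 1] assms(1)[of 2]
    by (simp_all add: bdot_matrix DF_transpose[of _ h r2 r3 1 1 1 1] bdot_simps del: transpose_matrix_vector)
  have z1: "c 2 2 = 0 \<and> c 1 3 = 0 \<and> c 2 5 = 0 \<and> c 1 6 = 0 \<and> c 2 7 = 0 \<and> c 2 8 = 0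
      \<and> c 3 1 = 0 \<and> c 2 4 = 0 \<and> c 3 3 = 0 \<and> c 3 4 = 0 \<and> c 3 6 = 0"
    using F(1)[of "T 1 2"] F(2)[of "T 1 2"] F(1)[of "T 1 5"] F(2)[of "T 1 5"] F(1)[of "T 1 7"]
      F(1)[of "T 1 8"] F(2)[of "T 2 1"] F(1)[of "T 2 3"] F(2)[of "T 2 3"] F(2)[of "T 2 4"]
      F(2)[of "T 2 6"]
    by (simp add: F1_simps F2_simps tens_simps bdot_simps c_def[symmetric] del: One_nat_def)
  have z2: "c 3 7 = 0 \<and> c 3 8 = 0 \<and> c 4 2 = 0 \<and> c 4 5 = 0 \<and> c 4 7 = 0 \<and> c 4 8 = 0
      \<and> c 5 2 = 0 \<and> c 4 3 = 0 \<and> c 5 5 = 0 \<and> c 4 6 = 0 \<and> c 5 7 = 0"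
    using F(2)[of "T 2 7"] F(2)[of "T 2 8"] F(1)[of "T 3 2"] F(1)[of "T 3 5"] F(1)[of "T 3 7"]
      F(1)[of "T 3 8"] F(1)[of "T 4 2"] F(2)[of "T 4 2"] F(1)[of "T 4 5"] F(2)[of "T 4 5"]
      F(1)[of "T 4 7"]
    by (simp add: F1_simps F2_simps tens_simps bdot_simps c_def[symmetric] del: One_nat_def)
  have z3: "c 5 8 = 0 \<and> c 6 1 = 0 \<and> c 5 4 = 0 \<and> c 6 3 = 0 \<and> c 6 4 = 0 \<and> c 6 6 = 0
      \<and> c 6 7 = 0 \<and> c 6 8 = 0 \<and> c 7 2 = 0 \<and> c 7 5 = 0 \<and> c 7 7 = 0"
    using F(1)[of "T 4 8"] F(2)[of "T 5 1"] F(1)[of "T 5 3"] F(2)[of "T 5 3"] F(2)[of "T 5 4"]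
      F(2)[of "T 5 6"] F(2)[of "T 5 7"] F(2)[of "T 5 8"] F(1)[of "T 6 2"] F(1)[of "T 6 5"]
      F(1)[of "T 6 7"]
    by (simp add: F1_simps F2_simps tens_simps bdot_simps c_def[symmetric] del: One_nat_def)
  have z4: "c 7 8 = 0 \<and> c 7 3 = 0 \<and> c 7 4 = 0 \<and> c 7 6 = 0 \<and> c 8 2 = 0 \<and> c 8 3 = 0
      \<and> c 8 4 = 0 \<and> c 8 5 = 0 \<and> c 8 6 = 0 \<and> c 8 7 = 0"
    using F(1)[of "T 6 8"] F(2)[of "T 7 2"] F(1)[of "T 7 3"] F(2)[of "T 7 5"] F(1)[of "T 8 1"]
      F(2)[of "T 8 2"] F(1)[of "T 8 3"] F(1)[of "T 8 4"] F(2)[of "T 8 5"] F(1)[of "T 8 6"]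
    by (simp add: F1_simps F2_simps tens_simps bdot_simps c_def[symmetric] del: One_nat_def)
  \<comment> \<open>Each of these equations has a second term, which is already known to
    vanish.\<close>
  have z5: "c 1 5 = 0 \<and> c 5 1 = 0 \<and> c 5 6 = 0 \<and> c 6 5 = 0"
    using F(1)[of "T 1 4"] F(1)[of "T 4 1"] F(1)[of "T 4 6"] F(1)[of "T 6 4"] z1 z2 z3 z4
    by (simp add: F1_simps F2_simps tens_simps bdot_simps c_def[symmetric] del: One_nat_def)
  \<comment> \<open>From here on the equations link consecutive coordinates of one weight, leaving a
    single unknown for each of the weights omega_2, omega_1 and 0 (apart from the vectors involving
    v_8).\<close>
  have k1: "c 1 2 = - (h\<^sup>2 * c 2 1)"
    using F(1)[of "T 1 1"] by (simp add: F1_simps F2_simps tens_simps bdot_simps c_def[symmetric] del: One_nat_def) (simp add: divide_simps power2_eq_square, algebra)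
  have k2: "c 2 3 = - c 1 4 / h ^ 3"
    using F(1)[of "T 1 3"] by (simp add: F1_simps F2_simps tens_simps bdot_simps c_def[symmetric] del: One_nat_def) (simp add: divide_simps, algebra)
  have k3: "c 3 2 = - c 2 3 / h ^ 6"
    using F(2)[of "T 2 2"] by (simp add: F1_simps F2_simps tens_simps bdot_simps c_def[symmetric] del: One_nat_def) (simp add: divide_simps, algebra)
  have k4: "c 4 1 = - c 3 2 / h ^ 3"
    using F(1)[of "T 3 1"] by (simp add: F1_simps F2_simps tens_simps bdot_simps c_def[symmetric] del: One_nat_def) (simp add: divide_simps, algebra)
  have k5: "c 2 6 = - c 1 7 / h\<^sup>2"
    using F(1)[of "T 1 6"] by (simp add: F1_simps F2_simps tens_simps bdot_simps c_def[symmetric] del: One_nat_def) (simp add: divide_simps, algebra)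
  have k6: "c 3 5 = - c 2 6 / h ^ 6"
    using F(2)[of "T 2 5"] by (simp add: F1_simps F2_simps tens_simps bdot_simps c_def[symmetric] del: One_nat_def) (simp add: divide_simps, algebra)
  have k7: "c 4 4 = - ((h ^ 4 + 1) / h ^ 4) * c 3 5"
    using F(1)[of "T 3 4"] by (simp add: F1_simps F2_simps tens_simps bdot_simps c_def[symmetric] del: One_nat_def) (simp add: divide_simps, algebra)
  have k8: "c 5 3 = - c 4 4 / (h ^ 4 + 1)"
    using F(1)[of "T 4 3"] by (simp add: F1_simps F2_simps tens_simps bdot_simps c_def[symmetric] del: One_nat_def) (simp add: divide_simps, algebra)
  have k9: "c 6 2 = - c 5 3 / h ^ 6"
    using F(2)[of "T 5 2"] by (simp add: F1_simps F2_simps tens_simps bdot_simps c_def[symmetric] del: One_nat_def) (simp add: divide_simps, algebra)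
  have k10: "c 7 1 = - c 6 2 / h\<^sup>2"
    using F(1)[of "T 6 1"] by (simp add: F1_simps F2_simps tens_simps bdot_simps c_def[symmetric] del: One_nat_def) (simp add: divide_simps, algebra)
  have sv: "c 1 1 = 0 \<and> c 1 8 = 0 \<and> c 8 1 = 0 \<and> c 8 8 = 0"
    using assms(2)[of 0] assms(2)[of 3] assms(2)[of 4] assms(2)[of 6]
    by (simp add: sv_def bdot_simps c_def[symmetric] del: One_nat_def)
  \<comment> \<open>The pairing with the singular vector is a nonzero multiple of the remaining
    unknown. The same is done below for \<open>sv 2\<close> and \<open>sv 5\<close>.\<close>
  have "bdot (sv 1) x = - (c 2 1 * (1 + h ^ 4)) / h"
    by (simp add: sv_def bdot_simps c_def[symmetric] k1 del: One_nat_def)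
      (simp add: divide_simps, algebra)
  then have s1: "c 2 1 = 0" using assms(2)[of 1] by simp
  have "bdot (sv 2) x = c 1 4 * ((1 + h ^ 4 + h ^ 8) * (1 + h ^ 16)) / h ^ 18"
    by (simp add: sv_def bdot_simps c_def[symmetric] k2 k3 k4 del: One_nat_def)
      (simp add: divide_simps, algebra)
  then have s2: "c 1 4 = 0" using assms(2)[of 2] by simp
  have "bdot (sv 5) x = c 1 7 * ((1 - h ^ 8 + h ^ 16) * (1 + h ^ 4 + h ^ 8 + h ^ 12 + h ^ 16 + h ^ 20 + h ^ 24)) / h ^ 30"
    by (simp add: sv_def bdot_simps c_def[symmetric] k5 k6 k7 k8 k9 k10 del: One_nat_def)
      (simp add: divide_simps, algebra)
  then have s3: "c 1 7 = 0" using assms(2)[of 5] by simp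
  show ?thesis
    by (rule co_eqI') (simp add: co_def bdot_simps bdot_commute[of x] c_def[symmetric]
        z1 z2 z3 z4 z5 sv k1 k2 k3 k4 k5 k6 k7 k8 k9 k10 s1 s2 s3 del: One_nat_def)
qed


lemma pow_q_inj: "q ^ m = q ^ n \<Longrightarrow> m = n"
proof (induction m n rule: linorder_wlog)
  case (le m n)
  have "q ^ m * q ^ (n - m) = q ^ n"
    using power_add[of q m "n - m"] le(1) by simp
  then have "q ^ m * q ^ (n - m) = q ^ m" using le(2) by simp
  then have "q ^ (n - m) = 1" using q_nonzero by simp
  then have "n - m = 0" using q_generic by (metis gr0I)
  then show ?case using le by simp
qed metis

lemma wtq_inj:
  assumes "\<And>i. i \<in> {1, 2} \<Longrightarrow> wtq i \<mu> = wtq i \<nu>"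
  shows "\<mu> = \<nu>"
proof -
  have "q ^ fst \<mu> = q ^ fst \<nu>" using assms[of 1] by (simp add: wtq_def dsym_def)
  moreover have "q ^ (3 * snd \<mu>) = q ^ (3 * snd \<nu>)" using assms[of 2] by (simp add: wtq_def dsym_def power_mult)
  ultimately show ?thesis using pow_q_inj by (metis mult_cancel1 prod_eq_iff zero_neq_numeral)
qed

sublocale G2: contravariant_module "{1, 2}" "DE h r2 r3 1 1" "DF h r2 r3 1 1" "DK q" "DK (inverse q)"
  wtq 7 sv cl level
proof
  fix i j :: nat assume ij: "i \<in> {1, 2}" "j \<in> {1, 2}"
  then have ij': "i \<in> {0, 1, 2}" "j \<in> {0, 1, 2}" by auto
  show "\<exists>c. DK q i ** DF h r2 r3 1 1 j = mat c ** (DF h r2 r3 1 1 j ** DK q i)"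
    using DK_DF[OF q_nonzero ij'] by blast
  show "\<exists>c. DK (inverse q) i ** DF h r2 r3 1 1 j = mat c ** (DF h r2 r3 1 1 j ** DK (inverse q) i)"
    using DK_DF[of "inverse q", OF _ ij'] q_nonzero by auto
  have "DE h r2 r3 1 1 i ** DF h r2 r3 1 1 j = DF h r2 r3 1 1 j ** DE h r2 r3 1 1 i +
     mat (if i = j then 1 / (q ^ dsym i - inverse q ^ dsym i) else 0) ** (DK q i - DK (inverse q) i)"
    using DE_DF[OF q_nonzero q_generic h_square r2_square r3_square, of 1 1 i j 1 1] ij ij'
    by (auto simp: mat_scal vec_eq_iff)
  then show "\<exists>c. DE h r2 r3 1 1 i ** DF h r2 r3 1 1 j = DF h r2 r3 1 1 j ** DE h r2 r3 1 1 i +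
     mat c ** (DK q i - DK (inverse q) i)" by blast
next
  fix i k assume "i \<in> {1, 2::nat}" "k < (7::nat)"
  then show "DE h r2 r3 1 1 i *v sv k = 0" "DK q i *v sv k = wtq i (cl k) *s sv k"
    using E1_sv E2_sv K_sv by blast+
next
  fix i :: nat assume "i \<in> {1, 2}"
  then show "transpose (DF h r2 r3 1 1 i) = DE h r2 r3 1 1 i" by (auto intro: DF_transpose)
next
  fix j k :: nat assume "j < 7" "k < 7" "j \<noteq> k"
  then show "bdot (sv j) (sv k) = 0" using bdot_sv by simp
next
  fix k :: nat assume "k < 7"
  then show "bdot (sv k) (sv k) \<noteq> 0" using bdot_sv nrm_nonzero by simp
next
  fix \<mu> \<nu> assume "\<And>i. i \<in> {1, 2} \<Longrightarrow> wtq i \<mu> = wtq i \<nu>"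
  then show "\<mu> = \<nu>" by (rule wtq_inj)
next
  fix x assume "\<And>i. i \<in> {1, 2} \<Longrightarrow> DE h r2 r3 1 1 i *v x = 0" "\<And>k. k < 7 \<Longrightarrow> bdot (sv k) x = 0"
  then show "x = 0" by (rule singular_complete)
qed (use q_nonzero level in \<open>simp_all add: DK_transpose DK_inverse\<close>)

end

section \<open>Intertwiners\<close>

context D43_parameters
begin

lemma UqG2_eq: "UqG2 q h r2 r3 = G2.alg"
  unfolding UqG2_def G2.alg_def ..

lemma isotypic_eq: "isotypic q h r2 r3 \<mu> = G2.iso \<mu>"
proof -
  have "G2_submodule q h r2 r3 = G2.submod"
    by (intro ext) (simp only: G2_submodule_def G2.submod_def UqG2_eq)
  then have "G2_irreducible q h r2 r3 = G2.irred"
    by (intro ext) (simp only: G2_irreducible_def G2.irred_def)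
  then have "G2_copy q h r2 r3 \<mu> W \<longleftrightarrow> G2.irred W \<and>
      (\<exists>x\<in>W. x \<noteq> 0 \<and> (\<forall>i\<in>{1, 2}. DE h r2 r3 1 1 i *v x = 0 \<and> DK q i *v x = wtq i \<mu> *s x))" for W
    by (auto simp: G2_copy_def G2_singular_def wtq_def simp del: One_nat_def)
  then show ?thesis by (simp only: isotypic_def G2.iso_def)
qed

lemma proj_iso_eq: "proj_iso q h r2 r3 \<mu> = G2.opF (\<lambda>i k. if i = k \<and> cl k = \<mu> then 1 else 0)"
  unfolding proj_iso_def isotypic_eq by (rule G2.iso_projector)

lemma tensor_proj_eq:
  fixes e :: "'m::finite \<Rightarrow> nat" and f :: "complex^'m^'m"
  assumes "inj e" "range e = {k. k < 7 \<and> cl k = \<mu>}" "\<And>j. w $ j = c *s sv (e j)" "c \<noteq> 0"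
    and "\<And>i j. g (e i) (e j) = f $ i $ j"
  shows "tensor_proj q h r2 r3 \<mu> w f = G2.opF (\<lambda>i k. if cl k = \<mu> then g i k else 0)"
  unfolding tensor_proj_def isotypic_eq UqG2_eq by (rule G2.iso_tensor_projector[OF assms])

lemma T_vv: "T i j = (sc i * sc j) *s vv (of_nat i) (of_nat j)"
  by (simp add: bv_def tens_simps tens_axis vv_def mult.commute)

lemma r_powers: "r2 * r2 * h\<^sup>2 = h ^ 4 + 1" "r3 * r3 * h ^ 4 = h ^ 8 + h ^ 4 + 1"
  by (simp_all add: r2_mult r3_mult)

text \<open>The factor is the same for all three vectors, so the matrix f keeps its meaning when the
  \<open>sv k\<close> replace them.\<close>

lemma sing1_sv:
  "sing1 q h r2 r3 $ j = (1 / (r2 * r3)) *s sv (if j = 1 then 2 else if j = 2 then 3 else 4)"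
proof -
  have q: "q ^ 3 = h ^ 6" by (simp add: h_square[symmetric] power_mult[symmetric])
  have 1: "sing1 q h r2 r3 $ 1 = (1 / (r2 * r3)) *s sv 2"
    by (simp add: sing1_def q sv_def T_vv sc_def power_int_minus vec_eq_iff inverse_eq_divide del: One_nat_def)
      (simp add: divide_simps, insert r_powers(1), algebra)
  have "\<forall>j. sing1 q h r2 r3 $ j = (1 / (r2 * r3)) *s sv (if j = 1 then 2 else if j = 2 then 3 else 4)"
    unfolding forall_3 by (simp add: 1) (simp add: sing1_def sv_def T_vv sc_def)
  then show ?thesis by blast
qed

lemma sing0_sv: "sing0 q $ j = 1 *s sv (if j = 1 then 5 else 6)"
proof -
  have q: "q ^ 5 = h ^ 10" "q ^ 4 = h ^ 8" "q = h\<^sup>2"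
    by (simp_all add: h_square[symmetric] power_mult[symmetric])
  have 1: "sing0 q $ 1 = sv 5"
    by (simp add: sing0_def q(1,2) sv_def T_vv sc_def power_int_minus vec_eq_iff del: One_nat_def)
      (simp add: q(3) divide_simps, insert r_powers(1), algebra)
  \<comment> \<open>The vector \<open>bv 8\<close> contains the factor \<open>r2 * r3\<close>; the
    coefficient of \<open>T 8 8\<close> in \<open>sv 6\<close> is the inverse of its square. In the
    same way the coefficient of \<open>T 4 4\<close> in \<open>sv 5\<close> is minus the inverse
    square of \<open>r2\<close>.\<close>
  have "r2 * r3 * (r2 * r3) = (h ^ 4 + 1) / h\<^sup>2 * ((h ^ 8 + h ^ 4 + 1) / h ^ 4)"
    by (simp add: r2_mult[symmetric] r3_mult[symmetric])
  then have 2: "h ^ 6 / ((h ^ 4 + 1) * (h ^ 8 + h ^ 4 + 1)) * (r2 * r3 * (r2 * r3)) = 1"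
    by (simp only:) (simp add: divide_simps, algebra?)
  have "sing0 q $ 2 = sv 6"
    unfolding sing0_def sv_def by (simp add: T_vv sc_def 2 del: times_divide_eq_left)
  then have "\<forall>j. sing0 q $ j = 1 *s sv (if j = 1 then 5 else 6)"
    unfolding forall_2 by (simp add: 1)
  then show ?thesis by blast
qed

definition Xop :: "nat \<times> nat \<Rightarrow> nat \<times> nat \<Rightarrow> complex^(8 \<times> 8)^(8 \<times> 8)" where
  "Xop \<kappa> \<mu> = mat (1 / Dn \<mu>) ** Y \<kappa> \<mu>"

lemma Dn_nonzero [simp]: "Dn \<mu> \<noteq> 0"
  by (simp add: Dn_def)

lemma Xop_alg: "Xop \<kappa> \<mu> \<in> G2.alg"
proof -
  have F: "F1 \<in> G2.alg" "F2 \<in> G2.alg" using G2.alg_intros(2) by auto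
  have "Y \<kappa> \<mu> \<in> G2.alg"
    unfolding Y_def by (auto intro!: G2.alg_intros(5-8) F simp del: One_nat_def)
  then show ?thesis unfolding Xop_def by (intro G2.alg_intros(5,8))
qed

lemma Cm_linear: "k < 7 \<Longrightarrow> j < 7 \<Longrightarrow> Cm a b k j = a * Cm 1 0 k j + b * Cm 0 1 k j"
proof -
  have "\<forall>k<7. \<forall>j<7. Cm a b k j = a * Cm 1 0 k j + b * Cm 0 1 k j"
    unfolding less7 by (intro conjI; simp add: Cm_def del: One_nat_def; algebra?)
  then show "k < 7 \<Longrightarrow> j < 7 \<Longrightarrow> Cm a b k j = a * Cm 1 0 k j + b * Cm 0 1 k j" by blast
qed

lemma E0_sv:
  assumes "j < 7"
  shows "DE h r2 r3 a b 0 *v sv j = (\<Sum>k<7. Cm a b k j *s (Xop (cl k) (cl j) *v sv k))"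
proof -
  have "\<forall>j<7. Dn (cl j) *s (EL *v sv j) = (\<Sum>k<7. Cm 1 0 k j *s (Y (cl k) (cl j) *v sv k))"
    unfolding less7 by (intro conjI EL_0 EL_1 EL_2 EL_3 EL_4 EL_5 EL_6)
  then have L: "Dn (cl j) *s (EL *v sv j) = (\<Sum>k<7. Cm 1 0 k j *s (Y (cl k) (cl j) *v sv k))"
    using assms by blast
  have "\<forall>j<7. Dn (cl j) *s (ER *v sv j) = (\<Sum>k<7. Cm 0 1 k j *s (Y (cl k) (cl j) *v sv k))"
    unfolding less7 by (intro conjI ER_0 ER_1 ER_2 ER_3 ER_4 ER_5 ER_6)
  then have R: "Dn (cl j) *s (ER *v sv j) = (\<Sum>k<7. Cm 0 1 k j *s (Y (cl k) (cl j) *v sv k))"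
    using assms by blast
  have "Dn (cl j) *s (DE h r2 r3 a b 0 *v sv j) = a *s (Dn (cl j) *s (EL *v sv j)) + b *s (Dn (cl j) *s (ER *v sv j))"
    by (simp add: DE0_split mv_simps mult.commute)
  also have "\<dots> = Dn (cl j) *s (\<Sum>k<7. Cm a b k j *s (Xop (cl k) (cl j) *v sv k))"
    unfolding L R vec.scale_sum_right sum.distrib[symmetric]
    by (intro sum.cong refl) (use assms in \<open>simp add: Xop_def mv_simps Cm_linear[of _ j a b]\<close>)
  finally show ?thesis by simp
qed

lemma E0_commutes:
  assumes "a \<noteq> 0" "b \<noteq> 0" "i \<in> {1, 2}"
  shows "DE h r2 r3 a b 0 ** DF h r2 r3 1 1 i = DF h r2 r3 1 1 i ** DE h r2 r3 a b 0"
  using DE_DF[OF q_nonzero q_generic h_square r2_square r3_square assms(1,2), of 0 i 1 1] assms(3) by auto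

text \<open>At level zero K_0 is a monomial in the inverses of K_1 and K_2, so its relation follows
  from commutation with U_q(G_2).\<close>

lemma DK_zero:
  assumes "p \<noteq> 0"
  shows "DK p 0 = DK (inverse p) 2 ** DK (inverse p) 1 ** DK (inverse p) 1"
proof -
  let ?N = "DK (inverse p) 2 ** DK (inverse p) 1 ** DK (inverse p) 1"
  have 1: "DK p 0 ** DK p 1 ** DK p 1 ** DK p 2 = mat 1"
    using K_prod[OF assms] by (simp add: DK_def kron_mult kron_one)
  have "DK p 0 = DK p 0 ** DK p 1 ** (DK p 1 ** (DK p 2 ** DK (inverse p) 2) ** DK (inverse p) 1) ** DK (inverse p) 1"
    by (simp add: DK_inverse[OF assms] matrix_mul_assoc[symmetric])
  also have "\<dots> = (DK p 0 ** DK p 1 ** DK p 1 ** DK p 2) ** ?N"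
    by (simp only: matrix_mul_assoc)
  finally show ?thesis unfolding 1 by simp
qed

lemma DK_alg: "i \<in> {0, 1, 2} \<Longrightarrow> DK q i \<in> G2.alg" "i \<in> {0, 1, 2} \<Longrightarrow> DK (inverse q) i \<in> G2.alg"
proof -
  have 1: "DK q 1 \<in> G2.alg" "DK q 2 \<in> G2.alg" "DK (inverse q) 1 \<in> G2.alg" "DK (inverse q) 2 \<in> G2.alg"
    by (intro G2.alg_intros(3,4); simp)+
  then have 2: "DK q 0 \<in> G2.alg" "DK (inverse q) 0 \<in> G2.alg"
    using DK_zero[of q] DK_zero[of "inverse q"] q_nonzero by (simp_all add: G2.alg_intros(8) del: One_nat_def)
  show "i \<in> {0, 1, 2} \<Longrightarrow> DK q i \<in> G2.alg" "i \<in> {0, 1, 2} \<Longrightarrow> DK (inverse q) i \<in> G2.alg"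
    using 1 2 by blast+
qed

text \<open>Entry (i, j) of the equation f C(a, b) = C(b, a) f; the conditions on \<open>cl\<close>
  express that f is block diagonal.\<close>

definition opF_eqs :: "complex \<Rightarrow> complex \<Rightarrow> (nat \<Rightarrow> nat \<Rightarrow> complex) \<Rightarrow> nat \<Rightarrow> nat \<Rightarrow> bool" where
  "opF_eqs a b f i j \<longleftrightarrow> (\<Sum>k<7. if cl i = cl k then f i k * Cm a b k j else 0) =
     (\<Sum>k<7. if cl k = cl j then Cm b a i k * f k j else 0)"

lemma opF_E0I:
  assumes "a \<noteq> 0" "b \<noteq> 0" "\<forall>i<7. \<forall>j<7. opF_eqs a b f i j"
  shows "G2.opF f ** DE h r2 r3 a b 0 = DE h r2 r3 b a 0 ** G2.opF f"
proof (subst G2.opF_intertwines_iff)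
  show "\<forall>j<7. G2.opF f *v (DE h r2 r3 a b 0 *v sv j) = DE h r2 r3 b a 0 *v (G2.opF f *v sv j)"
  proof (intro allI impI)
    fix j :: nat assume j: "j < 7"
    note r = G2.opF_reduced[where X = Xop and C = "Cm a b" and C' = "Cm b a" and G = "DE h r2 r3 a b 0"
        and G' = "DE h r2 r3 b a 0" and f = f, OF Xop_alg E0_sv E0_sv j]
    show "G2.opF f *v (DE h r2 r3 a b 0 *v sv j) = DE h r2 r3 b a 0 *v (G2.opF f *v sv j)"
      by (rule trans[OF r(1) trans[OF sum.cong r(2)[symmetric]]])
        (use assms(3) j in \<open>auto simp: opF_eqs_def\<close>)
  qed
qed (use E0_commutes assms in auto)

lemma opF_E0D:
  assumes "a \<noteq> 0" "b \<noteq> 0" "G2.opF f ** DE h r2 r3 a b 0 = DE h r2 r3 b a 0 ** G2.opF f"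
    and "i < 7" "j < 7" "Xop (cl i) (cl j) *v sv i \<noteq> 0"
  shows "opF_eqs a b f i j"
proof -
  note r = G2.opF_reduced[where X = Xop and C = "Cm a b" and C' = "Cm b a" and G = "DE h r2 r3 a b 0"
        and G' = "DE h r2 r3 b a 0" and f = f, OF Xop_alg E0_sv E0_sv assms(5)]
  have "(\<Sum>i<7. (\<Sum>k<7. if cl i = cl k then f i k * Cm a b k j else 0) *s (Xop (cl i) (cl j) *v sv i)) =
      G2.opF f *v (DE h r2 r3 a b 0 *v sv j)"
    by (rule r(1)[symmetric])
  also have "\<dots> = DE h r2 r3 b a 0 *v (G2.opF f *v sv j)"
    using arg_cong[OF assms(3), of "\<lambda>M. M *v sv j"] by (simp only: matrix_vector_mul_assoc[symmetric])
  also have "\<dots> = (\<Sum>i<7. (\<Sum>k<7. if cl k = cl j then Cm b a i k * f k j else 0) *s (Xop (cl i) (cl j) *v sv i))"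
    by (rule r(2))
  finally show ?thesis
    unfolding opF_eqs_def
    by (rule G2.reduced_coeff_unique[where X = Xop and \<nu> = "cl j" and i = i and
        \<alpha> = "\<lambda>i. \<Sum>k<7. if cl i = cl k then f i k * Cm a b k j else 0" and
        \<beta> = "\<lambda>i. \<Sum>k<7. if cl k = cl j then Cm b a i k * f k j else 0", OF Xop_alg _ assms(4,6)])
qed

text \<open>The relation for \<open>F\<^sub>0\<close> at \<open>(a, b)\<close> is the transpose of the one for \<open>E\<^sub>0\<close> at \<open>(1 / b, 1 / a)\<close>.\<close>

lemma opF_intertwiner:
  assumes ab: "a \<noteq> 0" "b \<noteq> 0"
    and eqs: "\<And>a' b'. a' \<noteq> 0 \<Longrightarrow> b' \<noteq> 0 \<Longrightarrow> a' / b' = a / b \<Longrightarrow> \<forall>i<7. \<forall>j<7. opF_eqs a' b' f i j"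
    and sym: "\<And>i k. i < 7 \<Longrightarrow> k < 7 \<Longrightarrow> cl i = cl k \<Longrightarrow> f i k * nrm i = f k i * nrm k"
  shows "intertwiner q h r2 r3 a b (G2.opF f)"
proof -
  have E0: "G2.opF f ** DE h r2 r3 a b 0 = DE h r2 r3 b a 0 ** G2.opF f"
    using ab eqs[OF ab refl] by (rule opF_E0I)
  have tr: "transpose (G2.opF f) = G2.opF f"
    by (rule G2.opF_transpose) (use sym bdot_sv in simp)
  \<comment> \<open>The pair (1 / b, 1 / a) has the same ratio as (a, b); hence \<open>eqs\<close>
    is assumed for all pairs with that ratio.\<close>
  have "G2.opF f ** DE h r2 r3 (1 / b) (1 / a) 0 = DE h r2 r3 (1 / a) (1 / b) 0 ** G2.opF f"
    by (rule opF_E0I) (use ab in \<open>simp_all add: eqs\<close>)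
  then have "transpose (G2.opF f ** DE h r2 r3 (1 / b) (1 / a) 0) = transpose (DE h r2 r3 (1 / a) (1 / b) 0 ** G2.opF f)"
    by simp
  then have F0: "G2.opF f ** DF h r2 r3 a b 0 = DF h r2 r3 b a 0 ** G2.opF f"
    using ab by (simp add: matrix_transpose_mul tr DF_zero del: One_nat_def)
  have c: "G2.opF f ** X = X ** G2.opF f" if "X \<in> G2.alg" for X
    using that by (rule G2.opF_commute)
  show ?thesis
    unfolding intertwiner_def
  proof (intro ballI conjI)
    fix i :: nat assume i: "i \<in> {0, 1, 2}"
    show "G2.opF f ** DE h r2 r3 a b i = DE h r2 r3 b a i ** G2.opF f"
    proof (cases "i = 0")
      case False
      then have "DE h r2 r3 a b i \<in> G2.alg" "DE h r2 r3 b a i = DE h r2 r3 a b i"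
        using i G2.alg_intros(1)[of i] DE_const[of i h r2 r3 a b 1 1] DE_const[of i h r2 r3 b a 1 1] by auto
      then show ?thesis using c by simp
    qed (use E0 in simp)
    show "G2.opF f ** DF h r2 r3 a b i = DF h r2 r3 b a i ** G2.opF f"
    proof (cases "i = 0")
      case False
      then have "DF h r2 r3 a b i \<in> G2.alg" "DF h r2 r3 b a i = DF h r2 r3 a b i"
        using i G2.alg_intros(2)[of i] DF_const[of i h r2 r3 a b 1 1] DF_const[of i h r2 r3 b a 1 1] by auto
      then show ?thesis using c by simp
    qed (use F0 in simp)
    show "G2.opF f ** DK q i = DK q i ** G2.opF f" "G2.opF f ** DK (inverse q) i = DK (inverse q) i ** G2.opF f"
      using DK_alg[OF i] c by blast+
  qed
qed

end

section \<open>Rational functions up to finitely many values\<close>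

lemma rational_fun_const: "rational_fun (\<lambda>z. c)"
  unfolding rational_fun_def by (rule exI[of _ "[:c:]"], rule exI[of _ 1]) simp

lemma rational_fun_id: "rational_fun (\<lambda>z. z)"
  unfolding rational_fun_def by (rule exI[of _ "[:0, 1:]"], rule exI[of _ 1]) simp

lemma poly_nonzero_cofinite: "d \<noteq> 0 \<Longrightarrow> \<forall>\<^sub>F z in cofinite. poly d z \<noteq> (0::complex)"
  by (simp add: eventually_cofinite poly_roots_finite)

lemma rational_fun_add:
  assumes "rational_fun f" "rational_fun g"
  shows "rational_fun (\<lambda>z. f z + g z)"
proof -
  obtain p d p' d' where d: "d \<noteq> 0" "\<forall>\<^sub>F z in cofinite. f z = poly p z / poly d z"
    "d' \<noteq> 0" "\<forall>\<^sub>F z in cofinite. g z = poly p' z / poly d' z"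
    using assms unfolding rational_fun_def by blast
  have "\<forall>\<^sub>F z in cofinite. f z + g z = poly (p * d' + p' * d) z / poly (d * d') z"
    using d(2,4) poly_nonzero_cofinite[OF d(1)] poly_nonzero_cofinite[OF d(3)]
    by eventually_elim (simp add: add_frac_eq)
  then show ?thesis unfolding rational_fun_def using d by (intro exI[of _ "p * d' + p' * d"] exI[of _ "d * d'"]) simp
qed

lemma rational_fun_mult:
  assumes "rational_fun f" "rational_fun g"
  shows "rational_fun (\<lambda>z. f z * g z)"
proof -
  obtain p d p' d' where d: "d \<noteq> 0" "\<forall>\<^sub>F z in cofinite. f z = poly p z / poly d z"
    "d' \<noteq> 0" "\<forall>\<^sub>F z in cofinite. g z = poly p' z / poly d' z"
    using assms unfolding rational_fun_def by blast
  have "\<forall>\<^sub>F z in cofinite. f z * g z = poly (p * p') z / poly (d * d') z"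
    using d(2,4) by eventually_elim simp
  then show ?thesis unfolding rational_fun_def using d by (intro exI[of _ "p * p'"] exI[of _ "d * d'"]) simp
qed

lemma rational_fun_inverse:
  assumes "rational_fun f"
  shows "rational_fun (\<lambda>z. inverse (f z))"
proof -
  obtain p d where d: "d \<noteq> 0" "\<forall>\<^sub>F z in cofinite. f z = poly p z / poly d z"
    using assms unfolding rational_fun_def by blast
  show ?thesis
  \<comment> \<open>If f vanishes almost everywhere then so does its inverse, because the inverse of
    0 is 0. This keeps closure under division unconditional.\<close>
  proof (cases "p = 0")
    case True
    then have "\<forall>\<^sub>F z in cofinite. inverse (f z) = poly 0 z / poly 1 z"
      by (intro eventually_mono[OF d(2)]) simp
    then show ?thesis unfolding rational_fun_def by (intro exI[of _ 0] exI[of _ 1]) simp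
  next
    case False
    have "\<forall>\<^sub>F z in cofinite. inverse (f z) = poly d z / poly p z"
      using d(2) by eventually_elim simp
    then show ?thesis unfolding rational_fun_def using False by blast
  qed
qed

lemma rational_fun_divide: "rational_fun f \<Longrightarrow> rational_fun g \<Longrightarrow> rational_fun (\<lambda>z. f z / g z)"
  unfolding divide_inverse by (intro rational_fun_mult rational_fun_inverse)

lemma rational_fun_uminus: "rational_fun f \<Longrightarrow> rational_fun (\<lambda>z. - f z)"
  using rational_fun_mult[OF rational_fun_const[of "-1"], of f] by simp

lemma rational_fun_diff: "rational_fun f \<Longrightarrow> rational_fun g \<Longrightarrow> rational_fun (\<lambda>z. f z - g z)"
  using rational_fun_add[OF _ rational_fun_uminus, of f g] by simp

lemma rational_fun_power: "rational_fun f \<Longrightarrow> rational_fun (\<lambda>z. f z ^ n)"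
  by (induction n) (auto intro: rational_fun_const rational_fun_mult)

lemma rational_fun_sum: "(\<And>i. i \<in> A \<Longrightarrow> rational_fun (f i)) \<Longrightarrow> rational_fun (\<lambda>z. \<Sum>i\<in>A. f i z)"
  by (induction A rule: infinite_finite_induct) (auto intro: rational_fun_const rational_fun_add)

lemmas rational_fun_intros = rational_fun_const rational_fun_id rational_fun_add rational_fun_mult
  rational_fun_divide rational_fun_uminus rational_fun_diff rational_fun_power

lemma rational_fun_cong:
  assumes "rational_fun f" "\<forall>\<^sub>F z in cofinite. g z = f z"
  shows "rational_fun g"
proof -
  obtain p d where d: "d \<noteq> 0" "\<forall>\<^sub>F z in cofinite. f z = poly p z / poly d z"
    using assms(1) unfolding rational_fun_def by blast
  have "\<forall>\<^sub>F z in cofinite. g z = poly p z / poly d z"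
    using d(2) assms(2) by eventually_elim simp
  then show ?thesis using d(1) unfolding rational_fun_def by blast
qed

context contravariant_module
begin

lemma opF_zero: "opF (\<lambda>i k. 0) = 0"
  by (rule opF_eqI[symmetric]) (simp cong: if_cong)

lemma opF_sum:
  "finite P \<Longrightarrow> opF (\<lambda>i k. if (i, k) \<in> P then f i k else 0) =
     (\<Sum>p\<in>P. mat (f (fst p) (snd p)) ** opF (\<lambda>i k. if (i, k) = p then 1 else 0))"
proof (induction rule: finite_induct)
  case empty
  then show ?case by (simp add: opF_zero)
next
  case (insert p P)
  have "opF (\<lambda>i k. if (i, k) \<in> insert p P then f i k else 0) =
      mat (f (fst p) (snd p)) ** opF (\<lambda>i k. if (i, k) = p then 1 else 0) +
      opF (\<lambda>i k. if (i, k) \<in> P then f i k else 0)"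
    unfolding opF_scale opF_add by (rule opF_cong) (use insert(2) in auto)
  then show ?case using insert by simp
qed

text \<open>\<open>opF\<close> is linear in f: the matrix is a finite combination of fixed matrices
  with the entries of f as coefficients.\<close>

lemma rational_opF:
  assumes "\<And>i k. i < m \<Longrightarrow> k < m \<Longrightarrow> rational_fun (\<lambda>z. f z i k)"
  shows "rational_fun (\<lambda>z. opF (f z) $ x $ y)"
proof -
  let ?P = "{..<m} \<times> {..<m}"
  have "opF (f z) = (\<Sum>p\<in>?P. mat (f z (fst p) (snd p)) ** opF (\<lambda>i k. if (i, k) = p then 1 else 0))" for z
  proof -
    have "opF (f z) = opF (\<lambda>i k. if (i, k) \<in> ?P then f z i k else 0)" by (rule opF_cong) auto
    also have "\<dots> = (\<Sum>p\<in>?P. mat (f z (fst p) (snd p)) ** opF (\<lambda>i k. if (i, k) = p then 1 else 0))"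
      by (rule opF_sum) simp
    finally show ?thesis .
  qed
  then have "opF (f z) $ x $ y = (\<Sum>p\<in>?P. f z (fst p) (snd p) * opF (\<lambda>i k. if (i, k) = p then 1 else 0) $ x $ y)" for z
    by (simp add: mat_scal)
  then show ?thesis
    using assms by (auto intro!: rational_fun_sum rational_fun_mult rational_fun_const)
qed

end

section \<open>Uniqueness of the intertwiner\<close>

context D43_parameters
begin

text \<open>The letters A, B, G, Z stand for the weights 2 omega_1, omega_2, omega_1 and 0. In each
  case one coordinate is a product of factors that cannot vanish.\<close>

lemma X_nonzero_BA: "Xop (0, 1) (2, 0) *v sv 1 \<noteq> 0"
  and X_nonzero_GA: "\<forall>i\<in>{2,3,4}. Xop (1, 0) (2, 0) *v sv i \<noteq> 0"
  and X_nonzero_GB: "\<forall>i\<in>{2,3,4}. Xop (1, 0) (0, 1) *v sv i \<noteq> 0"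
  and X_nonzero_BG: "Xop (0, 1) (1, 0) *v sv 1 \<noteq> 0"
  and X_nonzero_GG: "Xop (1, 0) (1, 0) *v sv 2 \<noteq> 0"
  and X_nonzero_ZG: "\<forall>i\<in>{5,6}. Xop (0, 0) (1, 0) *v sv i \<noteq> 0"
proof -
  have co: "Xop \<kappa> \<mu> *v x \<noteq> 0" if "co (Y \<kappa> \<mu> *v x) i j = c" "c \<noteq> 0" for x i j c \<kappa> \<mu>
    using that co_simps(5) by (auto simp: Xop_def mv_simps)
  note s = Y_def mv_simps co_simps co_T
  \<comment> \<open>This factor divides h^12 + 1; it occurs in the coordinate used for
    \<open>BG\<close>.\<close>
  have n: "1 - h ^ 4 + h ^ 8 \<noteq> 0"
  proof
    assume "1 - h ^ 4 + h ^ 8 = 0"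
    then have "(1 - h ^ 4 + h ^ 8) * (1 + h ^ 4) = 0" by simp
    then have "h ^ 12 = - 1" by algebra
    then show False using h_minus[of 12] by simp
  qed
  have BA: "co (Y (0, 1) (2, 0) *v sv 1) 1 4 = h ^ 4 * (1 + h ^ 4) * (1 + h ^ 16)"
    by (simp add: s word1_12 del: One_nat_def, ((simp add: divide_simps)?; algebra?)?)
  have GA2: "co (Y (1, 0) (2, 0) *v sv 2) 1 4 = h ^ 6 * (1 + h ^ 4)"
    by (simp add: s sv_def del: One_nat_def, ((simp add: divide_simps)?; algebra?)?)
  have GA3: "co (Y (1, 0) (2, 0) *v sv 3) 1 8 = (1 + h ^ 4)"
    by (simp add: s sv_def del: One_nat_def, ((simp add: divide_simps)?; algebra?)?)
  have GA4: "co (Y (1, 0) (2, 0) *v sv 4) 8 1 = (1 + h ^ 4)"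
    by (simp add: s sv_def del: One_nat_def, ((simp add: divide_simps)?; algebra?)?)
  have GB2: "co (Y (1, 0) (0, 1) *v sv 2) 4 2 = (1 + h ^ 4)"
    by (simp add: s word2_1 del: One_nat_def, ((simp add: divide_simps)?; algebra?)?)
  have GB3: "co (Y (1, 0) (0, 1) *v sv 3) 2 8 = h\<^sup>2 * (1 + h ^ 4)"
    by (simp add: s word3_1 del: One_nat_def, ((simp add: divide_simps)?; algebra?)?)
  have GB4: "co (Y (1, 0) (0, 1) *v sv 4) 8 2 = h\<^sup>2 * (1 + h ^ 4)"
    by (simp add: s word4_1 del: One_nat_def, ((simp add: divide_simps)?; algebra?)?)
  have BG: "co (Y (0, 1) (1, 0) *v sv 1) 1 7 = (1 - h ^ 4 + h ^ 8) * (1 + h ^ 4)\<^sup>2 * (1 + h ^ 16)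
      * (1 + h ^ 4 + h ^ 8 + h ^ 12 + h ^ 16 + h ^ 20 + h ^ 24) / h ^ 4"
    by (simp add: s word1_12112 word1_21112 del: One_nat_def, ((simp add: divide_simps)?; algebra?)?)
  have GG: "co (Y (1, 0) (1, 0) *v sv 2) 5 3 = (1 + h ^ 4)\<^sup>2 * (1 - h ^ 8 + h ^ 16)
      * (1 + h ^ 4 + h ^ 8 + h ^ 12 + h ^ 16 + h ^ 20 + h ^ 24) / h ^ 6"
    by (simp add: s word2_121 del: One_nat_def, ((simp add: divide_simps)?; algebra?)?)
  have ZG5: "co (Y (0, 0) (1, 0) *v sv 5) 1 7 = h ^ 6 * (1 + h ^ 4)\<^sup>2 * (1 + h ^ 4 + h ^ 8) * (1 + h ^ 16)"
    by (simp add: s sv_def del: One_nat_def, ((simp add: divide_simps)?; algebra?)?)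
  have ZG6: "co (Y (0, 0) (1, 0) *v sv 6) 8 8 = h\<^sup>2 * (1 + h ^ 4) * (1 + h ^ 16)"
    by (simp add: s sv_def del: One_nat_def, ((simp add: divide_simps)?; algebra?)?)
  show "Xop (0, 1) (2, 0) *v sv 1 \<noteq> 0" "Xop (0, 1) (1, 0) *v sv 1 \<noteq> 0" "Xop (1, 0) (1, 0) *v sv 2 \<noteq> 0"
    using n by (intro co[OF BA] co[OF BG] co[OF GG]; simp)+
  show "\<forall>i\<in>{2,3,4}. Xop (1, 0) (2, 0) *v sv i \<noteq> 0"
    using co[OF GA2] co[OF GA3] co[OF GA4] by simp
  show "\<forall>i\<in>{2,3,4}. Xop (1, 0) (0, 1) *v sv i \<noteq> 0"
    using co[OF GB2] co[OF GB3] co[OF GB4] by simp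
  show "\<forall>i\<in>{5,6}. Xop (0, 0) (1, 0) *v sv i \<noteq> 0"
    using co[OF ZG5] co[OF ZG6] by simp
qed

text \<open>A single coordinate need not be a product of cyclotomic factors: the one at (5, 3)
  contains h^20 + h^16 + h^8 + 1, which can vanish for admissible h. The combination of the
  coordinates at (5, 3) and (3, 5) used here is such a product.\<close>

lemma X_nonzero_AG: "Xop (2, 0) (1, 0) *v sv 0 \<noteq> 0"
proof
  assume "Xop (2, 0) (1, 0) *v sv 0 = 0"
  then have Y: "Y (2, 0) (1, 0) *v sv 0 = 0" by (simp add: Xop_def mv_simps)
  note s = Y_def mv_simps co_simps co_T word0_112121 word0_121121 word0_211121
  have "co (Y (2, 0) (1, 0) *v sv 0) 5 3 - h ^ 8 * co (Y (2, 0) (1, 0) *v sv 0) 3 5 =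
      h ^ 12 * (h ^ 4 - 1) * (1 + h ^ 8) * (1 + h ^ 4) * (1 - h ^ 8 + h ^ 16)"
    by (simp add: s del: One_nat_def) (simp add: divide_simps; algebra?)
  then have "h ^ 12 * (h ^ 4 - 1) * (1 + h ^ 8) * (1 + h ^ 4) * (1 - h ^ 8 + h ^ 16) = 0"
    unfolding Y by (simp add: co_simps)
  moreover have "h ^ 4 - 1 \<noteq> 0" "1 + h ^ 8 \<noteq> 0"
    using h_generic[of 4] h_minus[of 8] by (auto simp: eq_neg_iff_add_eq_0 add.commute)
  ultimately show False by simp
qed

text \<open>
  Comparing with the summands \<open>L\<^bsub>2\<omega>1\<^esub>\<close> and \<open>L\<^bsub>\<omega>2\<^esub>\<close> shows that the block of \<open>f\<close> at \<open>\<omega>\<^sub>1\<close> has rank at most 1, with known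
  kernel and image; the entry \<open>(2, 3)\<close> of the matrix equation then makes it vanish.
\<close>

lemma intertwining_unique:
  assumes ab: "a \<noteq> 0" "b \<noteq> 0" "a \<noteq> h ^ 4 * b" "a\<^sup>2 + h ^ 8 * a * b + h ^ 16 * b\<^sup>2 \<noteq> 0" "a\<^sup>2 \<noteq> h ^ 24 * b\<^sup>2"
    and T: "G2.opF f ** DE h r2 r3 a b 0 = DE h r2 r3 b a 0 ** G2.opF f" and f00: "f 0 0 = 0"
  shows "G2.opF f = 0"
proof -
  have E: "opF_eqs a b f i j" if "i < 7" "j < 7" "Xop (cl i) (cl j) *v sv i \<noteq> 0" for i j
    using opF_E0D[OF ab(1,2) T that] .
  note s = opF_eqs_def sum7 Cm_def cl_def
  define t e where "t = 1 + h ^ 4 + h ^ 8" and "e = 1 + h ^ 16"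
  have te: "t \<noteq> 0" "e \<noteq> 0" by (simp_all add: t_def e_def)
  have "opF_eqs a b f 1 0" using X_nonzero_BA by (intro E) (simp_all add: cl_def del: One_nat_def)
  then have "f 1 1 * (h ^ 4 * b - a) = 0" by (simp add: s f00 del: One_nat_def) (simp add: algebra_simps)?
  then have f11: "f 1 1 = 0" using ab(3) by simp
  \<comment> \<open>The equations from the columns 0 and 1, where the right-hand sides vanish with
    \<open>f 0 0\<close> and \<open>f 1 1\<close>: two linear conditions on each row of the block at
    omega_1, which determine its kernel.\<close>
  have row0: "f i 2 * (- (h ^ 6) * a + h ^ 22 * b) + f i 3 * (h ^ 4 * t * e * b) + f i 4 * (t * e * a) = 0"
    and row1: "f i 2 * (h\<^sup>2 * a + h ^ 14 * b) - f i 3 * (e * b) + f i 4 * (e * a) = 0" if "i \<in> {2, 3, 4}" for i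
  proof -
    have "opF_eqs a b f i 0" "opF_eqs a b f i 1"
      using X_nonzero_GA X_nonzero_GB that by (auto intro!: E simp: cl_def simp del: One_nat_def)
    then show "f i 2 * (- (h ^ 6) * a + h ^ 22 * b) + f i 3 * (h ^ 4 * t * e * b) + f i 4 * (t * e * a) = 0"
      "f i 2 * (h\<^sup>2 * a + h ^ 14 * b) - f i 3 * (e * b) + f i 4 * (e * a) = 0"
      unfolding t_def e_def using that
      by (auto simp: s f00 f11 algebra_simps simp del: One_nat_def)
  qed
  \<comment> \<open>Dually, the equations from the rows 0 and 1 put two linear conditions on each
    column of the block, which determine its image.\<close>
  have col0: "(a - h ^ 16 * b) * f 2 j - h\<^sup>2 * t * a * f 3 j - h ^ 6 * t * b * f 4 j = 0"
    and col1: "(h ^ 12 * b + a) * f 2 j + h ^ 6 * a * f 3 j - h ^ 6 * b * f 4 j = 0" if "j \<in> {2, 3, 4}" for j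
  proof -
    have "opF_eqs a b f 0 j" "opF_eqs a b f 1 j"
      using X_nonzero_AG X_nonzero_BG that by (auto intro!: E simp: cl_def simp del: One_nat_def)
    then show "(a - h ^ 16 * b) * f 2 j - h\<^sup>2 * t * a * f 3 j - h ^ 6 * t * b * f 4 j = 0"
      "(h ^ 12 * b + a) * f 2 j + h ^ 6 * a * f 3 j - h ^ 6 * b * f 4 j = 0"
      unfolding t_def e_def using that
      by (auto simp: s f00 f11 algebra_simps simp del: One_nat_def)
  qed
  have "opF_eqs a b f 2 3" using X_nonzero_GG by (intro E) (simp_all add: cl_def del: One_nat_def)
  then have e23: "f 2 2 * (h ^ 20 * b) + f 2 3 * (h ^ 6 * e * a) =
      - (h ^ 10 * (1 - h ^ 4 + h ^ 8) * (a + b)) * f 2 3 + h ^ 20 * a * f 3 3 - h ^ 8 * b * f 4 3"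
    unfolding e_def by (simp add: s del: One_nat_def) (simp add: algebra_simps)
  \<comment> \<open>\<open>N\<close> results from eliminating \<open>f i 4\<close> between the two
    row equations, \<open>X3\<close> and \<open>X4\<close> from eliminating \<open>f 4 j\<close> and
    \<open>f 3 j\<close> between the two column equations.\<close>
  define N where "N = t * (h\<^sup>2 * a + h ^ 14 * b) + h ^ 6 * a - h ^ 22 * b"
  define X3 where "X3 = (a - h ^ 16 * b) - t * (h ^ 12 * b + a)"
  define X4 where "X4 = h ^ 4 * (a - h ^ 16 * b) + t * (h ^ 12 * b + a)"
  have r3: "f i 3 * (t * e * (1 + h ^ 4) * b) = f i 2 * N" if "i \<in> {2, 3, 4}" for i
  proof -
    have "f i 3 * (t * e * (1 + h ^ 4) * b) - f i 2 * N =
        (f i 2 * (- (h ^ 6) * a + h ^ 22 * b) + f i 3 * (h ^ 4 * t * e * b) + f i 4 * (t * e * a))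
        - t * (f i 2 * (h\<^sup>2 * a + h ^ 14 * b) - f i 3 * (e * b) + f i 4 * (e * a))"
      unfolding N_def by algebra
    then show ?thesis unfolding row0[OF that] row1[OF that] by simp
  qed
  have c3: "h\<^sup>2 * t * (1 + h ^ 4) * a * f 3 j = f 2 j * X3"
    and c4: "h ^ 6 * t * (1 + h ^ 4) * b * f 4 j = f 2 j * X4" if "j \<in> {2, 3, 4}" for j
  proof -
    let ?c0 = "(a - h ^ 16 * b) * f 2 j - h\<^sup>2 * t * a * f 3 j - h ^ 6 * t * b * f 4 j"
    let ?c1 = "(h ^ 12 * b + a) * f 2 j + h ^ 6 * a * f 3 j - h ^ 6 * b * f 4 j"
    have "f 2 j * X3 - h\<^sup>2 * t * (1 + h ^ 4) * a * f 3 j = ?c0 - t * ?c1"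
      "f 2 j * X4 - h ^ 6 * t * (1 + h ^ 4) * b * f 4 j = h ^ 4 * ?c0 + t * ?c1"
      unfolding X3_def X4_def by algebra+
    then show "h\<^sup>2 * t * (1 + h ^ 4) * a * f 3 j = f 2 j * X3"
      "h ^ 6 * t * (1 + h ^ 4) * b * f 4 j = f 2 j * X4"
      unfolding col0[OF that] col1[OF that] by simp_all
  qed
  \<comment> \<open>The coefficient of \<open>f 2 3\<close> after \<open>c3\<close> and
    \<open>c4\<close> have been used to remove \<open>f 3 3\<close> and \<open>f 4 3\<close> from
    the multiple of \<open>e23\<close> by \<open>h^2 * t * (1 + h^4)\<close>.\<close>
  define W where "W = h\<^sup>2 * t * (1 + h ^ 4) * (h ^ 6 * e * a + h ^ 10 * (1 - h ^ 4 + h ^ 8) * (a + b))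
    - h ^ 20 * X3 + h ^ 4 * X4"
  have E1: "f 2 2 * (h ^ 20 * (h\<^sup>2 * t * (1 + h ^ 4)) * b) + f 2 3 * W = 0"
  proof -
    have "f 2 2 * (h ^ 20 * (h\<^sup>2 * t * (1 + h ^ 4)) * b) + f 2 3 * W =
        h\<^sup>2 * t * (1 + h ^ 4) * (f 2 2 * (h ^ 20 * b) + f 2 3 * (h ^ 6 * e * a) -
          (- (h ^ 10 * (1 - h ^ 4 + h ^ 8) * (a + b)) * f 2 3 + h ^ 20 * a * f 3 3 - h ^ 8 * b * f 4 3))
        + h ^ 20 * (h\<^sup>2 * t * (1 + h ^ 4) * a * f 3 3 - f 2 3 * X3)
        - h ^ 4 * (h ^ 6 * t * (1 + h ^ 4) * b * f 4 3 - f 2 3 * X4)"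
      unfolding W_def by algebra
    also have "\<dots> = 0" unfolding e23 using c3[of 3] c4[of 3] by simp
    finally show ?thesis .
  qed
  have "f 2 2 * (h ^ 20 * (h\<^sup>2 * t * (1 + h ^ 4)) * b * (t * e * (1 + h ^ 4) * b) + N * W) = 0"
  proof -
    have "f 2 2 * (h ^ 20 * (h\<^sup>2 * t * (1 + h ^ 4)) * b * (t * e * (1 + h ^ 4) * b) + N * W) =
        (f 2 2 * (h ^ 20 * (h\<^sup>2 * t * (1 + h ^ 4)) * b) + f 2 3 * W) * (t * e * (1 + h ^ 4) * b)
        - W * (f 2 3 * (t * e * (1 + h ^ 4) * b) - f 2 2 * N)"
      by algebra
    also have "\<dots> = 0" unfolding E1 using r3[of 2] by simp
    finally show ?thesis .
  qed
  \<comment> \<open>The determinant of the remaining equations for \<open>f 2 2\<close> and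
    \<open>f 2 3\<close>. Apart from nonzero constants it is the quadratic denominator of the
    formula at omega_1.\<close>
  moreover have "h ^ 20 * (h\<^sup>2 * t * (1 + h ^ 4)) * b * (t * e * (1 + h ^ 4) * b) + N * W =
      h ^ 6 * (1 + h ^ 4) ^ 4 * t * e * (a\<^sup>2 + h ^ 8 * a * b + h ^ 16 * b\<^sup>2)"
    unfolding N_def W_def X3_def X4_def t_def e_def by algebra
  ultimately have f22: "f 2 2 = 0" using ab(4) te by simp
  have f2: "f 2 j = 0" if "j \<in> {2, 3, 4}" for j
  proof -
    have 3: "f 2 3 = 0" using r3[of 2] f22 ab te by simp
    then have "f 2 4 = 0" using row1[of 2] f22 ab te by simp
    then show ?thesis using that f22 3 by auto
  qed
  have fG: "f i j = 0" if "i \<in> {2, 3, 4}" "j \<in> {2, 3, 4}" for i j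
    using that f2[OF that(2)] c3[OF that(2)] c4[OF that(2)] ab te by auto
  have fZ: "f i j = 0" if "i \<in> {5, 6}" "j \<in> {5, 6}" for i j
  proof -
    define P where "P = (1 - h ^ 8 + h ^ 16) * (1 + h ^ 4 + h ^ 8 + h ^ 12 + h ^ 16 + h ^ 20 + h ^ 24)"
    have P: "P \<noteq> 0" by (simp add: P_def)
    have "opF_eqs a b f i 3" "opF_eqs a b f i 4"
      using X_nonzero_ZG that by (auto intro!: E simp: cl_def simp del: One_nat_def)
    then have 1: "f i 5 * (h ^ 32 * b) + f i 6 * (P * a) = 0" and 2: "f i 5 * (h ^ 8 * a) + f i 6 * (P * b) = 0"
      unfolding P_def using that fG
      by (auto simp: s algebra_simps simp del: One_nat_def)
    \<comment> \<open>Once the block at omega_1 vanishes, each row of the block at weight 0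
      satisfies a homogeneous 2 by 2 system, whose determinant is a nonzero multiple of a^2 - h^24
      b^2.\<close>
    have "f i 5 * (h ^ 8 * (h ^ 24 * b\<^sup>2 - a\<^sup>2)) =
        b * (f i 5 * (h ^ 32 * b) + f i 6 * (P * a)) - a * (f i 5 * (h ^ 8 * a) + f i 6 * (P * b))"
      by algebra
    then have "f i 5 * (h ^ 8 * (h ^ 24 * b\<^sup>2 - a\<^sup>2)) = 0" unfolding 1 2 by simp
    then have 5: "f i 5 = 0" using ab by simp
    then have "f i 6 = 0" using 1 ab P by simp
    then show ?thesis using that 5 by auto
  qed
  have "\<forall>i<7. \<forall>k<7. cl i = cl k \<longrightarrow> f i k = 0"
    unfolding less7 using f00 f11 fG fZ by (simp add: cl_def del: One_nat_def)
  then have "G2.opF f = G2.opF (\<lambda>i k. 0)" by (intro G2.opF_cong) blast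
  then show ?thesis by (simp only: G2.opF_zero)
qed

end

section \<open>The matrix of the theorem\<close>

context D43_parameters
begin

definition cB :: "complex \<Rightarrow> complex" where
  "cB z = q powi (-2) * ((1 - q powi 2 * z) / (1 - q powi (-2) * z))"

definition cG :: "complex \<Rightarrow> complex" where
  "cG z = q powi (-5) / ((1 - q powi (-2) * z) * (1 + q powi (-4) * z + q powi (-8) * z ^ 2))"

definition cZ :: "complex \<Rightarrow> complex" where
  "cZ z = q powi (-8) / ((1 - q powi (-2) * z) * (1 - q powi (-6) * z) *
     (1 + q powi (-4) * z + q powi (-8) * z ^ 2))"

text \<open>The shifts by 1 and 4 take the positions 2, 3, 4 and 5, 6 of the singular vectors to the
  matrix indices 1, 2, 3 and 1, 2. Entries between different classes are meaningless and ignored by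
  \<open>opF\<close>.\<close>

definition Fm :: "complex \<Rightarrow> nat \<Rightarrow> nat \<Rightarrow> complex" where
  "Fm z i k = (if i = k \<and> cl k = (2, 0) then 1 else 0) - cB z * (if i = k \<and> cl k = (0, 1) then 1 else 0)
     + (if cl k = (1, 0) then (mat (cG z) ** f_omega1 q z) $ of_nat (i - 1) $ of_nat (k - 1) else 0)
     + (if cl k = (0, 0) then (mat (cZ z) ** f_omega0 q z) $ of_nat (i - 4) $ of_nat (k - 4) else 0)"

lemma R_formula_eq:
  "proj_iso q h r2 r3 (2, 0) - mat (cB z) ** proj_iso q h r2 r3 (0, 1)
    + tensor_proj q h r2 r3 (1, 0) (sing1 q h r2 r3) (mat (cG z) ** f_omega1 q z)
    + tensor_proj q h r2 r3 (0, 0) (sing0 q) (mat (cZ z) ** f_omega0 q z) = G2.opF (Fm z)"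
proof -
  define e1 :: "3 \<Rightarrow> nat" where "e1 j = (if j = 1 then 2 else if j = 2 then 3 else 4)" for j
  define e0 :: "2 \<Rightarrow> nat" where "e0 j = (if j = 1 then 5 else 6)" for j
  have cl: "k < 7 \<and> cl k = (1, 0) \<longleftrightarrow> k \<in> {2, 3, 4}" "k < 7 \<and> cl k = (0, 0) \<longleftrightarrow> k \<in> {5, 6}" for k
  proof -
    have "\<forall>k<7. (cl k = (1, 0) \<longleftrightarrow> k \<in> {2, 3, 4}) \<and> (cl k = (0, 0) \<longleftrightarrow> k \<in> {5, 6})"
      unfolding less7 by (simp add: cl_def del: One_nat_def)
    then show "k < 7 \<and> cl k = (1, 0) \<longleftrightarrow> k \<in> {2, 3, 4}" "k < 7 \<and> cl k = (0, 0) \<longleftrightarrow> k \<in> {5, 6}" by auto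
  qed
  have e1: "inj e1" "range e1 = {k. k < 7 \<and> cl k = (1, 0)}"
    unfolding cl inj_def UNIV_3 forall_3 by (auto simp: e1_def)
  have e0: "inj e0" "range e0 = {k. k < 7 \<and> cl k = (0, 0)}"
    unfolding cl inj_def UNIV_2 forall_2 by (auto simp: e0_def)
  have o1: "of_nat (e1 j - 1) = j" for j
  proof -
    have "\<forall>j. of_nat (e1 j - 1) = j" unfolding forall_3 by (simp add: e1_def)
    then show ?thesis by blast
  qed
  have o0: "of_nat (e0 j - 4) = j" for j
  proof -
    have "\<forall>j. of_nat (e0 j - 4) = j" unfolding forall_2 by (simp add: e0_def)
    then show ?thesis by blast
  qed
  have T1: "tensor_proj q h r2 r3 (1, 0) (sing1 q h r2 r3) f =
      G2.opF (\<lambda>i k. if cl k = (1, 0) then f $ of_nat (i - 1) $ of_nat (k - 1) else 0)" for f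
    by (rule tensor_proj_eq[OF e1 _ _, where c = "1 / (r2 * r3)"]) (simp_all add: sing1_sv e1_def[symmetric] o1 del: One_nat_def)
  have T0: "tensor_proj q h r2 r3 (0, 0) (sing0 q) f =
      G2.opF (\<lambda>i k. if cl k = (0, 0) then f $ of_nat (i - 4) $ of_nat (k - 4) else 0)" for f
    by (rule tensor_proj_eq[OF e0 _ _, where c = 1]) (simp_all only: sing0_sv e0_def[symmetric] o0, simp)
  show ?thesis
    unfolding proj_iso_eq T1 T0 G2.opF_scale G2.opF_diff G2.opF_add
    by (rule G2.opF_cong) (simp only: Fm_def)
qed

lemma rational_Fm: "rational_fun (\<lambda>z. Fm z i k)"
proof -
  have "rational_fun (\<lambda>z. f_omega1 q z $ x $ y)" for x y
  proof -
    have "\<forall>x y. rational_fun (\<lambda>z. f_omega1 q z $ x $ y)"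
      unfolding forall_3 f_omega1_def Let_def vector_3 by (intro conjI rational_fun_intros)
    then show ?thesis by blast
  qed
  moreover have "rational_fun (\<lambda>z. f_omega0 q z $ x $ y)" for x y
  proof -
    have "\<forall>x y. rational_fun (\<lambda>z. f_omega0 q z $ x $ y)"
      unfolding forall_2 f_omega0_def Let_def vector_2 by (intro conjI rational_fun_intros)
    then show ?thesis by blast
  qed
  moreover have "rational_fun cB" "rational_fun cG" "rational_fun cZ"
    unfolding cB_def cG_def cZ_def by (intro rational_fun_intros)+
  moreover have rational_fun_if: "rational_fun (\<lambda>z. if P then f z else 0)" if "rational_fun f" for P f
    using that by (cases P) (simp_all add: rational_fun_const)
  ultimately show ?thesis
    unfolding Fm_def mat_scal vec_lambda_beta
    by (intro rational_fun_intros rational_fun_if)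
qed

lemma coefficients:
  "c_beta q = (h ^ 12 - 1) / (h ^ 4 * (1 + h ^ 4))"
  "c_eta q = (h ^ 12 - 1) / (h ^ 4 * (1 + h ^ 4))"
  "c_alpha q = (h ^ 4 - 1) * (h ^ 12 - 1) / (h ^ 6 * (1 + h ^ 4))"
  "c_gamma q = (h ^ 12 - 1) * (1 + h ^ 16) / (h ^ 12 * (1 + h ^ 4))"
  "c_kappa q = (1 + h ^ 8) / (h\<^sup>2 * (1 + h ^ 4))"
  "c_zeta q = (1 + h ^ 16) / (h ^ 6 * (1 + h ^ 4))"
  "c_rho q = (h ^ 12 - 1) * (1 - h ^ 8 + h ^ 16) * (1 + h ^ 4 + h ^ 8 + h ^ 12 + h ^ 16 + h ^ 20 + h ^ 24)
     / (h ^ 24 * (1 + h ^ 4))"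
  "c_xi q = (h ^ 4 - 1) * (h ^ 12 - 1) * (1 + h ^ 16) / h ^ 16"
proof -
  have *: "a + b = 0 \<Longrightarrow> b = - a" for a b :: complex by (simp add: eq_neg_iff_add_eq_0 add.commute)
  have nz: "h ^ 4 - 1 \<noteq> 0" "h ^ 8 - 1 \<noteq> 0" "h ^ 16 - 1 \<noteq> 0" "1 + h ^ 12 \<noteq> 0" "1 + h ^ 8 \<noteq> 0"
    using h_generic[of 4] h_generic[of 8] h_generic[of 16] h_minus[of 12] h_minus[of 8] * by auto
  have pw: "q ^ n = h ^ (2 * n)" for n by (simp add: h_square[symmetric] power_mult)
  have q: "q = h\<^sup>2" by (simp add: h_square)
  have qint_2: "qint q 1 2 = (1 + h ^ 4) / h\<^sup>2"
  proof -
    have "qint q 1 2 = (h ^ 4 - 1 / h ^ 4) / (h\<^sup>2 - 1 / h\<^sup>2)"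
      by (simp add: qint_def power_int_minus pw inverse_eq_divide) (simp add: q)
    also have "\<dots> = (1 + h ^ 4) / h\<^sup>2"
    proof -
      have "h\<^sup>2 - 1 / h\<^sup>2 = (h ^ 4 - 1) / h\<^sup>2" by (simp add: divide_simps)
      then show ?thesis using nz by (simp add: divide_simps) algebra
    qed
    finally show ?thesis .
  qed
  have qint_7: "qint q 1 7 = (1 + h ^ 4 + h ^ 8 + h ^ 12 + h ^ 16 + h ^ 20 + h ^ 24) / h ^ 12"
  proof -
    have "qint q 1 7 = (h ^ 14 - 1 / h ^ 14) / (h\<^sup>2 - 1 / h\<^sup>2)"
      by (simp add: qint_def power_int_minus pw inverse_eq_divide) (simp add: q)
    also have "\<dots> = (1 + h ^ 4 + h ^ 8 + h ^ 12 + h ^ 16 + h ^ 20 + h ^ 24) / h ^ 12"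
    proof -
      have "h\<^sup>2 - 1 / h\<^sup>2 = (h ^ 4 - 1) / h\<^sup>2" by (simp add: divide_simps)
      then show ?thesis using nz by (simp add: divide_simps) algebra
    qed
    finally show ?thesis .
  qed
  have qint_22: "qint q 2 2 = (1 + h ^ 8) / h ^ 4"
  proof -
    have "qint q 2 2 = (h ^ 8 - 1 / h ^ 8) / (h ^ 4 - 1 / h ^ 4)"
      by (simp add: qint_def power_int_minus pw inverse_eq_divide)
    also have "\<dots> = (1 + h ^ 8) / h ^ 4"
    proof -
      have "h ^ 4 - 1 / h ^ 4 = (h ^ 8 - 1) / h ^ 4" by (simp add: divide_simps) algebra?
      then show ?thesis using nz by (simp add: divide_simps) algebra
    qed
    finally show ?thesis .
  qed
  have qint_42: "qint q 4 2 = (1 + h ^ 16) / h ^ 8"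
  proof -
    have "qint q 4 2 = (h ^ 16 - 1 / h ^ 16) / (h ^ 8 - 1 / h ^ 8)"
      by (simp add: qint_def power_int_minus pw inverse_eq_divide)
    also have "\<dots> = (1 + h ^ 16) / h ^ 8"
    proof -
      have "h ^ 8 - 1 / h ^ 8 = (h ^ 16 - 1) / h ^ 8" by (simp add: divide_simps) algebra?
      then show ?thesis using nz by (simp add: divide_simps) algebra
    qed
    finally show ?thesis .
  qed
  have qi_12: "qint_i q 1 2 = (h ^ 4 - 1) / h\<^sup>2"
  proof -
    have "qint_i q 1 2 = (h ^ 4 - 1 / h ^ 4) / (h\<^sup>2 + 1 / h\<^sup>2)"
      by (simp add: qint_i_def power_int_minus pw inverse_eq_divide) (simp add: q)
    also have "\<dots> = (h ^ 4 - 1) / h\<^sup>2"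
    proof -
      have "h\<^sup>2 + 1 / h\<^sup>2 = (1 + h ^ 4) / h\<^sup>2" by (simp add: divide_simps)
      then show ?thesis by (simp add: divide_simps) algebra
    qed
    finally show ?thesis .
  qed
  have qi_32: "qint_i q 3 2 = (h ^ 12 - 1) / h ^ 6"
  proof -
    have "qint_i q 3 2 = (h ^ 12 - 1 / h ^ 12) / (h ^ 6 + 1 / h ^ 6)"
      by (simp add: qint_i_def power_int_minus pw inverse_eq_divide)
    also have "\<dots> = (h ^ 12 - 1) / h ^ 6"
    proof -
      have "h ^ 6 + 1 / h ^ 6 = (1 + h ^ 12) / h ^ 6" by (simp add: divide_simps) algebra?
      then show ?thesis using nz by (simp add: divide_simps) algebra
    qed
    finally show ?thesis .
  qed
  have qi_23: "qint_i q 2 3 = (1 - h ^ 8 + h ^ 16) / h ^ 8"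
  proof -
    have "qint_i q 2 3 = (h ^ 12 + 1 / h ^ 12) / (h ^ 4 + 1 / h ^ 4)"
      by (simp add: qint_i_def power_int_minus pw inverse_eq_divide)
    also have "\<dots> = (1 - h ^ 8 + h ^ 16) / h ^ 8"
    proof -
      have "h ^ 4 + 1 / h ^ 4 = (1 + h ^ 8) / h ^ 4" by (simp add: divide_simps) algebra?
      then show ?thesis using nz by (simp add: divide_simps) algebra
    qed
    finally show ?thesis .
  qed
  show "c_beta q = (h ^ 12 - 1) / (h ^ 4 * (1 + h ^ 4))"
    "c_eta q = (h ^ 12 - 1) / (h ^ 4 * (1 + h ^ 4))"
    "c_alpha q = (h ^ 4 - 1) * (h ^ 12 - 1) / (h ^ 6 * (1 + h ^ 4))"
    "c_gamma q = (h ^ 12 - 1) * (1 + h ^ 16) / (h ^ 12 * (1 + h ^ 4))"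
    "c_kappa q = (1 + h ^ 8) / (h\<^sup>2 * (1 + h ^ 4))"
    "c_zeta q = (1 + h ^ 16) / (h ^ 6 * (1 + h ^ 4))"
    "c_rho q = (h ^ 12 - 1) * (1 - h ^ 8 + h ^ 16) * (1 + h ^ 4 + h ^ 8 + h ^ 12 + h ^ 16 + h ^ 20 + h ^ 24)
       / (h ^ 24 * (1 + h ^ 4))"
    "c_xi q = (h ^ 4 - 1) * (h ^ 12 - 1) * (1 + h ^ 16) / h ^ 16"
    unfolding c_beta_def c_eta_def c_alpha_def c_gamma_def c_kappa_def c_zeta_def c_rho_def c_xi_def
      qint_2 qint_7 qint_22 qint_42 qi_12 qi_32 qi_23
    by (simp add: divide_simps; algebra?)+
qed

text \<open>The entries of the \<open>R\<close>-matrix at \<open>z = a / b\<close>, as homogeneous rational functions of \<open>a\<close> and \<open>b\<close>.\<close>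

definition Ff :: "complex \<Rightarrow> complex \<Rightarrow> nat \<Rightarrow> nat \<Rightarrow> complex" where
  "Ff a b i k = (let
      dG = (1 + h ^ 4) * (h ^ 4 * b - a) * (a\<^sup>2 + h ^ 8 * a * b + h ^ 16 * b\<^sup>2);
      dZ = dG * (h ^ 12 * b - a);
      g1 = ((1 + h ^ 4) * (h ^ 16 * a ^ 3 - h ^ 4 * b ^ 3) + (h ^ 4 - 1) * (h ^ 12 - 1) * (h ^ 8 * a\<^sup>2 * b - a * b\<^sup>2)) / dG;
      g2 = h ^ 6 * (h ^ 12 - 1) * a * b * (b - a) / dG;
      g3 = (h ^ 12 - 1) * (1 + h ^ 16) * a * b * (b - a) / (h\<^sup>2 * dG);
      g4 = (h ^ 12 - 1) * a * b * (h ^ 12 * b + a) / dG;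
      g5 = (b - a) * ((1 + h ^ 4) * (h ^ 16 * b\<^sup>2 + h ^ 4 * a\<^sup>2) + h ^ 8 * (1 + h ^ 8) * a * b) / dG;
      x = (1 + h ^ 4) * (h ^ 4 - 1) * (h ^ 12 - 1) * (1 + h ^ 16) * a\<^sup>2 * b\<^sup>2;
      w1 = ((1 + h ^ 4) * (h ^ 4 * b ^ 4 + h ^ 28 * a ^ 4) - (1 + h ^ 16) * (h ^ 4 * a * b ^ 3 + h ^ 16 * a ^ 3 * b) + x) / dZ;
      w2 = h ^ 12 * (h ^ 12 - 1) * a * b * (b\<^sup>2 - a\<^sup>2) / dZ;
      w3 = (h ^ 12 - 1) * (1 - h ^ 8 + h ^ 16) * (1 + h ^ 4 + h ^ 8 + h ^ 12 + h ^ 16 + h ^ 20 + h ^ 24)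
        * a * b * (b\<^sup>2 - a\<^sup>2) / (h ^ 8 * dZ);
      w4 = ((1 + h ^ 4) * (h ^ 28 * b ^ 4 + h ^ 4 * a ^ 4) - (1 + h ^ 16) * (h ^ 16 * a * b ^ 3 + h ^ 4 * a ^ 3 * b) + x) / dZ
    in [[1, 0, 0, 0, 0, 0, 0],
        [0, - (b - h ^ 4 * a) / (h ^ 4 * b - a), 0, 0, 0, 0, 0],
        [0, 0, g1, g2, g2, 0, 0],
        [0, 0, g3, g4, g5, 0, 0],
        [0, 0, g3, g5, g4, 0, 0],
        [0, 0, 0, 0, 0, w1, w2],
        [0, 0, 0, 0, 0, w3, w4]] ! i ! k)"

text \<open>The factors of the denominators of \<open>Ff\<close>, and in addition h^12 b + a: it is
  no pole, but it divides the determinant a^2 - h^24 b^2 of the uniqueness argument at weight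
  0.\<close>

definition regular :: "complex \<Rightarrow> complex \<Rightarrow> bool" where
  "regular a b \<longleftrightarrow> a \<noteq> 0 \<and> b \<noteq> 0 \<and> h ^ 4 * b - a \<noteq> 0 \<and> h ^ 12 * b - a \<noteq> 0 \<and> h ^ 12 * b + a \<noteq> 0 \<and>
     a\<^sup>2 + h ^ 8 * a * b + h ^ 16 * b\<^sup>2 \<noteq> 0"

text \<open>The symmetry that \<open>opF_transpose\<close> asks for. It accounts for the ratios of
  the off-diagonal constants: \<open>c_gamma q / c_beta q\<close> is [2]_4 =
  \<open>nrm 2 / nrm 3\<close>, and \<open>c_rho q / c_eta q\<close> is
  \<open>nrm 5\<close>.\<close>

lemma Ff_sym:
  assumes "regular a b"
  shows "\<forall>i<7. \<forall>k<7. Ff a b i k * nrm i = Ff a b k i * nrm k"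
proof -
  define u v w where "u = h ^ 4 * b - a" and "v = h ^ 12 * b - a" and "w = a\<^sup>2 + h ^ 8 * a * b + h ^ 16 * b\<^sup>2"
  have nz: "u \<noteq> 0" "v \<noteq> 0" "w \<noteq> 0" using assms by (simp_all add: regular_def u_def v_def w_def)
  show ?thesis
    unfolding less7
    by (intro conjI; simp add: Ff_def Let_def nrm_def u_def[symmetric] v_def[symmetric] w_def[symmetric] nz
        del: One_nat_def; (simp add: nz divide_simps)?; algebra?)
qed

lemma Ff_eqs:
  assumes "regular a b"
  shows "\<forall>i<7. \<forall>j<7. opF_eqs a b (Ff a b) i j"
proof -
  \<comment> \<open>Naming the denominators keeps them as atoms while fractions are cleared; they
    are unfolded only for the final polynomial identities.\<close>
  define u v w where "u = h ^ 4 * b - a" and "v = h ^ 12 * b - a" and "w = a\<^sup>2 + h ^ 8 * a * b + h ^ 16 * b\<^sup>2"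
  have nz: "u \<noteq> 0" "v \<noteq> 0" "w \<noteq> 0" using assms by (simp_all add: regular_def u_def v_def w_def)
  show ?thesis
    unfolding less7
    by (intro conjI; simp add: opF_eqs_def sum7 cl_def Cm_def Ff_def Let_def u_def[symmetric] v_def[symmetric]
        w_def[symmetric] nz del: One_nat_def; (simp add: nz divide_simps)?; (unfold u_def v_def w_def)?; algebra?)
qed

end

section \<open>Identification with the R-matrix\<close>

context D43_parameters
begin

lemma Fm_eq:
  assumes r: "regular a b"
  shows "\<forall>i<7. \<forall>k<7. cl i = cl k \<longrightarrow> Fm (a / b) i k = Ff a b i k"
proof -
  define u v w where "u = h ^ 4 * b - a" and "v = h ^ 12 * b - a" and "w = a\<^sup>2 + h ^ 8 * a * b + h ^ 16 * b\<^sup>2"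
  have nz: "u \<noteq> 0" "v \<noteq> 0" "w \<noteq> 0" "b \<noteq> 0" using assms by (simp_all add: regular_def u_def v_def w_def)
  have pw: "q ^ n = h ^ (2 * n)" for n by (simp add: h_square[symmetric] power_mult)
  have f: "1 - q powi (-2) * (a / b) = u / (h ^ 4 * b)" "1 - q powi (-6) * (a / b) = v / (h ^ 12 * b)"
    "1 + q powi (-4) * (a / b) + q powi (-8) * (a / b) ^ 2 = w / (h ^ 16 * b\<^sup>2)"
    using nz(4) by (simp_all add: power_int_minus pw inverse_eq_divide)
      (simp_all add: u_def v_def w_def divide_simps, algebra+)
  have cB: "cB (a / b) = (b - h ^ 4 * a) / u"
    unfolding cB_def f using nz by (simp add: power_int_minus pw inverse_eq_divide) (simp add: divide_simps)
  have cG: "cG (a / b) = h ^ 10 * b ^ 3 / (u * w)"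
    unfolding cG_def f using nz by (simp add: power_int_minus pw inverse_eq_divide) (simp add: divide_simps, algebra)
  have cZ: "cZ (a / b) = h ^ 16 * b ^ 4 / (u * v * w)"
    unfolding cZ_def f using nz by (simp add: power_int_minus pw inverse_eq_divide) ((simp add: divide_simps)?, algebra)
  have qp: "q powi (-2) = 1 / h ^ 4" "q powi 2 = h ^ 4" "q powi 3 = h ^ 6" "q powi (-3) = 1 / h ^ 6"
    "q powi 6 = h ^ 12" "q powi (-6) = 1 / h ^ 12"
    by (simp_all add: power_int_minus pw inverse_eq_divide)
  show ?thesis
    unfolding less7
    by (intro conjI impI; simp add: cl_def Fm_def cB cG cZ mat_scal f_omega1_def f_omega0_def Let_def qp coefficients
        Ff_def u_def[symmetric] v_def[symmetric] w_def[symmetric] del: One_nat_def power_int_numeral;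
        (simp add: nz divide_simps)?; (rule disjI2)?; algebra?)
qed

lemma R_intertwiner:
  assumes r: "regular a b"
  shows "intertwiner q h r2 r3 a b (G2.opF (Fm (a / b)))"
    and "G2.opF (Fm (a / b)) *v vv 1 1 = vv 1 1"
proof -
  have ab: "a \<noteq> 0" "b \<noteq> 0" using r by (simp_all add: regular_def)
  \<comment> \<open>All conditions in \<open>regular\<close> are homogeneous in (a, b), so they
    depend only on the ratio; this is needed at (1 / b, 1 / a) as well.\<close>
  have regular: "regular a' b'" if "a' \<noteq> 0" "b' \<noteq> 0" "a' / b' = a / b" for a' b'
  proof -
    define c where "c = b' / b"
    have c: "c \<noteq> 0" "b' = c * b" "a' = c * a" using that ab by (simp_all add: c_def field_simps)
    have "h ^ 4 * b' - a' = c * (h ^ 4 * b - a)" "h ^ 12 * b' - a' = c * (h ^ 12 * b - a)"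
      "h ^ 12 * b' + a' = c * (h ^ 12 * b + a)"
      "a'\<^sup>2 + h ^ 8 * a' * b' + h ^ 16 * b'\<^sup>2 = c\<^sup>2 * (a\<^sup>2 + h ^ 8 * a * b + h ^ 16 * b\<^sup>2)"
      unfolding c by algebra+
    then show ?thesis using r that c(1) by (simp add: regular_def)
  qed
  have eqs: "\<forall>i<7. \<forall>j<7. opF_eqs a' b' (Fm (a / b)) i j" if "a' \<noteq> 0" "b' \<noteq> 0" "a' / b' = a / b" for a' b'
  proof (intro allI impI)
    fix i j :: nat assume ij: "i < 7" "j < 7"
    note r' = regular[OF that]
    have F: "Fm (a / b) i k = Ff a' b' i k" if "i < 7" "k < 7" "cl i = cl k" for i k
      using Fm_eq[OF r'] that \<open>a' / b' = a / b\<close> by simp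
    have 1: "(\<Sum>k<7. if cl i = cl k then Fm (a / b) i k * Cm a' b' k j else 0) =
        (\<Sum>k<7. if cl i = cl k then Ff a' b' i k * Cm a' b' k j else 0)"
      using F ij by (intro sum.cong) auto
    have 2: "(\<Sum>k<7. if cl k = cl j then Cm b' a' i k * Fm (a / b) k j else 0) =
        (\<Sum>k<7. if cl k = cl j then Cm b' a' i k * Ff a' b' k j else 0)"
      using F ij by (intro sum.cong) auto
    have "opF_eqs a' b' (Ff a' b') i j" using Ff_eqs[OF r'] ij by blast
    then show "opF_eqs a' b' (Fm (a / b)) i j"
      unfolding opF_eqs_def 1 2 .
  qed
  show "intertwiner q h r2 r3 a b (G2.opF (Fm (a / b)))"
  proof (rule opF_intertwiner[OF ab eqs])
    fix i k :: nat assume ik: "i < 7" "k < 7" "cl i = cl k"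
    have "Fm (a / b) i k = Ff a b i k" "Fm (a / b) k i = Ff a b k i"
      using Fm_eq[OF r] ik by auto
    then show "Fm (a / b) i k * nrm i = Fm (a / b) k i * nrm k"
      using Ff_sym[OF r] ik by simp
  qed
  have "G2.opF (Fm (a / b)) *v sv 0 = (\<Sum>i<7. if cl i = cl 0 then Fm (a / b) i 0 *s sv i else 0)"
    by (rule G2.opF_u) simp
  also have "\<dots> = sv 0"
    using Fm_eq[OF r] by (simp add: sum7 cl_def Ff_def Let_def)
  finally show "G2.opF (Fm (a / b)) *v vv 1 1 = vv 1 1"
    by (simp add: sv_def T_vv sc_def)
qed

text \<open>The difference D commutes with U_q(G_2), so it is \<open>opF f\<close> for some f by
  Schur's lemma. The common normalization gives \<open>f 0 0 = 0\<close>, and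
  \<open>intertwining_unique\<close> then forces D to vanish.\<close>

lemma R_unique:
  assumes r: "regular a b"
    and S: "intertwiner q h r2 r3 a b S" "S *v vv 1 1 = vv 1 1"
    and V: "intertwiner q h r2 r3 a b V" "V *v vv 1 1 = vv 1 1"
  shows "S = V"
proof -
  have comm: "U ** X = X ** U" if U: "intertwiner q h r2 r3 a b U" and "X \<in> G2.alg" for U X
    using that(2)
  proof -
    have c: "U ** DE h r2 r3 a b i = DE h r2 r3 b a i ** U" "U ** DF h r2 r3 a b i = DF h r2 r3 b a i ** U"
      "U ** DK q i = DK q i ** U" "U ** DK (inverse q) i = DK (inverse q) i ** U" if "i \<in> {1, 2}" for i
    proof -
      have "i \<in> {0, 1, 2}" using that by blast
      note * = bspec[OF U[unfolded intertwiner_def] this]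
      show "U ** DE h r2 r3 a b i = DE h r2 r3 b a i ** U" using * by (elim conjE)
      show "U ** DF h r2 r3 a b i = DF h r2 r3 b a i ** U" using * by (elim conjE)
      show "U ** DK q i = DK q i ** U" using * by (elim conjE)
      show "U ** DK (inverse q) i = DK (inverse q) i ** U" using * by (elim conjE)
    qed
    show ?thesis
      using \<open>X \<in> G2.alg\<close>
    proof (induction rule: G2.alg_induct)
      case (E i)
      then have i: "i \<noteq> 0" by auto
      show ?case using c(1)[OF E]
        unfolding DE_const[OF i, of h r2 r3 a b 1 1] DE_const[OF i, of h r2 r3 b a 1 1] .
    next
      case (F i)
      then have i: "i \<noteq> 0" by auto
      show ?case using c(2)[OF F]
        unfolding DF_const[OF i, of h r2 r3 a b 1 1] DF_const[OF i, of h r2 r3 b a 1 1] .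
    next
      case (mult X Y)
      have "U ** (X ** Y) = (X ** U) ** Y" by (simp only: matrix_mul_assoc mult.IH(1))
      also have "\<dots> = X ** (Y ** U)" unfolding mult.IH(2)[symmetric] by (rule matrix_mul_assoc[symmetric])
      finally show ?case by (simp only: matrix_mul_assoc)
    next
      case (K i)
      then show ?case by (rule c(3))
    next
      case (K' i)
      then show ?case by (rule c(4))
    next
      case (scalar d)
      show ?case by (rule mat_commute[symmetric])
    next
      case (add X Y)
      show ?case by (simp only: madd add.IH)
    qed
  qed
  define D where "D = S - V"
  have diff: "(S - V) ** X = S ** X - V ** X" "X ** (S - V) = X ** S - X ** V" for X
    by (simp_all add: vec_eq_iff matrix_matrix_mult_def left_diff_distrib right_diff_distrib sum_subtractf)
  have "D ** X = X ** D" if "X \<in> G2.alg" for X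
    unfolding D_def diff comm[OF S(1) that] comm[OF V(1) that] ..
  note D = G2.commuting_opF[OF this]
  define f where "f i k = bdot (sv i) (D *v sv k) / bdot (sv i) (sv i)" for i k
  have f: "D = G2.opF f" unfolding f_def by (rule D)
  have "vv 1 1 = sv 0" by (simp add: sv_def T_vv sc_def)
  then have "D *v sv 0 = 0" using S(2) V(2) by (simp add: D_def matrix_vector_mult_diff_rdistrib)
  then have f00: "f 0 0 = 0" by (simp add: f_def bdot_simps)
  have E0: "S ** DE h r2 r3 a b 0 = DE h r2 r3 b a 0 ** S" "V ** DE h r2 r3 a b 0 = DE h r2 r3 b a 0 ** V"
    using S(1) V(1) unfolding intertwiner_def by blast+
  have "D ** DE h r2 r3 a b 0 = DE h r2 r3 b a 0 ** D"
    unfolding D_def diff E0 ..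
  note E = this[unfolded f]
  have ne: "a\<^sup>2 \<noteq> h ^ 24 * b\<^sup>2"
  proof
    assume "a\<^sup>2 = h ^ 24 * b\<^sup>2"
    then have "(h ^ 12 * b - a) * (h ^ 12 * b + a) = 0" by algebra
    then show False using r by (simp add: regular_def)
  qed
  have ab: "a \<noteq> 0" "b \<noteq> 0" "a \<noteq> h ^ 4 * b" "a\<^sup>2 + h ^ 8 * a * b + h ^ 16 * b\<^sup>2 \<noteq> 0"
    using r unfolding regular_def by auto
  have "D = 0" unfolding f by (rule intertwining_unique[OF ab ne E f00])
  then show ?thesis by (simp add: D_def)
qed

definition bad :: "complex set" where
  "bad = insert (h ^ 4) (insert (h ^ 12) (insert (- (h ^ 12)) {z. poly [:h ^ 16, h ^ 8, 1:] z = 0}))"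

lemma finite_bad: "finite bad"
  by (simp only: bad_def finite_insert) (rule poly_roots_finite, simp)

lemma regular_generic:
  assumes "a \<noteq> 0" "b \<noteq> 0" "a / b \<notin> bad"
  shows "regular a b"
proof -
  have "h ^ 4 * b - a \<noteq> 0" "h ^ 12 * b - a \<noteq> 0" "h ^ 12 * b + a \<noteq> 0"
    using assms by (auto simp: bad_def field_simps eq_neg_iff_add_eq_0)
  moreover have "a\<^sup>2 + h ^ 8 * a * b + h ^ 16 * b\<^sup>2 = b\<^sup>2 * poly [:h ^ 16, h ^ 8, 1:] (a / b)"
    using assms(2) by (simp add: field_simps power2_eq_square)
  ultimately show ?thesis using assms by (simp add: regular_def bad_def)
qed

text \<open>Off \<open>bad\<close> the formula is a normalized intertwiner, so the uniqueness clause
  in \<open>is_R_matrix\<close> makes any R-matrix agree with it. Conversely,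
  \<open>R_unique\<close> supplies that clause for the formula.\<close>

lemma is_R_matrix_iff: "is_R_matrix q h r2 r3 R \<longleftrightarrow> (\<forall>\<^sub>F z in cofinite. R z = G2.opF (Fm z))"
proof
  assume "is_R_matrix q h r2 r3 R"
  then obtain S where "finite S" and S: "\<forall>a b. a \<noteq> 0 \<and> b \<noteq> 0 \<and> a / b \<notin> S \<longrightarrow>
      intertwiner q h r2 r3 a b (R (a / b)) \<and> R (a / b) *v vv 1 1 = vv 1 1 \<and>
      (\<forall>T. intertwiner q h r2 r3 a b T \<and> T *v vv 1 1 = vv 1 1 \<longrightarrow> T = R (a / b))"
    unfolding is_R_matrix_def by (elim conjE exE)
  \<comment> \<open>The ratio z is realized by a = z and b = 1, which requires z to be
    nonzero.\<close>
  have "R z = G2.opF (Fm z)" if "z \<notin> insert 0 (S \<union> bad)" for z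
  proof -
    have r: "regular z 1" using that by (intro regular_generic) auto
    have "z \<noteq> 0 \<and> (1::complex) \<noteq> 0 \<and> z / 1 \<notin> S" using that by simp
    note * = S[THEN spec, THEN spec, THEN mp, OF this, THEN conjunct2, THEN conjunct2]
    have "G2.opF (Fm (z / 1)) = R (z / 1)"
      by (rule *[THEN spec, THEN mp, OF conjI, OF R_intertwiner[OF r]])
    then show ?thesis by simp
  qed
  then have "{z. R z \<noteq> G2.opF (Fm z)} \<subseteq> insert 0 (S \<union> bad)" by blast
  then show "\<forall>\<^sub>F z in cofinite. R z = G2.opF (Fm z)"
    unfolding eventually_cofinite using \<open>finite S\<close> finite_bad by (meson finite_UnI finite_insert finite_subset)
next
  assume R: "\<forall>\<^sub>F z in cofinite. R z = G2.opF (Fm z)"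
  \<comment> \<open>The exceptional set absorbs the finitely many points at which R deviates from
    the formula.\<close>
  define S where "S = {z. R z \<noteq> G2.opF (Fm z)} \<union> bad"
  show "is_R_matrix q h r2 r3 R"
    unfolding is_R_matrix_def
  proof (intro conjI allI exI[of _ S] impI)
    show "rational_fun (\<lambda>z. R z $ k $ l)" for k l
      by (rule rational_fun_cong[OF G2.rational_opF[OF rational_Fm]])
        (use R in \<open>rule eventually_mono; simp\<close>)
    show "finite S" using R finite_bad by (simp add: S_def eventually_cofinite)
    fix a b assume ab: "a \<noteq> 0 \<and> b \<noteq> 0 \<and> a / b \<notin> S"
    then have r: "regular a b" by (intro regular_generic) (auto simp: S_def)
    have eq: "R (a / b) = G2.opF (Fm (a / b))" using ab by (simp add: S_def)
    show "intertwiner q h r2 r3 a b (R (a / b))" "R (a / b) *v vv 1 1 = vv 1 1"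
      unfolding eq by (rule R_intertwiner[OF r])+
    fix V assume "intertwiner q h r2 r3 a b V \<and> V *v vv 1 1 = vv 1 1"
    then show "V = R (a / b)"
      unfolding eq by (elim conjE) (rule R_unique[OF r _ _ R_intertwiner[OF r]])
  qed
qed

end

theorem theorem4p7:
  fixes q h r2 r3 :: complex
    and R :: "complex \<Rightarrow> complex^(8 \<times> 8)^(8 \<times> 8)"
  assumes "q \<noteq> 0"
    and "\<And>n :: nat. n > 0 \<Longrightarrow> q ^ n \<noteq> 1"
    and "h\<^sup>2 = q"
    and "r2\<^sup>2 = qint q 1 2"
    and "r3\<^sup>2 = qint q 1 3"
  shows "is_R_matrix q h r2 r3 R \<longleftrightarrow>
    (\<forall>\<^sub>F z in cofinite. R z =
       proj_iso q h r2 r3 (2, 0)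
       - mat (q powi (-2) * ((1 - q powi 2 * z) / (1 - q powi (-2) * z))) **
           proj_iso q h r2 r3 (0, 1)
       + tensor_proj q h r2 r3 (1, 0) (sing1 q h r2 r3)
           (mat (q powi (-5) /
                 ((1 - q powi (-2) * z) * (1 + q powi (-4) * z + q powi (-8) * z ^ 2))) **
            f_omega1 q z)
       + tensor_proj q h r2 r3 (0, 0) (sing0 q)
           (mat (q powi (-8) /
                 ((1 - q powi (-2) * z) * (1 - q powi (-6) * z) *
                  (1 + q powi (-4) * z + q powi (-8) * z ^ 2))) **
            f_omega0 q z))"
proof -
  interpret D43_parameters q h r2 r3
    using assms by unfold_locales
  show ?thesis
    unfolding is_R_matrix_iff R_formula_eq[symmetric] cB_def cG_def cZ_def ..
qed

end
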